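(* Fix $c>0$ and let $\mu(\cdot;k)$, $k\in(0,\sqrt c/2)$, be the smooth solitary waves (momentum densities) of the Novikov equation described in the context. The function $k\mapsto\mathcal{F}(\mu(\cdot;k))$ is strictly positive for $k\in(0,\sqrt c/2)$. In particular, for a wave $\mu=\mu(\cdot;k)$ whose associated operator $\mathcal{L}$ satisfies the spectral assumption (A) of the context, a sufficient condition for $$\left\langle\mathcal{L}^{-1}\frac{\delta\mathcal{F}}{\delta m}(\mu),\frac{\delta\mathcal{F}}{\delta m}(\mu)\right\rangle<0$$ to hold is that $$\frac{\partial}{\partial k}\mathcal{F}(\mu(\cdot;k))<0.$$
   Context: Setting: for fixed $c>0$ and $k\in(0,\sqrt c/2)$, set $a=k(c-k^2)^{3/2}$ and $E=\frac{k^2(c-2k^2)}{2c}$; $\phi=\phi(\cdot;k)$ denotes the unique nonconstant smooth even function on $\mathbb{R}$ with $\phi'(0)=0$, $\phi(x)\to k$ as $x\to\pm\infty$ (exponentially fast, together with decay of all derivatives), $\phi^2<c$, and $\phi-\phi''=a(c-\phi^2)^{-3/2}$; it satisfies $\frac12(\phi')^2=E+\frac12\phi^2-\frac{a\phi}{c\sqrt{c-\phi^2}}$, depends smoothly on $k$, and is the profile of a smooth solitary wave $u(x,t)=\phi(x-ct)$ of the Novikov equation $u_t-u_{xxt}=u^2u_{xxx}-4u^2u_x+3uu_xu_{xx}$. Put $\mu=\mu(\cdot;k)=\phi-\phi''>0$, $\omega_0=-9a^{-2/3}$, $\omega_1=9c\,a^{-4/3}(2E+c)$. The operator $\mathcal{L}$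 on $L^2(\mathbb{R})$ with domain $H^2(\mathbb{R})$ is $$\mathcal{L}=\frac23\left(-3\,\partial_x\left(\mu^{-8/3}\partial_x\right)+8\mu''\mu^{-11/3}-\frac{44}{3}(\mu')^2\mu^{-14/3}+15\mu^{-8/3}\right)-\frac{2\omega_1}{9}\mu^{-4/3}+2\omega_0(1-\partial_x^2)^{-1},$$ where $(1-\partial_x^2)^{-1}$ is convolution with $\frac12e^{-|x|}$. Spectral assumption (A): the spectrum of the symmetric operator $\mathcal{L}$ on $L^2(\mathbb{R})$ consists of a simple negative eigenvalue, a simple eigenvalue at $\lambda=0$ (whose eigenspace is then spanned by $\mu'$), and the rest of the spectrum is strictly positive and uniformly bounded away from $0$. For each $k$, $\mathcal{F}(m)=\int_{\mathbb{R}}(m(1-\partial_x^2)^{-1}m-k^2)\,dx-3k^{4/3}\int_{\mathbb{R}}(m^{2/3}-k^{2/3})\,dx$, with first variation $\frac{\delta\mathcal{F}}{\delta m}(\mu)=2(1-\partial_x^2)^{-1}\mu-2k^{4/3}\mu^{-1/3}$ at $\mu$; $\frac{\partial}{\partial k}\mathcal{F}(\mu(\cdot;k))$ is the total $k$-derivative (the functional $\mathcal{F}$ itself depends explicitly on $k$). Under (A), the even function $\frac{\delta\mathcal{F}}{\delta m}(\mu)$ lies in the range of $\mathcal{L}$, and $\mathcal{L}^{-1}\frac{\delta\mathcal{F}}{\delta m}(\mu)$ denotes a preimage (unique up to multiples of the odd function $\mu'$, which do not affect the inner product). $\langle\cdot,\cdot\rangle$ is the $L^2(\mathbb{R})$ inner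 product. *)

theory Defs
  imports "HOL-Analysis.Analysis"
begin

section \<open>Smooth solitary waves of the Novikov equation\<close>

definition smooth :: "(real \<Rightarrow> real) \<Rightarrow> bool" where
  "smooth f \<longleftrightarrow> (\<forall>n x. (deriv ^^ n) f field_differentiable (at x))"

text \<open>\<open>D i j\<close> is the mixed partial derivative of order \<open>i\<close> in the first and \<open>j\<close> in the second
  variable; existence and total differentiability of all of them on the open set \<open>U\<close> is
  \<open>u \<in> C\<^sup>\<infinity>(U)\<close>.\<close>

definition jointly_smooth_on :: "(real \<times> real) set \<Rightarrow> (real \<Rightarrow> real \<Rightarrow> real) \<Rightarrow> bool" where
  "jointly_smooth_on U u \<longleftrightarrow>
     (\<exists>D :: nat \<Rightarrow> nat \<Rightarrow> real \<times> real \<Rightarrow> real.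
        (\<forall>p\<in>U. D 0 0 p = u (fst p) (snd p)) \<and>
        (\<forall>i j. \<forall>p\<in>U. (D i j has_derivative
            (\<lambda>h. D (Suc i) j p * fst h + D i (Suc j) p * snd h)) (at p)))"

definition nov_a :: "real \<Rightarrow> real \<Rightarrow> real" where
  "nov_a c k = k * (c - k\<^sup>2) powr (3/2)"

definition nov_E :: "real \<Rightarrow> real \<Rightarrow> real" where
  "nov_E c k = k\<^sup>2 * (c - 2 * k\<^sup>2) / (2 * c)"

definition nov_omega0 :: "real \<Rightarrow> real \<Rightarrow> real" where
  "nov_omega0 c k = - 9 * nov_a c k powr (-2/3)"

definition nov_omega1 :: "real \<Rightarrow> real \<Rightarrow> real" where
  "nov_omega1 c k = 9 * c * nov_a c k powr (-4/3) * (2 * nov_E c k + c)"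

definition solitary_profile :: "real \<Rightarrow> real \<Rightarrow> (real \<Rightarrow> real) \<Rightarrow> bool" where
  "solitary_profile c k \<phi> \<longleftrightarrow>
     smooth \<phi> \<and> \<not> \<phi> constant_on UNIV \<and> (\<forall>x. \<phi> (- x) = \<phi> x) \<and> deriv \<phi> 0 = 0 \<and>
     (\<phi> \<longlongrightarrow> k) at_top \<and> (\<phi> \<longlongrightarrow> k) at_bot \<and>
     (\<exists>r>0. \<forall>n. \<exists>C. \<forall>x. \<bar>(deriv ^^ n) (\<lambda>y. \<phi> y - k) x\<bar> \<le> C * exp (- r * \<bar>x\<bar>)) \<and>
     (\<forall>x. (\<phi> x)\<^sup>2 < c) \<and>
     (\<forall>x. \<phi> x - deriv (deriv \<phi>) x = nov_a c k * (c - (\<phi> x)\<^sup>2) powr (-3/2))"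

definition momentum :: "(real \<Rightarrow> real) \<Rightarrow> real \<Rightarrow> real" where
  "momentum \<phi> x = \<phi> x - deriv (deriv \<phi>) x"

definition helmholtz_inv :: "(real \<Rightarrow> 'a::{banach, second_countable_topology}) \<Rightarrow> real \<Rightarrow> 'a" where
  "helmholtz_inv f x = (LINT y|lborel. (exp (- \<bar>x - y\<bar>) / 2) *\<^sub>R f y)"

definition nov_F :: "real \<Rightarrow> (real \<Rightarrow> real) \<Rightarrow> real" where
  "nov_F k m = (LINT x|lborel. m x * helmholtz_inv m x - k\<^sup>2)
     - 3 * k powr (4/3) * (LINT x|lborel. m x powr (2/3) - k powr (2/3))"

text \<open>The variational derivative of \<open>nov_F k\<close> at \<open>m\<close>.\<close>

definition nov_dF :: "real \<Rightarrow> (real \<Rightarrow> real) \<Rightarrow> real \<Rightarrow> real" where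
  "nov_dF k m x = 2 * helmholtz_inv m x - 2 * k powr (4/3) * m x powr (-1/3)"

section \<open>Unbounded operators on \<open>L\<^sup>2(\<real>)\<close>\<close>

text \<open>Elements of the complex space \<open>L\<^sup>2(\<real>)\<close> are represented by Borel functions, identified when
  they agree almost everywhere. An operator \<open>T\<close> is given by its graph: \<open>T f g\<close> says that \<open>f\<close> lies
  in the domain and \<open>T f = g\<close>.\<close>

definition L2 :: "(real \<Rightarrow> complex) set" where
  "L2 = {f \<in> borel_measurable lborel. integrable lborel (\<lambda>x. (norm (f x))\<^sup>2)}"

definition L2_inner :: "(real \<Rightarrow> complex) \<Rightarrow> (real \<Rightarrow> complex) \<Rightarrow> complex" where
  "L2_inner f g = (LINT x|lborel. f x * cnj (g x))"

definition L2_norm :: "(real \<Rightarrow> complex) \<Rightarrow> real" where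
  "L2_norm f = sqrt (LINT x|lborel. (norm (f x))\<^sup>2)"

definition test_function :: "(real \<Rightarrow> real) \<Rightarrow> bool" where
  "test_function \<psi> \<longleftrightarrow> smooth \<psi> \<and> (\<exists>R. \<forall>x. \<bar>x\<bar> > R \<longrightarrow> \<psi> x = 0)"

definition weak_deriv :: "(real \<Rightarrow> complex) \<Rightarrow> (real \<Rightarrow> complex) \<Rightarrow> bool" where
  "weak_deriv f g \<longleftrightarrow> f \<in> L2 \<and> g \<in> L2 \<and>
     (\<forall>\<psi>. test_function \<psi> \<longrightarrow>
        (LINT x|lborel. deriv \<psi> x *\<^sub>R f x) = - (LINT x|lborel. \<psi> x *\<^sub>R g x))"

definition H2 :: "(real \<Rightarrow> complex) set" where
  "H2 = {f. \<exists>f' f''. weak_deriv f f' \<and> weak_deriv f' f''}"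

definition resolvent_set :: "((real \<Rightarrow> complex) \<Rightarrow> (real \<Rightarrow> complex) \<Rightarrow> bool) \<Rightarrow> complex set" where
  "resolvent_set T = {z.
     (\<forall>f. T f (\<lambda>x. z * f x) \<longrightarrow> (AE x in lborel. f x = 0)) \<and>
     (\<exists>C. \<forall>g\<in>L2. \<exists>f. T f (\<lambda>x. g x + z * f x) \<and> L2_norm f \<le> C * L2_norm g)}"

definition op_spectrum :: "((real \<Rightarrow> complex) \<Rightarrow> (real \<Rightarrow> complex) \<Rightarrow> bool) \<Rightarrow> complex set" where
  "op_spectrum T = - resolvent_set T"

definition simple_eigenvalue ::
  "((real \<Rightarrow> complex) \<Rightarrow> (real \<Rightarrow> complex) \<Rightarrow> bool) \<Rightarrow> complex \<Rightarrow> bool" where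
  "simple_eigenvalue T z \<longleftrightarrow>
     (\<exists>f. T f (\<lambda>x. z * f x) \<and> \<not> (AE x in lborel. f x = 0) \<and>
        (\<forall>g. T g (\<lambda>x. z * g x) \<longrightarrow> (\<exists>b. AE x in lborel. g x = b * f x)))"

definition spectral_assumption :: "((real \<Rightarrow> complex) \<Rightarrow> (real \<Rightarrow> complex) \<Rightarrow> bool) \<Rightarrow> bool" where
  "spectral_assumption T \<longleftrightarrow>
     (\<exists>\<nu> \<delta> :: real. \<nu> < 0 \<and> \<delta> > 0 \<and>
        simple_eigenvalue T (complex_of_real \<nu>) \<and> simple_eigenvalue T 0 \<and>
        (\<forall>z \<in> op_spectrum T - {complex_of_real \<nu>, 0}. z \<in> \<real> \<and> Re z \<ge> \<delta>))"

section \<open>The linearized operator\<close>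

text \<open>In \<open>nov_L c k \<mu> f g\<close>, \<open>f'\<close> is the weak derivative of \<open>f\<close> and \<open>h = (\<mu>\<^bsup>-8/3\<^esup> f')'\<close>.\<close>

definition nov_L ::
  "real \<Rightarrow> real \<Rightarrow> (real \<Rightarrow> real) \<Rightarrow> (real \<Rightarrow> complex) \<Rightarrow> (real \<Rightarrow> complex) \<Rightarrow> bool" where
  "nov_L c k \<mu> f g \<longleftrightarrow> f \<in> H2 \<and> g \<in> L2 \<and>
     (\<exists>f' h. weak_deriv f f' \<and> weak_deriv (\<lambda>x. (\<mu> x powr (-8/3)) *\<^sub>R f' x) h \<and>
       (AE x in lborel. g x =
          (2/3) *\<^sub>R ((-3) *\<^sub>R h x
             + (8 * deriv (deriv \<mu>) x * \<mu> x powr (-11/3)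
                - 44/3 * (deriv \<mu> x)\<^sup>2 * \<mu> x powr (-14/3)
                + 15 * \<mu> x powr (-8/3)) *\<^sub>R f x)
          - (2 * nov_omega1 c k / 9 * \<mu> x powr (-4/3)) *\<^sub>R f x
          + (2 * nov_omega0 c k) *\<^sub>R helmholtz_inv f x))"

end

theory Submission
  imports Defs
begin

text \<open>
  With \<open>\<sigma> = sqrt (c - \<phi>\<^sup>2)\<close>, \<open>t = \<phi> / \<sigma>\<close>, \<open>b = k / sqrt (c - k\<^sup>2)\<close> and \<open>q\<^sup>2 = 1 - b\<^sup>2 - 2 b t\<close> (\<open>q\<close> odd in \<open>x\<close>) the
  first integral of the profile equation becomes \<open>q' = b (1 + t\<^sup>2) (t - b) / (1 + b\<^sup>2)\<close>, which integrates in
  closed form to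
  \<open>x = (ln (Q + q) - ln (Q - q)) / Q + M(b, q)\<close>, \<open>Q\<^sup>2 = 1 - 3 b\<^sup>2\<close>,
  \<open>M(b, q) = (ln ((1 - q)\<^sup>2 + b\<^sup>2) - ln ((1 + q)\<^sup>2 + b\<^sup>2)) / 2\<close>.
  The integrand of the functional is a positive multiple of \<open>(t - b) ((t - b)\<^sup>2 + Q\<^sup>2)\<close>, hence positive, with
  primitive \<open>(c - k\<^sup>2) (q + 2 b\<^sup>2 M(b, q))\<close>; so the functional is elementary in \<open>k\<close>.

  Differentiating the formula for \<open>x\<close> in \<open>k\<close> shows that \<open>\<phi>\<^sub>k - 1\<close> decays exponentially, so
  \<open>f = \<mu>\<^sub>k - \<mu> / k\<close> lies in the domain of the operator. Differentiating the Euler-Lagrange equation of \<open>\<mu>\<close> in \<open>k\<close>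
  and using its homogeneity, \<open>f\<close> is mapped to a positive multiple of the variational derivative, and
  \<open>\<langle>f, \<delta>F\<rangle> = F'(k) - 2 F(k) / k\<close>. Any other preimage differs by a multiple of the odd function \<open>\<mu>'\<close>, because \<open>0\<close>
  is a simple eigenvalue.
\<close>

section \<open>Bounded and exponentially decaying functions\<close>

text \<open>The term \<open>2 F / k\<close> is Euler's relation: \<open>nov_F\<close> is homogeneous
  of degree 2 under scaling of \<open>k\<close> and \<open>m\<close> together, so its derivative in
  the direction \<open>(1, \<mu> / k)\<close> is \<open>2 F / k\<close>. The family moves in the
  direction \<open>(1, \<mu>\<^sub>k) = (1, \<mu> / k) + (0, f)\<close>, so \<open>F > 0\<close> and
  \<open>F' < 0\<close> force a negative pairing of \<open>f\<close> with the variational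
  derivative. Both \<open>\<mu>\<^sub>k\<close> and \<open>\<mu> / k\<close> tend to 1, so only
  their difference can lie in \<open>L2\<close>. The obstacle is that the hypotheses give smoothness
  in \<open>(k, x)\<close> but no decay uniform in \<open>k\<close>: neither decay of
  \<open>\<phi>\<^sub>k - 1\<close> nor differentiation under the integral over the line comes for
  free. The first is extracted from the closed form by implicit differentiation; the second is done
  on compact intervals, where the explicit primitive gives boundary terms with computable limits.
  The coordinates are trigonometric: for \<open>\<phi> = sqrt c * sin \<theta>\<close> one has
  \<open>t = tan \<theta>\<close>, and \<open>b\<close> is the limit of \<open>t\<close> at
  infinity. The condition \<open>k < sqrt c / 2\<close> says exactly \<open>3 b^2 < 1\<close>, which
  makes \<open>Q\<close> real and positive.\<close>

definition bounded_fun :: "(real \<Rightarrow> real) \<Rightarrow> bool" where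
  "bounded_fun f \<longleftrightarrow> (\<exists>C. \<forall>x. \<bar>f x\<bar> \<le> C)"

text \<open>The rate is existential because sums take the smaller of two rates and a factor of
  linear growth costs half of it.\<close>

definition exp_decay :: "(real \<Rightarrow> real) \<Rightarrow> bool" where
  "exp_decay f \<longleftrightarrow> (\<exists>r>0. \<exists>C. \<forall>x. \<bar>f x\<bar> \<le> C * exp (- r * \<bar>x\<bar>))"

named_theorems decay_intros

lemma bounded_funI: "(\<And>x. \<bar>f x\<bar> \<le> C) \<Longrightarrow> bounded_fun f"
  by (auto simp: bounded_fun_def)

lemma exp_decayE:
  assumes "exp_decay f"
  obtains r C where "r > 0" "C \<ge> 0" "\<And>x. \<bar>f x\<bar> \<le> C * exp (- r * \<bar>x\<bar>)"
proof -
  from assms obtain r C where *: "r > 0" "\<And>x. \<bar>f x\<bar> \<le> C * exp (- r * \<bar>x\<bar>)"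
    by (auto simp: exp_decay_def)
  moreover have "C \<ge> 0" using *(2)[of 0] by simp
  ultimately show ?thesis using that by blast
qed

lemma exp_decayI: "r > 0 \<Longrightarrow> (\<And>x. \<bar>f x\<bar> \<le> C * exp (- r * \<bar>x\<bar>)) \<Longrightarrow> exp_decay f"
  by (auto simp: exp_decay_def)

lemma bounded_fun_const [decay_intros]: "bounded_fun (\<lambda>x. c)"
  by (auto simp: bounded_fun_def)

lemma bounded_fun_add [decay_intros]:
  assumes "bounded_fun f" "bounded_fun g" shows "bounded_fun (\<lambda>x. f x + g x)"
proof -
  obtain A B where "\<And>x. \<bar>f x\<bar> \<le> A" "\<And>x. \<bar>g x\<bar> \<le> B" using assms by (auto simp: bounded_fun_def)
  then have "\<bar>f x + g x\<bar> \<le> A + B" for x by (meson abs_triangle_ineq add_mono order_trans)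
  then show ?thesis by (rule bounded_funI)
qed

lemma bounded_fun_minus [decay_intros]: "bounded_fun f \<Longrightarrow> bounded_fun (\<lambda>x. - f x)"
  by (simp add: bounded_fun_def)

lemma bounded_fun_diff [decay_intros]:
  "bounded_fun f \<Longrightarrow> bounded_fun g \<Longrightarrow> bounded_fun (\<lambda>x. f x - g x)"
  using bounded_fun_add[of f "\<lambda>x. - g x"] bounded_fun_minus[of g] by simp

lemma bounded_fun_mult [decay_intros]:
  assumes "bounded_fun f" "bounded_fun g" shows "bounded_fun (\<lambda>x. f x * g x)"
proof -
  obtain A B where *: "\<And>x. \<bar>f x\<bar> \<le> A" "\<And>x. \<bar>g x\<bar> \<le> B" using assms by (auto simp: bounded_fun_def)
  have "A \<ge> 0" using *(1)[of 0] by simp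
  then have "\<bar>f x * g x\<bar> \<le> A * B" for x
    unfolding abs_mult using * by (intro mult_mono) auto
  then show ?thesis by (rule bounded_funI)
qed

lemma bounded_fun_power [decay_intros]: "bounded_fun f \<Longrightarrow> bounded_fun (\<lambda>x. f x ^ n)"
  by (induction n) (auto intro: decay_intros)

lemma bounded_fun_divide_const [decay_intros]: "bounded_fun f \<Longrightarrow> bounded_fun (\<lambda>x. f x / c)"
  unfolding divide_inverse by (intro decay_intros)

lemma bounded_fun_inverse:
  assumes "l > 0" "\<And>x. l \<le> f x" shows "bounded_fun (\<lambda>x. inverse (f x))"
proof (rule bounded_funI[of _ "inverse l"])
  fix x have "f x > 0" using assms(1) assms(2)[of x] by linarith
  then show "\<bar>inverse (f x)\<bar> \<le> inverse l" using assms by (simp add: le_imp_inverse_le)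
qed

lemma exp_decay_imp_bounded: "exp_decay f \<Longrightarrow> bounded_fun f"
proof (elim exp_decayE, rule bounded_funI)
  fix r C x assume "r > 0" "C \<ge> 0" and *: "\<And>x. \<bar>f x\<bar> \<le> C * exp (- r * \<bar>x\<bar>)"
  have "exp (- r * \<bar>x\<bar>) \<le> 1" using \<open>r > 0\<close> by simp
  then show "\<bar>f x\<bar> \<le> C" using *[of x] \<open>C \<ge> 0\<close> mult_left_le order_trans by blast
qed

lemma exp_decay_zero [decay_intros]: "exp_decay (\<lambda>x. 0)"
  by (rule exp_decayI[of 1 _ 0]) auto

lemma exp_decay_add [decay_intros]:
  assumes "exp_decay f" "exp_decay g" shows "exp_decay (\<lambda>x. f x + g x)"
proof -
  obtain r C where f: "r > 0" "C \<ge> 0" "\<And>x. \<bar>f x\<bar> \<le> C * exp (- r * \<bar>x\<bar>)"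
    using assms(1) by (rule exp_decayE) blast
  obtain s D where g: "s > 0" "D \<ge> 0" "\<And>x. \<bar>g x\<bar> \<le> D * exp (- s * \<bar>x\<bar>)"
    using assms(2) by (rule exp_decayE) blast
  show ?thesis
  proof (rule exp_decayI[of "min r s" _ "C + D"])
    fix x :: real
    have "exp (- r * \<bar>x\<bar>) \<le> exp (- min r s * \<bar>x\<bar>)" "exp (- s * \<bar>x\<bar>) \<le> exp (- min r s * \<bar>x\<bar>)"
      by (auto intro!: mult_right_mono)
    then have "C * exp (- r * \<bar>x\<bar>) + D * exp (- s * \<bar>x\<bar>) \<le> (C + D) * exp (- min r s * \<bar>x\<bar>)"
      unfolding distrib_right using f g by (intro add_mono mult_left_mono) auto
    then show "\<bar>f x + g x\<bar> \<le> (C + D) * exp (- min r s * \<bar>x\<bar>)"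
      using f(3)[of x] g(3)[of x] by linarith
  qed (use f g in auto)
qed

lemma exp_decay_minus [decay_intros]: "exp_decay f \<Longrightarrow> exp_decay (\<lambda>x. - f x)"
  by (simp add: exp_decay_def)

lemma exp_decay_diff [decay_intros]:
  "exp_decay f \<Longrightarrow> exp_decay g \<Longrightarrow> exp_decay (\<lambda>x. f x - g x)"
  using exp_decay_add[of f "\<lambda>x. - g x"] exp_decay_minus[of g] by simp

text \<open>Half of the rate absorbs the linear factor via \<open>y \<le> exp y\<close>. Linear
  growth does occur: the decay rate \<open>Q\<close> of the wave depends on \<open>k\<close>, so
  \<open>\<phi>\<^sub>k\<close> contains \<open>x\<close> times an exponential.\<close>

lemma exp_decay_mult_linear:
  assumes "exp_decay f" "\<And>x. \<bar>g x\<bar> \<le> B * (1 + \<bar>x\<bar>)" shows "exp_decay (\<lambda>x. f x * g x)"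
proof -
  obtain r C where f: "r > 0" "C \<ge> 0" "\<And>x. \<bar>f x\<bar> \<le> C * exp (- r * \<bar>x\<bar>)"
    using assms(1) by (rule exp_decayE) blast
  have B: "B \<ge> 0" using assms(2)[of 0] by simp
  show ?thesis
  proof (rule exp_decayI[of "r/2" _ "C * B * (1 + 2/r)"])
    fix x :: real
    have "r/2 * \<bar>x\<bar> \<le> exp (r/2 * \<bar>x\<bar>)" using exp_ge_add_one_self[of "r/2 * \<bar>x\<bar>"] by linarith
    then have "\<bar>x\<bar> \<le> 2/r * exp (r/2 * \<bar>x\<bar>)" using f(1) by (simp add: field_simps)
    moreover have "1 \<le> exp (r/2 * \<bar>x\<bar>)" using f(1) by simp
    ultimately have 1: "1 + \<bar>x\<bar> \<le> (1 + 2/r) * exp (r/2 * \<bar>x\<bar>)" unfolding distrib_right by linarith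
    have "\<bar>f x * g x\<bar> \<le> (C * exp (- r * \<bar>x\<bar>)) * (B * (1 + \<bar>x\<bar>))"
      unfolding abs_mult using f assms(2) by (intro mult_mono) auto
    also have "\<dots> \<le> (C * exp (- r * \<bar>x\<bar>)) * (B * ((1 + 2/r) * exp (r/2 * \<bar>x\<bar>)))"
      using f B 1 by (intro mult_left_mono) auto
    also have "\<dots> = C * B * (1 + 2/r) * (exp (- r * \<bar>x\<bar>) * exp (r/2 * \<bar>x\<bar>))" by simp
    also have "exp (- r * \<bar>x\<bar>) * exp (r/2 * \<bar>x\<bar>) = exp (- (r/2) * \<bar>x\<bar>)"
      by (subst exp_add[symmetric]) (simp add: field_simps)
    finally show "\<bar>f x * g x\<bar> \<le> C * B * (1 + 2/r) * exp (- (r/2) * \<bar>x\<bar>)" .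
  qed (use f in auto)
qed

lemma exp_decay_mult_right [decay_intros]:
  assumes "exp_decay f" "bounded_fun g" shows "exp_decay (\<lambda>x. f x * g x)"
proof -
  obtain B where B: "\<And>x. \<bar>g x\<bar> \<le> B" using assms(2) by (auto simp: bounded_fun_def)
  have "B \<ge> 0" using B[of 0] by simp
  then have "\<bar>g x\<bar> \<le> B * (1 + \<bar>x\<bar>)" for x
    using B[of x] mult_left_mono[of 1 "1 + \<bar>x\<bar>" B] by simp
  then show ?thesis using exp_decay_mult_linear assms(1) by blast
qed

lemma exp_decay_mult_left [decay_intros]:
  "bounded_fun g \<Longrightarrow> exp_decay f \<Longrightarrow> exp_decay (\<lambda>x. g x * f x)"
  using exp_decay_mult_right[of f g] by (simp add: mult.commute)

lemma exp_decay_divide_const [decay_intros]: "exp_decay f \<Longrightarrow> exp_decay (\<lambda>x. f x / c)"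
  unfolding divide_inverse by (intro decay_intros)

lemma exp_decay_cmult [decay_intros]: "exp_decay f \<Longrightarrow> exp_decay (\<lambda>x. c * f x)"
  by (intro decay_intros)

lemma exp_decay_tendsto_top:
  assumes "exp_decay f" shows "(f \<longlongrightarrow> 0) at_top"
proof -
  obtain r C where f: "r > 0" "C \<ge> 0" "\<And>x. \<bar>f x\<bar> \<le> C * exp (- r * \<bar>x\<bar>)"
    using assms by (rule exp_decayE) blast
  have "filterlim (\<lambda>x::real. r * \<bar>x\<bar>) at_top at_top"
    by (intro filterlim_tendsto_pos_mult_at_top[OF tendsto_const f(1)] filterlim_abs_real)
  then have "((\<lambda>x. C * exp (- r * \<bar>x\<bar>)) \<longlongrightarrow> C * 0) at_top"
    by (intro tendsto_intros filterlim_compose[OF exp_at_bot]) (simp add: filterlim_uminus_at_bot)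
  then show ?thesis by (intro Lim_null_comparison[where f=f]) (use f in auto)
qed

lemma exp_decay_reflect: "exp_decay f \<Longrightarrow> exp_decay (\<lambda>x. f (- x))"
  by (simp add: exp_decay_def) (metis abs_minus_cancel)

lemma exp_decay_tendsto_bot:
  assumes "exp_decay f" shows "(f \<longlongrightarrow> 0) at_bot"
  using exp_decay_tendsto_top[OF exp_decay_reflect[OF assms]]
  by (simp add: filterlim_at_bot_mirror)

lemma integrable_exp_minus_abs:
  assumes "r > 0" shows "integrable lborel (\<lambda>x::real. exp (- r * \<bar>x\<bar>))"
proof -
  define g where "g = (\<lambda>x::real. indicator {0..} x *\<^sub>R exp (- r * x))"
  have "set_integrable lebesgue {0..} (\<lambda>x. exp (- r * x))"
    using assms
    by (intro nonnegative_absolutely_integrable_1 integrable_on_exp_minus_to_infinity) auto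
  then have "integrable lebesgue g" by (simp add: set_integrable_def g_def)
  then have g: "integrable lborel g"
    by (subst (asm) integrable_completion) (auto simp: g_def)
  then have "integrable lborel (\<lambda>x. g (0 + (-1) * x))"
    by (subst lborel_integrable_real_affine_iff) auto
  with g have "integrable lborel (\<lambda>x. g x + g (- x))" by simp
  then show ?thesis
    by (rule Bochner_Integration.integrable_bound) (auto simp: g_def indicator_def)
qed

lemma exp_decay_kernel: "exp_decay (\<lambda>y. exp (- \<bar>x - y\<bar>))"
proof (rule exp_decayI[of 1 _ "exp \<bar>x\<bar>"])
  fix y show "\<bar>exp (- \<bar>x - y\<bar>)\<bar> \<le> exp \<bar>x\<bar> * exp (- 1 * \<bar>y\<bar>)"
    by (simp add: exp_add[symmetric])
qed simp

lemma exp_decay_integrable: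
  assumes "exp_decay f" "continuous_on UNIV f" shows "integrable lborel f"
proof -
  obtain r C where f: "r > 0" "C \<ge> 0" "\<And>x. \<bar>f x\<bar> \<le> C * exp (- r * \<bar>x\<bar>)"
    using assms(1) by (rule exp_decayE) blast
  have "integrable lborel (\<lambda>x. C * exp (- r * \<bar>x\<bar>))"
    using integrable_exp_minus_abs[OF f(1)] by simp
  then show ?thesis
    by (rule Bochner_Integration.integrable_bound)
      (use f assms(2) in \<open>auto intro: borel_measurable_continuous_onI\<close>)
qed

text \<open>By the mean value theorem, \<open>v'\<close> at some point of \<open>(x, x + 1)\<close> is \<open>v (x + 1) - v x\<close>, and
  \<open>v''\<close> controls its variation up to that point.\<close>

lemma exp_decay_interpolate:
  assumes v: "\<And>x. (v has_real_derivative v1 x) (at x)"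
    and v1: "\<And>x. (v1 has_real_derivative v2 x) (at x)"
    and "exp_decay v" "exp_decay v2"
  shows "exp_decay v1"
proof -
  obtain r C where f: "r > 0" "C \<ge> 0" "\<And>x. \<bar>v x\<bar> \<le> C * exp (- r * \<bar>x\<bar>)"
    using assms(3) by (rule exp_decayE) blast
  obtain s D where g: "s > 0" "D \<ge> 0" "\<And>x. \<bar>v2 x\<bar> \<le> D * exp (- s * \<bar>x\<bar>)"
    using assms(4) by (rule exp_decayE) blast
  define m where "m = min r s"
  have m: "m > 0" "m \<le> r" "m \<le> s" using f g by (auto simp: m_def)
  have E: "exp (- t * \<bar>y\<bar>) \<le> exp m * exp (- m * \<bar>x\<bar>)" if "m \<le> t" "\<bar>y - x\<bar> \<le> 1" for t y x :: real
  proof -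
    have "m * \<bar>x\<bar> \<le> m * (\<bar>y\<bar> + 1)" using m that by (intro mult_left_mono) auto
    moreover have "m * \<bar>y\<bar> \<le> t * \<bar>y\<bar>" using that by (intro mult_right_mono) auto
    ultimately show ?thesis by (simp add: exp_add[symmetric] algebra_simps)
  qed
  show ?thesis
  proof (rule exp_decayI[of m _ "(2 * C + D) * exp m"])
    fix x :: real
    obtain z where z: "x < z" "z < x + 1" "v (x + 1) - v x = (x + 1 - x) * v1 z"
      using MVT2[of x "x+1" v v1] v by auto
    obtain y where y: "x < y" "y < z" "v1 z - v1 x = (z - x) * v2 y"
      using MVT2[of x z v1 v2] v1 z by auto
    have "\<bar>v (x+1)\<bar> \<le> C * (exp m * exp (- m * \<bar>x\<bar>))" "\<bar>v x\<bar> \<le> C * (exp m * exp (- m * \<bar>x\<bar>))"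
      by (rule order_trans[OF f(3)], rule mult_left_mono[OF E[OF m(2)] f(2)], simp)+
    moreover have "\<bar>(z - x) * v2 y\<bar> \<le> D * (exp m * exp (- m * \<bar>x\<bar>))"
    proof -
      have "\<bar>(z - x) * v2 y\<bar> \<le> 1 * \<bar>v2 y\<bar>"
        unfolding abs_mult using z by (intro mult_right_mono) auto
      also have "\<dots> \<le> D * exp (- s * \<bar>y\<bar>)" using g(3)[of y] by simp
      also have "\<dots> \<le> D * (exp m * exp (- m * \<bar>x\<bar>))"
        using E[OF m(3), of y x] y z g(2) by (intro mult_left_mono) auto
      finally show ?thesis .
    qed
    moreover have "v1 x = v (x+1) - v x - (z - x) * v2 y" using z y by simp
    ultimately have "\<bar>v1 x\<bar> \<le> C * (exp m * exp (- m * \<bar>x\<bar>)) + C * (exp m * exp (- m * \<bar>x\<bar>)) + D * (exp m * exp (- m * \<bar>x\<bar>))"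
      by linarith
    then show "\<bar>v1 x\<bar> \<le> (2 * C + D) * exp m * exp (- m * \<bar>x\<bar>)" by (simp add: algebra_simps)
  qed (use m in auto)
qed

lemma bounded_fun_powr:
  assumes "l > 0" "\<And>x. l \<le> f x" "\<And>x. f x \<le> u" shows "bounded_fun (\<lambda>x. f x powr e)"
proof (rule bounded_funI[of _ "max (l powr e) (u powr e)"])
  fix x
  have p: "f x > 0" using assms(1) assms(2)[of x] by linarith
  show "\<bar>f x powr e\<bar> \<le> max (l powr e) (u powr e)"
  proof (cases "e \<ge> 0")
    case True
    then have "f x powr e \<le> u powr e" using assms(3)[of x] p by (intro powr_mono2) auto
    then show ?thesis by simp
  next
    case False
    then have "f x powr e \<le> l powr e" using assms(1,2) by (intro powr_mono2') auto
    then show ?thesis by simp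
  qed
qed

section \<open>Integration by parts on the line\<close>

lemma DERIV_continuous_on_UNIV:
  fixes f :: "real \<Rightarrow> real"
  shows "(\<And>x. (f has_real_derivative f' x) (at x)) \<Longrightarrow> continuous_on UNIV f"
  by (blast intro: DERIV_continuous_on has_field_derivative_at_within)

lemma LINT_FTC_real:
  fixes B g :: "real \<Rightarrow> real"
  assumes "\<And>x. (B has_real_derivative g x) (at x)" "continuous_on UNIV g" "integrable lborel g"
    and "(B \<longlongrightarrow> l) at_top" "(B \<longlongrightarrow> m) at_bot"
  shows "(LINT x|lborel. g x) = l - m"
proof -
  have "(LBINT x=-\<infinity>..\<infinity>. g x) = l - m"
  proof (rule interval_integral_FTC_integrable)
    show "set_integrable lborel (einterval (-\<infinity>) \<infinity>) g" using assms(3) by (simp add: set_integrable_def)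
    show "((B \<circ> real_of_ereal) \<longlongrightarrow> m) (at_right (-\<infinity>))" "((B \<circ> real_of_ereal) \<longlongrightarrow> l) (at_left \<infinity>)"
      using assms(4,5) by (simp_all add: ereal_tendsto_simps)
  qed (use assms(1,2) in \<open>auto simp: has_real_derivative_iff_has_vector_derivative continuous_on_eq_continuous_at\<close>)
  then show ?thesis
    by (simp add: interval_lebesgue_integral_def set_lebesgue_integral_def)
qed

text \<open>The kernel is Green's function of \<open>1 - d^2/dx^2\<close>, so the integrand is an
  exact derivative on each side of \<open>x\<close>. Boundedness of \<open>u\<close> suffices
  because the kernel decays; this covers \<open>\<phi>\<close>, which tends to \<open>k\<close> and
  not to 0.\<close>

lemma helmholtz_inv_eq:
  fixes u :: "real \<Rightarrow> real"
  assumes d: "\<And>x. (u has_real_derivative u1 x) (at x)" "\<And>x. (u1 has_real_derivative u2 x) (at x)"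
    and c: "continuous_on UNIV u2" and b: "bounded_fun u" "bounded_fun u1" "bounded_fun u2"
  shows "helmholtz_inv (\<lambda>y. u y - u2 y) x = u x"
proof -
  define g where "g y = exp (- \<bar>x - y\<bar>) / 2 * (u y - u2 y)" for y
  have cu: "continuous_on UNIV u" "continuous_on UNIV u1"
    using d by (auto intro: DERIV_continuous_on_UNIV)
  note ex = exp_decay_kernel[of x]
  have gi: "integrable lborel g"
    unfolding g_def using b ex cu c
    by (intro exp_decay_integrable decay_intros continuous_intros) auto
  have cg: "isCont g y" for y
  proof -
    have "continuous_on UNIV g" unfolding g_def using cu c by (intro continuous_intros) auto
    then show ?thesis by (simp add: continuous_on_eq_continuous_at)
  qed
  \<comment> \<open>The two half-lines contribute \<open>(u x - u1 x) / 2\<close> and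
    \<open>(u x + u1 x) / 2\<close>, whose sum is \<open>u x\<close>.\<close>
  have L: "(LBINT y=-\<infinity>..ereal x. g y) = (u x - u1 x) / 2 - 0"
  proof (rule interval_integral_FTC_integrable)
    fix y assume "ereal y < ereal x"
    then have y: "\<bar>x - y\<bar> = x - y" by simp
    have "((\<lambda>y. exp (y - x) * (u y - u1 y) / 2) has_real_derivative
       (exp (y - x) * (u y - u1 y) + exp (y - x) * (u1 y - u2 y)) / 2) (at y)"
      by (auto intro!: derivative_eq_intros d)
    moreover have "(exp (y - x) * (u y - u1 y) + exp (y - x) * (u1 y - u2 y)) / 2 = g y"
      unfolding g_def y by (simp add: field_simps)
    ultimately show "((\<lambda>y. exp (y - x) * (u y - u1 y) / 2) has_vector_derivative g y) (at y)"
      by (simp add: has_real_derivative_iff_has_vector_derivative)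
  next
    show "set_integrable lborel (einterval (-\<infinity>) (ereal x)) g"
      using gi integrable_mult_indicator[of "{..<x}" lborel g] by (simp add: set_integrable_def)
  next
    have "exp_decay (\<lambda>y. exp (- \<bar>x - y\<bar>) * (u y - u1 y) / 2)"
      using b ex by (intro decay_intros)
    then have "((\<lambda>y. exp (- \<bar>x - y\<bar>) * (u y - u1 y) / 2) \<longlongrightarrow> 0) at_bot"
      by (rule exp_decay_tendsto_bot)
    moreover have "\<forall>\<^sub>F y in at_bot. exp (- \<bar>x - y\<bar>) * (u y - u1 y) / 2 = exp (y - x) * (u y - u1 y) / 2"
      using eventually_le_at_bot[of x] by eventually_elim auto
    ultimately have "((\<lambda>y. exp (y - x) * (u y - u1 y) / 2) \<longlongrightarrow> 0) at_bot"
      by (rule Lim_transform_eventually)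
    then show "(((\<lambda>y. exp (y - x) * (u y - u1 y) / 2) \<circ> real_of_ereal) \<longlongrightarrow> 0) (at_right (-\<infinity>))"
      by (simp add: ereal_tendsto_simps)
  next
    have "isCont (\<lambda>y. exp (y - x) * (u y - u1 y) / 2) x"
      using cu by (intro continuous_intros) (auto simp: continuous_on_eq_continuous_at)
    then show "(((\<lambda>y. exp (y - x) * (u y - u1 y) / 2) \<circ> real_of_ereal) \<longlongrightarrow> (u x - u1 x) / 2) (at_left (ereal x))"
      by (simp add: ereal_tendsto_simps isCont_def filterlim_at_split)
  qed (use cg in auto)
  have R: "(LBINT y=ereal x..\<infinity>. g y) = 0 - (- ((u x + u1 x) / 2))"
  proof (rule interval_integral_FTC_integrable)
    fix y assume "ereal x < ereal y"
    then have y: "\<bar>x - y\<bar> = y - x" by simp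
    have "((\<lambda>y. - (exp (x - y) * (u y + u1 y) / 2)) has_real_derivative
       - ((- exp (x - y) * (u y + u1 y) + exp (x - y) * (u1 y + u2 y)) / 2)) (at y)"
      by (auto intro!: derivative_eq_intros d)
    moreover have "- ((- exp (x - y) * (u y + u1 y) + exp (x - y) * (u1 y + u2 y)) / 2) = g y"
      unfolding g_def y by (simp add: field_simps)
    ultimately show "((\<lambda>y. - (exp (x - y) * (u y + u1 y) / 2)) has_vector_derivative g y) (at y)"
      by (simp add: has_real_derivative_iff_has_vector_derivative)
  next
    show "set_integrable lborel (einterval (ereal x) \<infinity>) g"
      using gi integrable_mult_indicator[of "{x<..}" lborel g] by (simp add: set_integrable_def)
  next
    have "exp_decay (\<lambda>y. - (exp (- \<bar>x - y\<bar>) * (u y + u1 y) / 2))"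
      using b ex by (intro decay_intros)
    then have "((\<lambda>y. - (exp (- \<bar>x - y\<bar>) * (u y + u1 y) / 2)) \<longlongrightarrow> 0) at_top"
      by (rule exp_decay_tendsto_top)
    moreover have "\<forall>\<^sub>F y in at_top. - (exp (- \<bar>x - y\<bar>) * (u y + u1 y) / 2) = - (exp (x - y) * (u y + u1 y) / 2)"
      using eventually_ge_at_top[of x] by eventually_elim auto
    ultimately have "((\<lambda>y. - (exp (x - y) * (u y + u1 y) / 2)) \<longlongrightarrow> 0) at_top"
      by (rule Lim_transform_eventually)
    then show "(((\<lambda>y. - (exp (x - y) * (u y + u1 y) / 2)) \<circ> real_of_ereal) \<longlongrightarrow> 0) (at_left \<infinity>)"
      by (simp add: ereal_tendsto_simps)
  next
    have "isCont (\<lambda>y. - (exp (x - y) * (u y + u1 y) / 2)) x"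
      using cu by (intro continuous_intros) (auto simp: continuous_on_eq_continuous_at)
    then show "(((\<lambda>y. - (exp (x - y) * (u y + u1 y) / 2)) \<circ> real_of_ereal) \<longlongrightarrow> - ((u x + u1 x) / 2)) (at_right (ereal x))"
      by (simp add: ereal_tendsto_simps isCont_def filterlim_at_split)
  qed (use cg in auto)
  have "(LBINT y=-\<infinity>..ereal x. g y) + (LBINT y=ereal x..\<infinity>. g y) = (LBINT y=-\<infinity>..\<infinity>. g y)"
    using gi by (intro interval_integral_sum)
      (simp add: interval_lebesgue_integrable_def set_integrable_def max_def min_def)
  also have "\<dots> = (LINT y|lborel. g y)"
    by (simp add: interval_lebesgue_integral_def set_lebesgue_integral_def)
  finally have "(LINT y|lborel. g y) = u x" using L R by (simp add: field_simps)
  then show ?thesis by (simp add: helmholtz_inv_def g_def)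
qed

section \<open>Classical functions in the operator domain\<close>

lemma smooth_deriv_iter:
  assumes "smooth f"
  shows "((deriv ^^ n) f has_real_derivative (deriv ^^ Suc n) f x) (at x)"
  using assms by (simp add: smooth_def DERIV_deriv_iff_field_differentiable)

lemma compact_support_exp_decay:
  assumes "continuous_on UNIV f" "\<And>x. \<bar>x\<bar> > R \<Longrightarrow> f x = 0" shows "exp_decay f"
proof -
  have "compact (f ` {-R..R})"
    by (intro compact_continuous_image continuous_on_subset[OF assms(1)]) auto
  then obtain B where B: "\<And>x. x \<in> {-R..R} \<Longrightarrow> \<bar>f x\<bar> \<le> B"
    using compact_imp_bounded[of "f ` {-R..R}"] unfolding bounded_iff by (metis imageI real_norm_def)
  show ?thesis
  proof (rule exp_decayI[of 1 _ "\<bar>B\<bar> * exp R"])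
    fix x
    show "\<bar>f x\<bar> \<le> \<bar>B\<bar> * exp R * exp (- 1 * \<bar>x\<bar>)"
    proof (cases "\<bar>x\<bar> \<le> R")
      case True
      then have "\<bar>f x\<bar> \<le> \<bar>B\<bar>" by (intro order_trans[OF B abs_ge_self]) auto
      also have "\<dots> \<le> \<bar>B\<bar> * (exp R * exp (- 1 * \<bar>x\<bar>))"
        using True mult_left_mono[of 1 "exp R * exp (- 1 * \<bar>x\<bar>)" "\<bar>B\<bar>"]
        by (simp add: exp_add[symmetric])
      finally show ?thesis by simp
    qed (use assms(2) in auto)
  qed simp
qed

lemma test_functionD:
  assumes "test_function \<psi>"
  shows "(\<psi> has_real_derivative deriv \<psi> x) (at x)" "continuous_on UNIV \<psi>" "continuous_on UNIV (deriv \<psi>)"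
    "exp_decay \<psi>" "exp_decay (deriv \<psi>)"
proof -
  have s: "smooth \<psi>" using assms by (simp add: test_function_def)
  obtain R where R: "\<And>x. \<bar>x\<bar> > R \<Longrightarrow> \<psi> x = 0" using assms by (auto simp: test_function_def)
  show d: "(\<psi> has_real_derivative deriv \<psi> x) (at x)" for x
    using smooth_deriv_iter[OF s, of 0] by simp
  show c1: "continuous_on UNIV \<psi>"
    using d by (rule DERIV_continuous_on_UNIV)
  have "(deriv \<psi> has_real_derivative deriv (deriv \<psi>) x) (at x)" for x
    using smooth_deriv_iter[OF s, of 1] by simp
  then show c2: "continuous_on UNIV (deriv \<psi>)"
    by (rule DERIV_continuous_on_UNIV)
  show "exp_decay \<psi>" using compact_support_exp_decay c1 R by blast
  have "deriv \<psi> x = 0" if "\<bar>x\<bar> > R" for x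
  proof -
    have "open {x. \<bar>x\<bar> > R}" by (intro open_Collect_less continuous_intros)
    then have "\<forall>\<^sub>F y in nhds x. \<psi> y = 0"
      using that R by (intro eventually_nhds_in_open[THEN eventually_mono, of "{x. \<bar>x\<bar> > R}"]) auto
    then have "deriv \<psi> x = deriv (\<lambda>_. 0) x" by (rule deriv_cong_ev) simp
    then show ?thesis by simp
  qed
  then show "exp_decay (deriv \<psi>)" using compact_support_exp_decay c2 by blast
qed

lemma exp_decay_L2:
  assumes "exp_decay f" "continuous_on UNIV f" shows "(\<lambda>x. complex_of_real (f x)) \<in> L2"
proof -
  have "integrable lborel (\<lambda>x. f x * f x)"
    using assms by (intro exp_decay_integrable decay_intros continuous_intros exp_decay_imp_bounded) auto
  moreover have "f \<in> borel_measurable borel" using assms(2) by (rule borel_measurable_continuous_onI)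
  ultimately show ?thesis by (simp add: L2_def power2_eq_square)
qed

lemma weak_deriv_classical:
  assumes d: "\<And>x. (f has_real_derivative f1 x) (at x)" and c1: "continuous_on UNIV f1"
    and e: "exp_decay f" "exp_decay f1"
  shows "weak_deriv (\<lambda>x. complex_of_real (f x)) (\<lambda>x. complex_of_real (f1 x))"
proof -
  have c0: "continuous_on UNIV f"
    using d by (rule DERIV_continuous_on_UNIV)
  have "(LINT x|lborel. deriv \<psi> x *\<^sub>R complex_of_real (f x)) = - (LINT x|lborel. \<psi> x *\<^sub>R complex_of_real (f1 x))"
    if "test_function \<psi>" for \<psi>
  proof -
    note t = test_functionD[OF that]
    have i: "integrable lborel (\<lambda>x. deriv \<psi> x * f x)" "integrable lborel (\<lambda>x. \<psi> x * f1 x)"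
      using t e c0 c1 by (intro exp_decay_integrable decay_intros continuous_intros exp_decay_imp_bounded; simp)+
    have "exp_decay (\<lambda>x. \<psi> x * f x)" using t e by (intro decay_intros exp_decay_imp_bounded)
    then have "(LINT x|lborel. deriv \<psi> x * f x + \<psi> x * f1 x) = 0 - 0"
      using t i c0 c1
      by (intro LINT_FTC_real[where B="\<lambda>x. \<psi> x * f x"] exp_decay_tendsto_top exp_decay_tendsto_bot
         continuous_intros) (auto intro!: derivative_eq_intros d)
    then have "(LINT x|lborel. deriv \<psi> x * f x) = - (LINT x|lborel. \<psi> x * f1 x)"
      using i by simp
    then have "complex_of_real (LINT x|lborel. deriv \<psi> x * f x) = - complex_of_real (LINT x|lborel. \<psi> x * f1 x)"
      by simp
    then show ?thesis unfolding integral_complex_of_real[symmetric] by (simp add: scaleR_conv_of_real)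
  qed
  then show ?thesis unfolding weak_deriv_def using e c0 c1 by (auto intro: exp_decay_L2)
qed

lemma helmholtz_inv_of_real:
  "helmholtz_inv (\<lambda>x. complex_of_real (f x)) x = complex_of_real (helmholtz_inv f x)"
  unfolding helmholtz_inv_def
  by (subst integral_complex_of_real[symmetric]) (simp add: scaleR_conv_of_real)

text \<open>The bridge from the weak, complex graph to real calculus: for decaying classical
  \<open>f\<close> the divergence-form term is expanded by the product rule, and membership in the
  graph becomes one identity at each \<open>x\<close>.\<close>

lemma nov_L_classical:
  assumes f: "\<And>x. (f has_real_derivative f1 x) (at x)" "\<And>x. (f1 has_real_derivative f2 x) (at x)"
    "continuous_on UNIV f2" "exp_decay f" "exp_decay f1" "exp_decay f2"
    and m: "\<And>x. (\<mu> has_real_derivative m1 x) (at x)" "\<And>x. (m1 has_real_derivative m2 x) (at x)"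
    "bounded_fun m1"
    and l: "l > 0" "\<And>x. l \<le> \<mu> x" "\<And>x. \<mu> x \<le> u"
    and g: "exp_decay g" "continuous_on UNIV g"
     "\<And>x. g x = 2/3 * (- 3 * (\<mu> x powr (-8/3) * f2 x - 8/3 * \<mu> x powr (-11/3) * m1 x * f1 x)
          + (8 * m2 x * \<mu> x powr (-11/3) - 44/3 * (m1 x)\<^sup>2 * \<mu> x powr (-14/3) + 15 * \<mu> x powr (-8/3)) * f x)
        - 2 * nov_omega1 c k / 9 * \<mu> x powr (-4/3) * f x + 2 * nov_omega0 c k * helmholtz_inv f x"
  shows "nov_L c k \<mu> (\<lambda>x. complex_of_real (f x)) (\<lambda>x. complex_of_real (g x))"
proof -
  have pos: "\<mu> x > 0" for x using l(1) l(2)[of x] by linarith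
  have cf: "continuous_on UNIV f" "continuous_on UNIV f1" and cm: "continuous_on UNIV \<mu>" "continuous_on UNIV m1"
    by (rule DERIV_continuous_on_UNIV[OF f(1)] DERIV_continuous_on_UNIV[OF f(2)]
        DERIV_continuous_on_UNIV[OF m(1)] DERIV_continuous_on_UNIV[OF m(2)])+
  define h where "h x = \<mu> x powr (-8/3) * f2 x - 8/3 * \<mu> x powr (-11/3) * m1 x * f1 x" for x
  have w1: "weak_deriv (\<lambda>x. complex_of_real (f x)) (\<lambda>x. complex_of_real (f1 x))"
    and w2: "weak_deriv (\<lambda>x. complex_of_real (f1 x)) (\<lambda>x. complex_of_real (f2 x))"
    by (rule weak_deriv_classical; fact)+
  have "weak_deriv (\<lambda>x. complex_of_real (\<mu> x powr (-8/3) * f1 x)) (\<lambda>x. complex_of_real (h x))"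
  proof (rule weak_deriv_classical)
    have e: "-8/3 - 1 = (-11/3 :: real)" by simp
    have "((\<lambda>x. \<mu> x powr (-8/3)) has_real_derivative (-8/3) * \<mu> x powr (-8/3 - 1) * m1 x) (at x)" for x
      using DERIV_chain2[OF has_real_derivative_powr[OF pos[of x]] m(1)] .
    then show "((\<lambda>x. \<mu> x powr (-8/3) * f1 x) has_real_derivative h x) (at x)" for x
      unfolding h_def e by (rule derivative_eq_intros) (use f in \<open>auto simp: algebra_simps\<close>)
    show "continuous_on UNIV h"
      unfolding h_def using f(3) cf cm pos by (intro continuous_intros) (auto simp: less_imp_neq[OF pos, symmetric])
    show "exp_decay (\<lambda>x. \<mu> x powr (-8/3) * f1 x)" "exp_decay h"
      unfolding h_def by (intro decay_intros f m bounded_fun_powr[OF l])+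
  qed
  then have w3: "weak_deriv (\<lambda>x. (\<mu> x powr (-8/3)) *\<^sub>R complex_of_real (f1 x)) (\<lambda>x. complex_of_real (h x))"
    by (simp add: scaleR_conv_of_real)
  have dm: "deriv \<mu> = m1" using m(1) by (auto intro: DERIV_imp_deriv)
  have dm1: "deriv m1 = m2" using m(2) by (auto intro: DERIV_imp_deriv)
  show ?thesis
    unfolding nov_L_def dm dm1
  proof (intro conjI exI)
    show "(\<lambda>x. complex_of_real (f x)) \<in> H2" unfolding H2_def using w1 w2 by blast
    show "(\<lambda>x. complex_of_real (g x)) \<in> L2" using g by (intro exp_decay_L2)
    show "AE x in lborel. complex_of_real (g x) =
       (2/3) *\<^sub>R ((-3) *\<^sub>R complex_of_real (h x)
             + (8 * m2 x * \<mu> x powr (-11/3)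
                - 44/3 * (m1 x)\<^sup>2 * \<mu> x powr (-14/3)
                + 15 * \<mu> x powr (-8/3)) *\<^sub>R complex_of_real (f x))
          - (2 * nov_omega1 c k / 9 * \<mu> x powr (-4/3)) *\<^sub>R complex_of_real (f x)
          + (2 * nov_omega0 c k) *\<^sub>R helmholtz_inv (\<lambda>x. complex_of_real (f x)) x"
      unfolding helmholtz_inv_of_real scaleR_conv_of_real of_real_mult[symmetric] of_real_add[symmetric] of_real_diff[symmetric]
      by (intro AE_I2 arg_cong[where f=complex_of_real]) (simp add: g(3) h_def)
  qed (use w1 w3 in auto)
qed

section \<open>Linearity of the operator\<close>

lemma L2_diff:
  assumes "f \<in> L2" "g \<in> L2" shows "(\<lambda>x. f x - g x) \<in> L2"
proof -
  have m: "f \<in> borel_measurable borel" "g \<in> borel_measurable borel"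
    and i: "integrable lborel (\<lambda>x. (norm (f x))\<^sup>2)" "integrable lborel (\<lambda>x. (norm (g x))\<^sup>2)"
    using assms by (auto simp: L2_def)
  have "integrable lborel (\<lambda>x. 2 * (norm (f x))\<^sup>2 + 2 * (norm (g x))\<^sup>2)" using i by simp
  then have "integrable lborel (\<lambda>x. (norm (f x - g x))\<^sup>2)"
  proof (rule Bochner_Integration.integrable_bound)
    show "AE x in lborel. norm ((norm (f x - g x))\<^sup>2) \<le> norm (2 * (norm (f x))\<^sup>2 + 2 * (norm (g x))\<^sup>2)"
    proof (rule AE_I2)
      fix x
      have "(norm (f x - g x))\<^sup>2 \<le> (norm (f x) + norm (g x))\<^sup>2"
        by (intro power_mono norm_triangle_ineq4) auto
      also have "\<dots> \<le> 2 * (norm (f x))\<^sup>2 + 2 * (norm (g x))\<^sup>2"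
        using sum_squares_bound[of "norm (f x)" "norm (g x)"] by (simp add: power2_sum)
      finally show "norm ((norm (f x - g x))\<^sup>2) \<le> norm (2 * (norm (f x))\<^sup>2 + 2 * (norm (g x))\<^sup>2)" by simp
    qed
  qed (use m in simp)
  then show ?thesis using m by (simp add: L2_def)
qed

lemma L2_mult_integrable:
  assumes "f \<in> L2" "exp_decay e" "continuous_on UNIV e"
  shows "integrable lborel (\<lambda>x. e x *\<^sub>R f x)"
proof -
  have m: "f \<in> borel_measurable borel" "e \<in> borel_measurable borel"
    using assms by (auto simp: L2_def intro: borel_measurable_continuous_onI)
  have "integrable lborel (\<lambda>x. (e x * e x + (norm (f x))\<^sup>2) / 2)"
  proof -
    have "integrable lborel (\<lambda>x. e x * e x)"
      using assms(2,3)
      by (intro exp_decay_integrable exp_decay_mult_right exp_decay_imp_bounded continuous_intros)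
    then show ?thesis using assms(1) by (simp add: L2_def)
  qed
  then show ?thesis
  proof (rule Bochner_Integration.integrable_bound)
    show "AE x in lborel. norm (e x *\<^sub>R f x) \<le> norm ((e x * e x + (norm (f x))\<^sup>2) / 2)"
    proof (rule AE_I2)
      fix x show "norm (e x *\<^sub>R f x) \<le> norm ((e x * e x + (norm (f x))\<^sup>2) / 2)"
        using sum_squares_bound[of "\<bar>e x\<bar>" "norm (f x)"] by (simp add: power2_eq_square)
    qed
  qed (use m in simp)
qed

lemma weak_deriv_diff:
  assumes "weak_deriv f f'" "weak_deriv g g'"
  shows "weak_deriv (\<lambda>x. f x - g x) (\<lambda>x. f' x - g' x)"
proof -
  have L: "f \<in> L2" "f' \<in> L2" "g \<in> L2" "g' \<in> L2" using assms by (auto simp: weak_deriv_def)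
  have "(LINT x|lborel. deriv \<psi> x *\<^sub>R (f x - g x)) = - (LINT x|lborel. \<psi> x *\<^sub>R (f' x - g' x))"
    if "test_function \<psi>" for \<psi>
  proof -
    note t = test_functionD[OF that]
    note i = L2_mult_integrable[OF _ t(5) t(3)] L2_mult_integrable[OF _ t(4) t(2)]
    show ?thesis
      using assms that i(1)[OF L(1)] i(1)[OF L(3)] i(2)[OF L(2)] i(2)[OF L(4)]
      by (simp add: weak_deriv_def scaleR_diff_right)
  qed
  then show ?thesis using L by (auto simp: weak_deriv_def intro: L2_diff)
qed

lemma helmholtz_inv_diff:
  assumes "f \<in> L2" "g \<in> L2"
  shows "helmholtz_inv (\<lambda>x. f x - g x) x = helmholtz_inv f x - helmholtz_inv g x"
proof -
  note ex = exp_decay_divide_const[OF exp_decay_kernel[of x], of 2]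
  show ?thesis
    unfolding helmholtz_inv_def scaleR_diff_right
    by (intro Bochner_Integration.integral_diff L2_mult_integrable ex assms continuous_intros) auto
qed

text \<open>Turns two preimages of the same function into a kernel element, to which simplicity of
  the eigenvalue 0 applies.\<close>

lemma nov_L_diff:
  assumes "nov_L c k \<mu> f g" "nov_L c k \<mu> f' g'"
  shows "nov_L c k \<mu> (\<lambda>x. f x - f' x) (\<lambda>x. g x - g' x)"
proof -
  obtain f1 h where 1: "f \<in> H2" "g \<in> L2" "weak_deriv f f1" "weak_deriv (\<lambda>x. (\<mu> x powr (-8/3)) *\<^sub>R f1 x) h"
    "AE x in lborel. g x =
          (2/3) *\<^sub>R ((-3) *\<^sub>R h x
             + (8 * deriv (deriv \<mu>) x * \<mu> x powr (-11/3)
                - 44/3 * (deriv \<mu> x)\<^sup>2 * \<mu> x powr (-14/3)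
                + 15 * \<mu> x powr (-8/3)) *\<^sub>R f x)
          - (2 * nov_omega1 c k / 9 * \<mu> x powr (-4/3)) *\<^sub>R f x
          + (2 * nov_omega0 c k) *\<^sub>R helmholtz_inv f x"
    using assms(1) unfolding nov_L_def by blast
  obtain f1' h' where 2: "f' \<in> H2" "g' \<in> L2" "weak_deriv f' f1'" "weak_deriv (\<lambda>x. (\<mu> x powr (-8/3)) *\<^sub>R f1' x) h'"
    "AE x in lborel. g' x =
          (2/3) *\<^sub>R ((-3) *\<^sub>R h' x
             + (8 * deriv (deriv \<mu>) x * \<mu> x powr (-11/3)
                - 44/3 * (deriv \<mu> x)\<^sup>2 * \<mu> x powr (-14/3)
                + 15 * \<mu> x powr (-8/3)) *\<^sub>R f' x)
          - (2 * nov_omega1 c k / 9 * \<mu> x powr (-4/3)) *\<^sub>R f' x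
          + (2 * nov_omega0 c k) *\<^sub>R helmholtz_inv f' x"
    using assms(2) unfolding nov_L_def by blast
  have L: "f \<in> L2" "f' \<in> L2" using 1(3) 2(3) by (auto simp: weak_deriv_def)
  show ?thesis
    unfolding nov_L_def
  proof (intro conjI exI)
    show "(\<lambda>x. f x - f' x) \<in> H2" using 1(1) 2(1) unfolding H2_def by (blast intro: weak_deriv_diff)
    show "(\<lambda>x. g x - g' x) \<in> L2" using 1(2) 2(2) by (rule L2_diff)
    show "weak_deriv (\<lambda>x. f x - f' x) (\<lambda>x. f1 x - f1' x)" using 1(3) 2(3) by (rule weak_deriv_diff)
    show "weak_deriv (\<lambda>x. (\<mu> x powr (-8/3)) *\<^sub>R (f1 x - f1' x)) (\<lambda>x. h x - h' x)"
      using weak_deriv_diff[OF 1(4) 2(4)] by (simp add: scaleR_diff_right)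
    show "AE x in lborel. g x - g' x =
          (2/3) *\<^sub>R ((-3) *\<^sub>R (h x - h' x)
             + (8 * deriv (deriv \<mu>) x * \<mu> x powr (-11/3)
                - 44/3 * (deriv \<mu> x)\<^sup>2 * \<mu> x powr (-14/3)
                + 15 * \<mu> x powr (-8/3)) *\<^sub>R (f x - f' x))
          - (2 * nov_omega1 c k / 9 * \<mu> x powr (-4/3)) *\<^sub>R (f x - f' x)
          + (2 * nov_omega0 c k) *\<^sub>R helmholtz_inv (\<lambda>x. f x - f' x) x"
      using 1(5) 2(5)
    proof eventually_elim
      case (elim x)
      show ?case unfolding elim helmholtz_inv_diff[OF L]
        by (simp only: scaleR_diff_right scaleR_add_right) simp
    qed
  qed
qed

section \<open>The profile in explicit coordinates\<close>

text \<open>Gronwall's argument on the segment between \<open>x0\<close> and \<open>y\<close>, where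
  \<open>\<kappa>\<close> is bounded. The bound is stated for squares because the first integral
  controls \<open>(\<phi>')^2\<close>.\<close>

lemma gronwall_zero:
  fixes u :: "real \<Rightarrow> real"
  assumes d: "\<And>x. (u has_real_derivative u' x) (at x)" and nn: "\<And>x. u x \<ge> 0"
    and K: "\<And>x. (u' x)\<^sup>2 \<le> \<kappa> x * (u x)\<^sup>2" and c: "continuous_on UNIV \<kappa>" and z: "u x0 = 0"
  shows "u y = 0"
proof -
  have "compact (\<kappa> ` {min x0 y..max x0 y})"
    by (intro compact_continuous_image continuous_on_subset[OF c]) auto
  then have "bounded (\<kappa> ` {min x0 y..max x0 y})" by (rule compact_imp_bounded)
  then obtain A where A: "\<And>x. x \<in> {min x0 y..max x0 y} \<Longrightarrow> \<bar>\<kappa> x\<bar> \<le> A"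
    unfolding bounded_iff by (metis imageI real_norm_def)
  define B where "B = sqrt \<bar>A\<bar>"
  have B: "\<bar>u' x\<bar> \<le> B * u x" if "x \<in> {min x0 y..max x0 y}" for x
  proof (rule power2_le_imp_le)
    have "\<kappa> x \<le> \<bar>A\<bar>" using A[OF that] by linarith
    then have "\<kappa> x * (u x)\<^sup>2 \<le> \<bar>A\<bar> * (u x)\<^sup>2" by (intro mult_right_mono) auto
    then show "\<bar>u' x\<bar>\<^sup>2 \<le> (B * u x)\<^sup>2" using K[of x] by (simp add: power_mult_distrib B_def)
    show "0 \<le> B * u x" using nn by (simp add: B_def)
  qed
  have "u y \<le> 0"
  proof (cases "x0 \<le> y")
    case True
    have "u y * exp (- B * y) \<le> u x0 * exp (- B * x0)"
    proof (rule DERIV_nonpos_imp_nonincreasing[OF True, where f="\<lambda>x. u x * exp (- B * x)"])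
      fix x assume "x0 \<le> x" "x \<le> y"
      then have "\<bar>u' x\<bar> \<le> B * u x" using True by (intro B) auto
      moreover have "((\<lambda>x. u x * exp (- B * x)) has_real_derivative (u' x - B * u x) * exp (- B * x)) (at x)"
        by (auto intro!: derivative_eq_intros d simp: algebra_simps)
      moreover have "(u' x - B * u x) * exp (- B * x) \<le> 0" if "\<bar>u' x\<bar> \<le> B * u x"
        using that by (intro mult_nonpos_nonneg) auto
      ultimately show "\<exists>D. ((\<lambda>x. u x * exp (- B * x)) has_real_derivative D) (at x) \<and> D \<le> 0" by blast
    qed
    then show ?thesis using z by (simp add: mult_le_0_iff)
  next
    case False
    have "u y * exp (B * y) \<le> u x0 * exp (B * x0)"
    proof (rule DERIV_nonneg_imp_nondecreasing[where f="\<lambda>x. u x * exp (B * x)"])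
      show "y \<le> x0" using False by simp
      fix x assume "y \<le> x" "x \<le> x0"
      then have "\<bar>u' x\<bar> \<le> B * u x" using False by (intro B) auto
      moreover have "((\<lambda>x. u x * exp (B * x)) has_real_derivative (u' x + B * u x) * exp (B * x)) (at x)"
        by (auto intro!: derivative_eq_intros d simp: algebra_simps)
      moreover have "(u' x + B * u x) * exp (B * x) \<ge> 0" if "\<bar>u' x\<bar> \<le> B * u x"
        using that by (intro mult_nonneg_nonneg) auto
      ultimately show "\<exists>D. ((\<lambda>x. u x * exp (B * x)) has_real_derivative D) (at x) \<and> D \<ge> 0" by blast
    qed
    then show ?thesis using z by (simp add: mult_le_0_iff)
  qed
  then show ?thesis using nn[of y] by simp
qed

text \<open>An opaque name for the iterated derivative, so that the simplifier does not unfold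
  \<open>deriv ^^ n\<close> at numerals.\<close>

definition deriv_n :: "nat \<Rightarrow> (real \<Rightarrow> real) \<Rightarrow> real \<Rightarrow> real" where
  "deriv_n n f = (deriv ^^ n) f"

definition wave_sigma :: "real \<Rightarrow> (real \<Rightarrow> real) \<Rightarrow> real \<Rightarrow> real" where
  "wave_sigma c \<phi> x = sqrt (c - (\<phi> x)\<^sup>2)"

definition wave_s0 :: "real \<Rightarrow> real \<Rightarrow> real" where
  "wave_s0 c k = sqrt (c - k\<^sup>2)"

text \<open>The difference \<open>t - b\<close> cleared of denominators: it equals
  \<open>s0 * sg * (t - b)\<close> and vanishes only where \<open>\<phi>\<close> meets the
  background \<open>k\<close>.\<close>

definition wave_N :: "real \<Rightarrow> real \<Rightarrow> (real \<Rightarrow> real) \<Rightarrow> real \<Rightarrow> real" where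
  "wave_N c k \<phi> x = wave_s0 c k * \<phi> x - k * wave_sigma c \<phi> x"

text \<open>The square root \<open>q\<close> of \<open>1 - b\<^sup>2 - 2 b t\<close>, written through \<open>\<phi>'\<close> so that its sign and its smoothness in \<open>(k, x)\<close>
  at the crest come for free.\<close>

definition wave_q :: "real \<Rightarrow> real \<Rightarrow> (real \<Rightarrow> real) \<Rightarrow> real \<Rightarrow> real" where
  "wave_q c k \<phi> x = - c * deriv \<phi> x / (wave_s0 c k * wave_N c k \<phi> x)"

definition wave_b :: "real \<Rightarrow> real \<Rightarrow> real" where
  "wave_b c k = k / wave_s0 c k"

definition wave_Q :: "real \<Rightarrow> real \<Rightarrow> real" where
  "wave_Q c k = sqrt (1 - 3 * (wave_b c k)\<^sup>2)"

text \<open>The difference of the logarithms of the moduli of \<open>1 - q + i b\<close> and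
  \<open>1 + q + i b\<close>. As a polynomial in \<open>q\<close>, \<open>4 b^2 (1 + t^2)\<close> is
  the product of the two quadratics, so these logarithms come from the partial fractions of
  \<open>dx/dq\<close>.\<close>

definition wave_M :: "real \<Rightarrow> real \<Rightarrow> real" where
  "wave_M b q = (ln ((1 - q)\<^sup>2 + b\<^sup>2) - ln ((1 + q)\<^sup>2 + b\<^sup>2)) / 2"

definition wave_Z :: "real \<Rightarrow> real \<Rightarrow> real" where
  "wave_Z b q = q + 2 * b\<^sup>2 * wave_M b q"

definition wave_density :: "real \<Rightarrow> (real \<Rightarrow> real) \<Rightarrow> real \<Rightarrow> real" where
  "wave_density k \<phi> x = momentum \<phi> x * \<phi> x - k\<^sup>2
     - 3 * k powr (4/3) * (momentum \<phi> x powr (2/3) - k powr (2/3))"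

lemma powr_thirds:
  assumes "y > 0" shows "y powr (- real n / 3) = (y powr (-1/3)) ^ n"
  using assms by (simp add: powr_realpow[symmetric] powr_powr)

text \<open>Both arguments may move, so one rule serves differentiation in \<open>x\<close> (with
  \<open>B\<close> constant) and in \<open>k\<close>.\<close>

lemma wave_M_deriv:
  assumes "b \<noteq> 0" and b: "(B has_real_derivative b') (at s within S)" "B s = b"
    and q: "(q has_real_derivative q') (at s within S)" "q s = r"
  shows "((\<lambda>s. wave_M (B s) (q s)) has_real_derivative
     b' * (b / ((1 - r)\<^sup>2 + b\<^sup>2) - b / ((1 + r)\<^sup>2 + b\<^sup>2))
     - q' * ((1 - r) / ((1 - r)\<^sup>2 + b\<^sup>2) + (1 + r) / ((1 + r)\<^sup>2 + b\<^sup>2))) (at s within S)"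
proof -
  have p: "(1 - r)\<^sup>2 + b\<^sup>2 > 0" "(1 + r)\<^sup>2 + b\<^sup>2 > 0" using assms(1) by (auto intro: add_nonneg_pos)
  have 1: "((\<lambda>s. (1 - q s)\<^sup>2 + (B s)\<^sup>2) has_real_derivative - 2 * (1 - r) * q' + 2 * b * b') (at s within S)"
    by (rule derivative_eq_intros b q refl)+ (simp add: b q algebra_simps)
  have 2: "((\<lambda>s. (1 + q s)\<^sup>2 + (B s)\<^sup>2) has_real_derivative 2 * (1 + r) * q' + 2 * b * b') (at s within S)"
    by (rule derivative_eq_intros b q refl)+ (simp add: b q algebra_simps)
  have l1: "((\<lambda>s. ln ((1 - q s)\<^sup>2 + (B s)\<^sup>2)) has_real_derivative
      1 / ((1 - r)\<^sup>2 + b\<^sup>2) * (- 2 * (1 - r) * q' + 2 * b * b')) (at s within S)"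
    using DERIV_chain2[OF DERIV_ln_divide 1] p b q by simp
  have l2: "((\<lambda>s. ln ((1 + q s)\<^sup>2 + (B s)\<^sup>2)) has_real_derivative
      1 / ((1 + r)\<^sup>2 + b\<^sup>2) * (2 * (1 + r) * q' + 2 * b * b')) (at s within S)"
    using DERIV_chain2[OF DERIV_ln_divide 2] p b q by simp
  have e: "(1 / P * (- 2 * (1 - r) * q' + 2 * b * b') - 1 / R * (2 * (1 + r) * q' + 2 * b * b')) / 2
      = b' * (b / P - b / R) - q' * ((1 - r) / P + (1 + r) / R)" for P R
    by (simp add: algebra_simps add_divide_distrib diff_divide_distrib)
  show ?thesis
    unfolding wave_M_def e[symmetric] by (intro DERIV_cdivide DERIV_diff l1 l2)
qed

text \<open>\<open>ev\<close> is the Euler-Lagrange equation along a curve with parameter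
  \<open>s\<close>; differentiating the powers of \<open>m\<close> produces the coefficients of
  \<open>nov_L\<close>. With \<open>s = x\<close> and constant \<open>w0\<close>, \<open>w1\<close>
  it yields the kernel element \<open>\<mu>'\<close>; with \<open>s = k\<close> the varying
  \<open>w0\<close>, \<open>w1\<close> give the source term.\<close>

lemma EL_linearization:
  assumes d: "(m has_real_derivative m') (at s)" "(n1 has_real_derivative n1') (at s)"
      "(n2 has_real_derivative n2') (at s)" "(p has_real_derivative p') (at s)"
      "(w1 has_real_derivative w1') (at s)" "(w0 has_real_derivative w0') (at s)"
    and pos: "m s > (0::real)"
    and ev: "\<forall>\<^sub>F r in nhds s. 8/3 * m r powr (-11/3) * (n1 r)\<^sup>2 - 2 * m r powr (-8/3) * n2 r - 6 * m r powr (-5/3)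
        + 2/3 * w1 r * m r powr (-1/3) + 2 * w0 r * p r = 0"
  shows "2/3 * (- 3 * (m s powr (-8/3) * n2' - 8/3 * m s powr (-11/3) * n1 s * n1')
          + (8 * n2 s * m s powr (-11/3) - 44/3 * (n1 s)\<^sup>2 * m s powr (-14/3) + 15 * m s powr (-8/3)) * m')
        - 2 * w1 s / 9 * m s powr (-4/3) * m' + 2 * w0 s * p'
      = - (2/3 * w1' * m s powr (-1/3) + 2 * w0' * p s)" (is "?L = - ?R")
proof -
  have pw: "((\<lambda>r. m r powr e) has_real_derivative e * m s powr (e - 1) * m') (at s)" for e
    using DERIV_chain2[OF has_real_derivative_powr[OF pos] d(1)] .
  have e: "-11/3 - 1 = (-14/3::real)" "-8/3 - 1 = (-11/3::real)" "-5/3 - 1 = (-8/3::real)" "-1/3 - 1 = (-4/3::real)"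
    by simp_all
  note pws = pw[of "-11/3", unfolded e] pw[of "-8/3", unfolded e] pw[of "-5/3", unfolded e] pw[of "-1/3", unfolded e]
  have "((\<lambda>r. 8/3 * m r powr (-11/3) * (n1 r)\<^sup>2 - 2 * m r powr (-8/3) * n2 r - 6 * m r powr (-5/3)
        + 2/3 * w1 r * m r powr (-1/3) + 2 * w0 r * p r) has_real_derivative ?L + ?R) (at s)"
    by (rule derivative_eq_intros pws d refl)+ (simp add: algebra_simps power2_eq_square)
  moreover have "((\<lambda>r. 8/3 * m r powr (-11/3) * (n1 r)\<^sup>2 - 2 * m r powr (-8/3) * n2 r - 6 * m r powr (-5/3)
        + 2/3 * w1 r * m r powr (-1/3) + 2 * w0 r * p r) has_real_derivative 0) (at s)"
    using DERIV_cong_ev[OF refl ev refl] by simp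
  ultimately have "?L + ?R = 0" by (rule DERIV_unique)
  then show ?thesis by linarith
qed

text \<open>At the energy level of the background the equilibrium is a double root of the energy
  equation, visible as the square of \<open>z * p - k * s\<close>.\<close>

lemma first_integral_identity:
  fixes p s k z c :: real
  assumes "s\<^sup>2 = c - p\<^sup>2" "z\<^sup>2 = c - k\<^sup>2"
  shows "c * (s * (k\<^sup>2 * (c - 2 * k\<^sup>2) + c * p\<^sup>2) - 2 * (k * z ^ 3) * p)
    = (z * p - k * s)\<^sup>2 * (s * z\<^sup>2 - k\<^sup>2 * s - 2 * k * z * p)"
proof -
  \<comment> \<open>Once \<open>c\<close> is eliminated, the claim is an identity modulo
    \<open>s^2 = c - p^2\<close>; the displayed cofactor is the quotient by this constraint.\<close>
  have c: "c = z\<^sup>2 + k\<^sup>2" using assms by simp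
  have "c * (s * (k\<^sup>2 * (c - 2 * k\<^sup>2) + c * p\<^sup>2) - 2 * (k * z ^ 3) * p)
      - (z * p - k * s)\<^sup>2 * (s * z\<^sup>2 - k\<^sup>2 * s - 2 * k * z * p)
    = (p\<^sup>2 - (c - s\<^sup>2)) * (s * k ^ 4 - s * k\<^sup>2 * z\<^sup>2 + 2 * p * k * z ^ 3)"
    unfolding c by algebra
  then show ?thesis using assms(1) by simp
qed

text \<open>This is the numerator of \<open>q'\<close> (one factor \<open>N\<close> removed) after
  inserting the profile equation and the first integral; what survives is again a multiple of
  \<open>N^2\<close>.\<close>

lemma slope_identity:
  fixes p s k z c :: real
  assumes "s\<^sup>2 = c - p\<^sup>2" "z\<^sup>2 = c - k\<^sup>2"
  shows "- c\<^sup>2 * (p * s ^ 3 - k * z ^ 3)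
     + (z * p - k * s) * (s * z\<^sup>2 - k\<^sup>2 * s - 2 * k * z * p) * s * (z * s + k * p) = c * k * z * (z * p - k * s)\<^sup>2"
proof -
  have c: "c = z\<^sup>2 + k\<^sup>2" using assms by simp
  have "- c\<^sup>2 * (p * s ^ 3 - k * z ^ 3)
     + (z * p - k * s) * (s * z\<^sup>2 - k\<^sup>2 * s - 2 * k * z * p) * s * (z * s + k * p) - c * k * z * (z * p - k * s)\<^sup>2
     = (p\<^sup>2 - (c - s\<^sup>2)) * (s\<^sup>2 * k ^ 3 * z - k * z ^ 5 - k ^ 3 * z ^ 3 - s\<^sup>2 * k * z ^ 3 - 2 * p * s * k\<^sup>2 * z\<^sup>2)"
    unfolding c by algebra
  then show ?thesis using assms(1) by simp
qed

\<comment> \<open>keeps \<open>deriv_n 1\<close> syntactically stable under the simplifier\<close>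
declare One_nat_def [simp del]

section \<open>A single wave: basic facts and the first integral\<close>

locale novikov_wave =
  fixes c k :: real and \<phi> :: "real \<Rightarrow> real"
  assumes c_pos: "c > 0" and k_range: "k \<in> {0<..<sqrt c / 2}" and profile: "solitary_profile c k \<phi>"
begin

abbreviation s0 :: real where "s0 \<equiv> wave_s0 c k"
abbreviation sg :: "real \<Rightarrow> real" where "sg \<equiv> wave_sigma c \<phi>"
abbreviation N :: "real \<Rightarrow> real" where "N \<equiv> wave_N c k \<phi>"
abbreviation q :: "real \<Rightarrow> real" where "q \<equiv> wave_q c k \<phi>"
abbreviation b :: real where "b \<equiv> wave_b c k"
abbreviation Q :: real where "Q \<equiv> wave_Q c k"
abbreviation t :: "real \<Rightarrow> real" where "t x \<equiv> \<phi> x / sg x"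
abbreviation a :: real where "a \<equiv> nov_a c k"
abbreviation d :: "nat \<Rightarrow> real \<Rightarrow> real" where "d n \<equiv> deriv_n n \<phi>"
abbreviation \<mu> :: "real \<Rightarrow> real" where "\<mu> \<equiv> momentum \<phi>"

lemma k_pos: "k > 0" and four_k2: "4 * k\<^sup>2 < c" and ck2: "c - k\<^sup>2 > 0"
proof -
  show "k > 0" using k_range by simp
  have "2 * k < sqrt c" using k_range by simp
  then have "(2 * k)\<^sup>2 < (sqrt c)\<^sup>2" using \<open>k > 0\<close> by (intro power_strict_mono) auto
  then show "4 * k\<^sup>2 < c" using c_pos by (simp add: power_mult_distrib)
  moreover have "k\<^sup>2 > 0" using \<open>k > 0\<close> by simp
  ultimately show "c - k\<^sup>2 > 0" by linarith
qed

lemma s0_pos: "s0 > 0" and s0_sq: "s0\<^sup>2 = c - k\<^sup>2"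
  using ck2 by (auto simp: wave_s0_def)

lemma phi_sq: "(\<phi> x)\<^sup>2 < c" using profile by (simp add: solitary_profile_def)

lemma sg_pos: "sg x > 0" and sg_sq: "(sg x)\<^sup>2 = c - (\<phi> x)\<^sup>2"
  using phi_sq[of x] by (auto simp: wave_sigma_def)

lemma a_eq: "a = k * s0 ^ 3"
proof -
  have "(c - k\<^sup>2) powr (3/2) = s0 ^ 3"
    using ck2 by (simp add: wave_s0_def powr_half_sqrt[symmetric] powr_realpow[symmetric] powr_powr)
  then show ?thesis by (simp add: nov_a_def)
qed

lemma a_pos: "a > 0" unfolding a_eq using k_pos s0_pos by simp

lemma d_deriv: "(d n has_real_derivative d (Suc n) x) (at x)"
  unfolding deriv_n_def using profile smooth_deriv_iter by (simp add: solitary_profile_def)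

lemma d_0: "d 0 = \<phi>" and d_1: "deriv \<phi> = d 1" and d_2: "deriv (deriv \<phi>) = d 2"
  by (simp_all add: deriv_n_def numeral_2_eq_2 One_nat_def)

lemma phi_deriv: "(\<phi> has_real_derivative d 1 x) (at x)" and d1_deriv: "(d 1 has_real_derivative d 2 x) (at x)"
  using d_deriv[of 0 x] d_deriv[of 1 x] by (simp_all add: numeral_2_eq_2 One_nat_def d_0)

lemma d_cont: "continuous_on A (d n)"
  by (rule continuous_on_subset[OF DERIV_continuous_on_UNIV[OF d_deriv]]) simp

lemma phi_cont: "continuous_on A \<phi>" using d_cont[of A 0] by (simp add: d_0)

lemma mu_eq: "\<mu> x = a / (sg x) ^ 3"
proof -
  have "(c - (\<phi> x)\<^sup>2) powr (-3/2) = 1 / (sg x) ^ 3"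
    using phi_sq[of x]
    by (simp add: wave_sigma_def powr_minus_divide powr_half_sqrt[symmetric] powr_realpow[symmetric] powr_powr)
  then show ?thesis using profile by (simp add: solitary_profile_def momentum_def)
qed

lemma d2_eq: "d 2 x = \<phi> x - a / (sg x) ^ 3"
  using mu_eq[of x] by (simp add: momentum_def d_2)

lemma phi_even: "\<phi> (- x) = \<phi> x" using profile by (simp add: solitary_profile_def)

lemma sg_even: "sg (- x) = sg x" by (simp add: wave_sigma_def phi_even)

lemma d1_odd: "d 1 (- x) = - d 1 x"
proof -
  have "((\<lambda>x. \<phi> (- x)) has_real_derivative d 1 (- x) * (- 1)) (at x)"
    by (rule DERIV_chain2[OF phi_deriv]) (auto intro!: derivative_eq_intros)
  then have "(\<phi> has_real_derivative - d 1 (- x)) (at x)" by (simp add: phi_even)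
  from DERIV_unique[OF this phi_deriv] show ?thesis by simp
qed

lemma d1_0: "d 1 0 = 0" using d1_odd[of 0] by simp

lemma phi_decay: "exp_decay (\<lambda>x. \<phi> x - k)"
proof -
  obtain r where "r > 0" "\<And>n. \<exists>C. \<forall>x. \<bar>(deriv ^^ n) (\<lambda>y. \<phi> y - k) x\<bar> \<le> C * exp (- r * \<bar>x\<bar>)"
    using profile unfolding solitary_profile_def by blast
  from this(1) this(2)[of 0] show ?thesis by (auto simp: exp_decay_def)
qed

lemma d_decay: "n > 0 \<Longrightarrow> exp_decay (d n)"
proof -
  assume "n > 0"
  obtain r where r: "r > 0" "\<And>n. \<exists>C. \<forall>x. \<bar>(deriv ^^ n) (\<lambda>y. \<phi> y - k) x\<bar> \<le> C * exp (- r * \<bar>x\<bar>)"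
    using profile unfolding solitary_profile_def by blast
  have "(deriv ^^ Suc m) (\<lambda>y. \<phi> y - k) = d (Suc m)" for m
  proof -
    have "((\<lambda>y. \<phi> y - k) has_real_derivative d 1 x) (at x)" for x
      using phi_deriv[of x] by (auto intro!: derivative_eq_intros)
    then have "deriv (\<lambda>y. \<phi> y - k) = d 1" by (auto intro!: DERIV_imp_deriv)
    then show ?thesis by (simp add: deriv_n_def funpow_Suc_right One_nat_def del: funpow.simps)
  qed
  from this[of "n - 1"] r \<open>n > 0\<close> show ?thesis
    by (simp add: exp_decay_def) (metis Suc_pred)
qed

lemma phi_bounded: "bounded_fun \<phi>"
  using bounded_fun_add[OF exp_decay_imp_bounded[OF phi_decay] bounded_fun_const[of k]] by simp

lemma d_bounded: "bounded_fun (d n)"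
  by (cases n) (use phi_bounded d_decay exp_decay_imp_bounded in \<open>auto simp: d_0\<close>)

lemma sg_deriv: "(sg has_real_derivative - \<phi> x * d 1 x / sg x) (at x)"
proof -
  have "c - (\<phi> x)\<^sup>2 > 0" using phi_sq[of x] by simp
  then show ?thesis
    unfolding wave_sigma_def[abs_def]
    by (auto intro!: derivative_eq_intros phi_deriv simp: field_simps)
qed

lemma sg_cont: "continuous_on A sg"
  by (rule continuous_on_subset[OF DERIV_continuous_on_UNIV[OF sg_deriv]]) simp

lemma t_deriv: "(t has_real_derivative c * d 1 x / (sg x) ^ 3) (at x)"
proof -
  have nz: "sg x \<noteq> 0" using sg_pos[of x] by auto
  have "(d 1 x * sg x - \<phi> x * (- \<phi> x * d 1 x / sg x)) / (sg x * sg x) = ((sg x)\<^sup>2 + (\<phi> x)\<^sup>2) * d 1 x / (sg x) ^ 3"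
    using nz by (simp add: field_simps power2_eq_square power3_eq_cube)
  then show ?thesis
    using DERIV_divide[OF phi_deriv sg_deriv nz] sg_sq[of x] by simp
qed

text \<open>Conservation of energy for \<open>\<phi>'' = \<phi> - a (c - \<phi>\<^sup>2)\<^bsup>-3/2\<^esup>\<close>, with the constant read off at infinity.\<close>

lemma first_integral: "c * sg x * (d 1 x)\<^sup>2 = sg x * (k\<^sup>2 * (c - 2 * k\<^sup>2) + c * (\<phi> x)\<^sup>2) - 2 * a * \<phi> x"
proof -
  define R where "R x = (d 1 x)\<^sup>2 - (\<phi> x)\<^sup>2 + 2 * a / c * (\<phi> x / sg x)" for x
  have "(R has_real_derivative 0) (at x)" for x
  proof -
    have nz: "sg x \<noteq> 0" "c \<noteq> 0" using sg_pos[of x] c_pos by auto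
    have "(R has_real_derivative 2 * d 1 x * d 2 x - 2 * \<phi> x * d 1 x + 2 * a / c * (c * d 1 x / (sg x) ^ 3)) (at x)"
      unfolding R_def[abs_def]
      by (intro DERIV_add DERIV_diff DERIV_cmult t_deriv) (auto intro!: derivative_eq_intros phi_deriv d1_deriv)
    moreover have "2 * d 1 x * d 2 x - 2 * \<phi> x * d 1 x + 2 * a / c * (c * d 1 x / (sg x) ^ 3) = 0"
      unfolding d2_eq using nz by (simp add: field_simps)
    ultimately show ?thesis by simp
  qed
  then obtain C where C: "\<And>x. R x = C" using DERIV_isconst_all by blast
  have l: "(\<phi> \<longlongrightarrow> k) at_top" using profile by (simp add: solitary_profile_def)
  have "(R \<longlongrightarrow> 0\<^sup>2 - k\<^sup>2 + 2 * a / c * (k / s0)) at_top"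
    unfolding R_def[abs_def] wave_sigma_def wave_s0_def using ck2
    by (intro tendsto_intros l exp_decay_tendsto_top[OF d_decay]) auto
  moreover have "R = (\<lambda>_. C)" using C by auto
  then have "(R \<longlongrightarrow> C) at_top" by simp
  ultimately have "C = 0\<^sup>2 - k\<^sup>2 + 2 * a / c * (k / s0)" by (intro tendsto_unique[of at_top]) auto
  also have "\<dots> = k\<^sup>2 * (c - 2 * k\<^sup>2) / c"
  proof -
    have "2 * a / c * (k / s0) = 2 * k\<^sup>2 * s0\<^sup>2 / c"
      unfolding a_eq using s0_pos by (simp add: power3_eq_cube power2_eq_square)
    then show ?thesis unfolding s0_sq using c_pos by (simp add: field_simps power2_eq_square)
  qed
  finally have "R x = k\<^sup>2 * (c - 2 * k\<^sup>2) / c" using C by simp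
  then have e: "(d 1 x)\<^sup>2 = k\<^sup>2 * (c - 2 * k\<^sup>2) / c + (\<phi> x)\<^sup>2 - 2 * a / c * (\<phi> x / sg x)"
    unfolding R_def by linarith
  show ?thesis unfolding e using sg_pos[of x] c_pos by (simp add: field_simps)
qed

lemma first_integral_N:
  "c\<^sup>2 * sg x * (d 1 x)\<^sup>2 = (N x)\<^sup>2 * (sg x * s0\<^sup>2 - k\<^sup>2 * sg x - 2 * k * s0 * \<phi> x)"
proof -
  have "c\<^sup>2 * sg x * (d 1 x)\<^sup>2 = c * (sg x * (k\<^sup>2 * (c - 2 * k\<^sup>2) + c * (\<phi> x)\<^sup>2) - 2 * (k * s0 ^ 3) * \<phi> x)"
    using first_integral[of x] unfolding a_eq[symmetric] by (simp add: power2_eq_square)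
  also have "\<dots> = (s0 * \<phi> x - k * sg x)\<^sup>2 * (sg x * s0\<^sup>2 - k\<^sup>2 * sg x - 2 * k * s0 * \<phi> x)"
    using sg_sq[of x] s0_sq by (rule first_integral_identity)
  finally show ?thesis by (simp add: wave_N_def)
qed

section \<open>The profile lies strictly above its background\<close>

lemma N_deriv: "(N has_real_derivative d 1 x * (s0 * sg x + k * \<phi> x) / sg x) (at x)"
  unfolding wave_N_def[abs_def] using sg_pos[of x]
  by (auto intro!: derivative_eq_intros phi_deriv sg_deriv simp: field_simps)

lemma N_cont: "continuous_on A N"
  by (rule continuous_on_subset[OF DERIV_continuous_on_UNIV[OF N_deriv]]) simp

text \<open>By \<open>first_integral_N\<close>, \<open>(\<phi>')^2\<close> is a multiple of
  \<open>N^2\<close>, hence so is \<open>(N')^2\<close>: a single zero would propagate and make the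
  profile the constant \<open>k\<close>, which is excluded.\<close>

lemma N_nz: "N x \<noteq> 0"
proof
  assume z: "N x = 0"
  \<comment> \<open>The exact ratio of the two sides: the Gronwall bound is met with
    equality.\<close>
  define \<kappa> where "\<kappa> x = 4 * ((s0\<^sup>2 - k\<^sup>2 - 2 * k * s0 * \<phi> x / sg x) / c\<^sup>2) * ((s0 * sg x + k * \<phi> x) / sg x)\<^sup>2" for x
  have "N y = 0" for y
  proof -
    have "(N y)\<^sup>2 = 0"
    proof (rule gronwall_zero[where u="\<lambda>x. (N x)\<^sup>2" and ?x0.0=x and u'="\<lambda>x. 2 * N x * (d 1 x * (s0 * sg x + k * \<phi> x) / sg x)" and \<kappa>=\<kappa>])
      show "((\<lambda>x. (N x)\<^sup>2) has_real_derivative 2 * N x * (d 1 x * (s0 * sg x + k * \<phi> x) / sg x)) (at x)" for x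
        by (auto intro!: derivative_eq_intros N_deriv)
      have sg: "sg x \<noteq> 0" for x using sg_pos[of x] by simp
      show "(2 * N x * (d 1 x * (s0 * sg x + k * \<phi> x) / sg x))\<^sup>2 \<le> \<kappa> x * ((N x)\<^sup>2)\<^sup>2" for x
      proof -
        have "(d 1 x)\<^sup>2 = (N x)\<^sup>2 * ((s0\<^sup>2 - k\<^sup>2 - 2 * k * s0 * \<phi> x / sg x) / c\<^sup>2)"
          using first_integral_N[of x] sg[of x] c_pos by (simp add: field_simps)
        then have "4 * (N x)\<^sup>2 * (d 1 x)\<^sup>2 * ((s0 * sg x + k * \<phi> x) / sg x)\<^sup>2 = \<kappa> x * ((N x)\<^sup>2)\<^sup>2"
          unfolding \<kappa>_def by (simp add: power2_eq_square)
        then show ?thesis by (simp add: power_mult_distrib power_divide)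
      qed
      show "continuous_on UNIV \<kappa>" unfolding \<kappa>_def using sg c_pos
        by (intro continuous_intros phi_cont sg_cont) auto
    qed (use z in auto)
    then show ?thesis by simp
  qed
  then have "\<phi> y = k" for y
  proof -
    have e: "s0 * \<phi> y = k * sg y" using \<open>N y = 0\<close> by (simp add: wave_N_def)
    then have "s0 * \<phi> y > 0" using k_pos sg_pos by simp
    then have p: "\<phi> y > 0" using s0_pos by (simp add: zero_less_mult_iff)
    have "c * (\<phi> y)\<^sup>2 = c * k\<^sup>2" using e sg_sq[of y] s0_sq by algebra
    then have "(\<phi> y)\<^sup>2 = k\<^sup>2" using c_pos by simp
    then show ?thesis using p k_pos by (simp add: power2_eq_iff)
  qed
  then have "\<phi> constant_on UNIV" by (auto simp: constant_on_def)
  then show False using profile by (simp add: solitary_profile_def)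
qed

text \<open>At the crest \<open>\<phi>' = 0\<close> while \<open>N \<noteq> 0\<close>, so the other
  factor of the first integral vanishes and gives \<open>2 k N = sg (c - 4 k^2)\<close>. Here
  \<open>k < sqrt c / 2\<close> decides the sign, and continuity carries it along the line.\<close>

lemma N_pos: "N x > 0"
proof -
  have "(N 0)\<^sup>2 * (sg 0 * s0\<^sup>2 - k\<^sup>2 * sg 0 - 2 * k * s0 * \<phi> 0) = 0"
    using first_integral_N[of 0] d1_0 by simp
  then have "sg 0 * s0\<^sup>2 - k\<^sup>2 * sg 0 - 2 * k * s0 * \<phi> 0 = 0" using N_nz[of 0] by simp
  then have "2 * k * N 0 = sg 0 * (c - 4 * k\<^sup>2)"
    using s0_sq unfolding wave_N_def by algebra
  then have "2 * k * N 0 > 0" using four_k2 sg_pos[of 0] by simp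
  then have 0: "N 0 > 0" using k_pos by (simp add: zero_less_mult_iff)
  show ?thesis
  proof (rule ccontr)
    assume "\<not> N x > 0"
    then have x: "N x \<le> 0" by simp
    have "\<exists>z. N z = 0"
    proof (cases "x \<le> 0")
      case True then show ?thesis using IVT'[of N x 0 0] x 0 N_cont by auto
    next
      case False then show ?thesis using IVT2'[of N x 0 0] x 0 N_cont by auto
    qed
    then show False using N_nz by blast
  qed
qed

section \<open>The coordinates \<open>b\<close>, \<open>t\<close>, \<open>q\<close> and the closed
  form of the position\<close>

lemma b_pos: "b > 0" and three_b2: "3 * b\<^sup>2 < 1"
proof -
  show "b > 0" using k_pos s0_pos by (simp add: wave_b_def)
  have e: "b\<^sup>2 = k\<^sup>2 / (c - k\<^sup>2)" using s0_sq by (simp add: wave_b_def power_divide)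
  show "3 * b\<^sup>2 < 1" unfolding e using ck2 four_k2 by (simp add: field_simps)
qed

lemma Q_pos: "Q > 0" and Q_sq: "Q\<^sup>2 = 1 - 3 * b\<^sup>2"
  using three_b2 by (auto simp: wave_Q_def)

lemma one_t2: "1 + (t x)\<^sup>2 = c / (sg x)\<^sup>2" and one_b2: "1 + b\<^sup>2 = c / s0\<^sup>2"
  and t_minus_b: "t x - b = N x / (sg x * s0)"
  using sg_pos[of x] sg_sq[of x] s0_pos s0_sq ck2
  by (simp_all add: field_simps wave_N_def wave_b_def)

lemma t_gt_b: "t x > b"
proof -
  have "t x - b > 0" unfolding t_minus_b using N_pos[of x] sg_pos[of x] s0_pos by simp
  then show ?thesis by simp
qed

lemma phi_pos: "\<phi> x > 0"
proof -
  have "t x > 0" using t_gt_b[of x] b_pos by linarith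
  then show ?thesis using sg_pos[of x] by (simp add: zero_less_divide_iff)
qed

lemma q_sq: "(q x)\<^sup>2 = 1 - b\<^sup>2 - 2 * b * t x"
proof -
  have nz: "sg x \<noteq> 0" "s0 \<noteq> 0" "N x \<noteq> 0" using sg_pos[of x] s0_pos N_nz by auto
  have "(q x)\<^sup>2 = c\<^sup>2 * (d 1 x)\<^sup>2 / (s0\<^sup>2 * (N x)\<^sup>2)"
    by (simp add: wave_q_def d_1 power_divide power_mult_distrib)
  also have "\<dots> = (c\<^sup>2 * sg x * (d 1 x)\<^sup>2) / (sg x * s0\<^sup>2 * (N x)\<^sup>2)" using nz by simp
  also have "\<dots> = (sg x * s0\<^sup>2 - k\<^sup>2 * sg x - 2 * k * s0 * \<phi> x) / (sg x * s0\<^sup>2)"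
    unfolding first_integral_N using nz by simp
  also have "\<dots> = 1 - (k / s0)\<^sup>2 - 2 * (k / s0) * t x"
    using nz by (simp add: diff_divide_distrib power_divide) (simp add: power2_eq_square mult_ac)
  finally show ?thesis by (simp add: wave_b_def)
qed

text \<open>In the quotient rule \<open>\<phi>''\<close> is taken from the profile equation and
  \<open>(\<phi>')^2\<close> from the first integral, after which the denominator \<open>N^2\<close>
  cancels.\<close>

lemma q_deriv: "(q has_real_derivative b * (1 + (t x)\<^sup>2) * (t x - b) / (1 + b\<^sup>2)) (at x)"
proof -
  have nz: "sg x \<noteq> 0" "s0 \<noteq> 0" "N x \<noteq> 0" "c \<noteq> 0" using sg_pos[of x] s0_pos N_nz c_pos by auto
  have "(q has_real_derivative ((- c * d 2 x) * (s0 * N x) - (- c * d 1 x) * (s0 * (d 1 x * (s0 * sg x + k * \<phi> x) / sg x)))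
      / ((s0 * N x) * (s0 * N x))) (at x)"
    unfolding wave_q_def[abs_def] d_1 using nz
    by (intro DERIV_divide DERIV_cmult N_deriv d1_deriv) auto
  moreover have "((- c * d 2 x) * (s0 * N x) - (- c * d 1 x) * (s0 * (d 1 x * (s0 * sg x + k * \<phi> x) / sg x)))
      / ((s0 * N x) * (s0 * N x)) = k * N x / (sg x) ^ 3"
  proof -
    have f: "c\<^sup>2 * sg x * (d 1 x)\<^sup>2 = (N x)\<^sup>2 * (sg x * s0\<^sup>2 - k\<^sup>2 * sg x - 2 * k * s0 * \<phi> x)"
      by (rule first_integral_N)
    have d2: "sg x ^ 3 * d 2 x = \<phi> x * sg x ^ 3 - k * s0 ^ 3"
      unfolding d2_eq a_eq using nz by (simp add: field_simps)
    have n: "N x = s0 * \<phi> x - k * sg x" by (simp add: wave_N_def)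
    have s: "(sg x)\<^sup>2 = c - (\<phi> x)\<^sup>2" "s0\<^sup>2 = c - k\<^sup>2" using sg_sq s0_sq by auto
    \<comment> \<open>The factor \<open>c * (sg x)^2\<close> clears denominators, so that
      \<open>sg^3 * \<phi>''\<close> and \<open>c^2 * sg * (\<phi>')^2\<close> appear as blocks to
      which \<open>d2\<close> and \<open>f\<close> apply.\<close>
    have key: "c * (sg x)\<^sup>2 * (- c * d 2 x * sg x * N x + c * (d 1 x)\<^sup>2 * (s0 * sg x + k * \<phi> x)) = c * (k * s0 * (N x) ^ 3)"
    proof -
      have "c * (sg x)\<^sup>2 * (- c * d 2 x * sg x * N x + c * (d 1 x)\<^sup>2 * (s0 * sg x + k * \<phi> x))
        = - c\<^sup>2 * (sg x ^ 3 * d 2 x) * N x + (c\<^sup>2 * sg x * (d 1 x)\<^sup>2) * sg x * (s0 * sg x + k * \<phi> x)"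
        by algebra
      also have "\<dots> = - c\<^sup>2 * (\<phi> x * sg x ^ 3 - k * s0 ^ 3) * N x
         + ((N x)\<^sup>2 * (sg x * s0\<^sup>2 - k\<^sup>2 * sg x - 2 * k * s0 * \<phi> x)) * sg x * (s0 * sg x + k * \<phi> x)"
        unfolding f d2 ..
      also have "\<dots> = N x * (- c\<^sup>2 * (\<phi> x * sg x ^ 3 - k * s0 ^ 3)
         + (N x * (sg x * s0\<^sup>2 - k\<^sup>2 * sg x - 2 * k * s0 * \<phi> x)) * sg x * (s0 * sg x + k * \<phi> x))"
        by algebra
      also have "- c\<^sup>2 * (\<phi> x * sg x ^ 3 - k * s0 ^ 3)
         + (N x * (sg x * s0\<^sup>2 - k\<^sup>2 * sg x - 2 * k * s0 * \<phi> x)) * sg x * (s0 * sg x + k * \<phi> x)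
        = c * k * s0 * (N x)\<^sup>2"
        unfolding n using s by (rule slope_identity)
      finally show ?thesis by algebra
    qed
    have "c * (sg x)\<^sup>2 \<noteq> 0" "c * s0 \<noteq> 0" using nz by auto
    have "((- c * d 2 x) * (s0 * N x) - (- c * d 1 x) * (s0 * (d 1 x * (s0 * sg x + k * \<phi> x) / sg x)))
      / ((s0 * N x) * (s0 * N x)) = (- c * d 2 x * sg x * N x + c * (d 1 x)\<^sup>2 * (s0 * sg x + k * \<phi> x)) / (s0 * sg x * (N x)\<^sup>2)"
      using nz by (simp add: field_simps power2_eq_square)
    also have "\<dots> = c * (sg x)\<^sup>2 * (- c * d 2 x * sg x * N x + c * (d 1 x)\<^sup>2 * (s0 * sg x + k * \<phi> x)) / (c * (sg x)\<^sup>2 * (s0 * sg x * (N x)\<^sup>2))"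
      using nz by simp
    also have "\<dots> = k * N x / (sg x) ^ 3"
      unfolding key using nz by (simp add: field_simps power2_eq_square power3_eq_cube)
    finally show ?thesis .
  qed
  moreover have "b * (1 + (t x)\<^sup>2) * (t x - b) / (1 + b\<^sup>2) = k * N x / (sg x) ^ 3"
    unfolding one_t2 one_b2 t_minus_b using nz by (simp add: wave_b_def field_simps power2_eq_square power3_eq_cube)
  ultimately show ?thesis by simp
qed

lemma q_0: "q 0 = 0" by (simp add: wave_q_def d_1 d1_0)

lemma q_odd: "q (- x) = - q x"
  by (simp add: wave_q_def wave_N_def d_1 d1_odd sg_even phi_even)

lemma Q2_minus_q2: "Q\<^sup>2 - (q x)\<^sup>2 = 2 * b * (t x - b)"
  unfolding Q_sq q_sq by algebra

lemma q_less_Q: "\<bar>q x\<bar> < Q"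
proof -
  have "(q x)\<^sup>2 < Q\<^sup>2" using Q2_minus_q2[of x] t_gt_b[of x] b_pos by (smt (verit) mult_pos_pos)
  then show ?thesis using Q_pos by (metis abs_of_pos power2_less_imp_less abs_ge_zero power2_abs less_imp_le)
qed

lemma q_sum: "(1 - q x) / ((1 - q x)\<^sup>2 + b\<^sup>2) + (1 + q x) / ((1 + q x)\<^sup>2 + b\<^sup>2) = (t x + b) / (b * (1 + (t x)\<^sup>2))"
proof -
  have p: "(1 - q x)\<^sup>2 + b\<^sup>2 > 0" "(1 + q x)\<^sup>2 + b\<^sup>2 > 0" "1 + (t x)\<^sup>2 > 0"
    using b_pos by (auto intro: add_nonneg_pos add_pos_nonneg)
  define T where "T = t x"
  have q2: "(q x)\<^sup>2 = 1 - b\<^sup>2 - 2 * b * T" using q_sq[of x] by (simp add: T_def)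
  \<comment> \<open>Inserting \<open>q^2 = 1 - b^2 - 2 b T\<close> produces the factor
    \<open>1 + T^2\<close> that later cancels against the one in \<open>q'\<close>.\<close>
  have P: "((1 - q x)\<^sup>2 + b\<^sup>2) * ((1 + q x)\<^sup>2 + b\<^sup>2) = 4 * b\<^sup>2 * (1 + T\<^sup>2)"
    using q2 by algebra
  have "(1 - q x) / ((1 - q x)\<^sup>2 + b\<^sup>2) + (1 + q x) / ((1 + q x)\<^sup>2 + b\<^sup>2)
     = ((1 - q x) * ((1 + q x)\<^sup>2 + b\<^sup>2) + (1 + q x) * ((1 - q x)\<^sup>2 + b\<^sup>2)) / (((1 - q x)\<^sup>2 + b\<^sup>2) * ((1 + q x)\<^sup>2 + b\<^sup>2))"
    by (subst add_frac_eq) (use p in auto)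
  also have "(1 - q x) * ((1 + q x)\<^sup>2 + b\<^sup>2) + (1 + q x) * ((1 - q x)\<^sup>2 + b\<^sup>2) = 4 * b * (T + b)"
    using q2 by algebra
  also have "4 * b * (T + b) / (((1 - q x)\<^sup>2 + b\<^sup>2) * ((1 + q x)\<^sup>2 + b\<^sup>2)) = (T + b) / (b * (1 + T\<^sup>2))"
    unfolding P using b_pos by (simp add: power2_eq_square)
  finally show ?thesis by (simp add: T_def)
qed

text \<open>The left side has derivative 1 by the partial fractions \<open>(1 + b^2) / ((t - b) (1 +
  t^2)) = 1 / (t - b) - (t + b) / (1 + t^2)\<close>: the first part yields the logarithms with
  \<open>Q\<close>, the second \<open>wave_M\<close>. The constant is fixed by
  \<open>q 0 = 0\<close>.\<close>

lemma position_eq: "(ln (Q + q x) - ln (Q - q x)) / Q + wave_M b (q x) = x"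
proof -
  define X where "X x = (ln (Q + q x) - ln (Q - q x)) / Q + wave_M b (q x)" for x
  have "((\<lambda>x. X x - x) has_real_derivative 0) (at x)" for x
  proof -
    define q' where "q' = b * (1 + (t x)\<^sup>2) * (t x - b) / (1 + b\<^sup>2)"
    have qd: "(q has_real_derivative q') (at x)" using q_deriv[of x] by (simp add: q'_def)
    have p: "Q + q x > 0" "Q - q x > 0" using q_less_Q[of x] by auto
    have M: "((\<lambda>x. wave_M b (q x)) has_real_derivative - q' * ((t x + b) / (b * (1 + (t x)\<^sup>2)))) (at x)"
      using wave_M_deriv[OF _ DERIV_const refl qd refl, of b] b_pos unfolding q_sum by simp
    have L: "((\<lambda>x. (ln (Q + q x) - ln (Q - q x)) / Q) has_real_derivative (q' / (Q + q x) + q' / (Q - q x)) / Q) (at x)"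
      using p Q_pos by (auto intro!: derivative_eq_intros qd simp: inverse_eq_divide)
    have "(q' / (Q + q x) + q' / (Q - q x)) / Q = 2 * q' / (Q\<^sup>2 - (q x)\<^sup>2)"
    proof -
      have "q' / (Q + q x) + q' / (Q - q x) = 2 * Q * q' / ((Q + q x) * (Q - q x))"
        by (subst add_frac_eq) (use p in \<open>auto simp: algebra_simps\<close>)
      moreover have "(Q + q x) * (Q - q x) = Q\<^sup>2 - (q x)\<^sup>2" by algebra
      ultimately show ?thesis using Q_pos by simp
    qed
    also have "\<dots> = q' / (b * (t x - b))" unfolding Q2_minus_q2 using b_pos by simp
    finally have L': "((\<lambda>x. (ln (Q + q x) - ln (Q - q x)) / Q) has_real_derivative q' / (b * (t x - b))) (at x)"
      using L by simp
    define T where "T = t x"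
    have T: "T > b" using t_gt_b T_def by simp
    have pp: "1 + T\<^sup>2 > 0" "1 + b\<^sup>2 > 0" by (auto intro: add_pos_nonneg)
    have "q' / (b * (t x - b)) + - q' * ((t x + b) / (b * (1 + (t x)\<^sup>2))) = 1"
    proof -
      have "q' / (b * (t x - b)) = (1 + T\<^sup>2) / (1 + b\<^sup>2)"
        unfolding q'_def T_def[symmetric] using T b_pos by simp
      moreover have "q' * ((t x + b) / (b * (1 + (t x)\<^sup>2))) = (T - b) * (T + b) / (1 + b\<^sup>2)"
        unfolding q'_def T_def[symmetric] using T b_pos pp by simp
      moreover have "(1 + T\<^sup>2) / (1 + b\<^sup>2) - (T - b) * (T + b) / (1 + b\<^sup>2) = 1"
      proof -
        have "1 + T\<^sup>2 - (T - b) * (T + b) = 1 + b\<^sup>2" by algebra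
        then show ?thesis using pp by (simp add: diff_divide_distrib[symmetric])
      qed
      ultimately show ?thesis by simp
    qed
    then show ?thesis
      unfolding X_def[abs_def] using DERIV_diff[OF DERIV_add[OF L' M] DERIV_ident] by simp
  qed
  then obtain C where C: "\<And>x. X x - x = C" using DERIV_isconst_all by blast
  have "C = 0" using C[of 0] by (simp add: X_def q_0 wave_M_def)
  then show ?thesis using C[of x] by (simp add: X_def)
qed

section \<open>Uniform bounds and exponential decay\<close>

lemma sg_nz: "sg x \<noteq> 0" using sg_pos[of x] by simp

text \<open>This is \<open>q^2 \<ge> 0\<close>, with equality at the crest.\<close>

lemma t_upper: "t x \<le> (1 - b\<^sup>2) / (2 * b)"
proof -
  have "2 * b * t x \<le> 1 - b\<^sup>2" using q_sq[of x] zero_le_power2[of "q x"] by linarith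
  then show ?thesis using b_pos by (simp add: field_simps)
qed

lemma t_bounded: "bounded_fun t"
proof (rule bounded_funI)
  fix x show "\<bar>t x\<bar> \<le> (1 - b\<^sup>2) / (2 * b)" using t_upper[of x] t_gt_b[of x] b_pos by linarith
qed

lemma sg_upper: "sg x \<le> sqrt c"
  unfolding wave_sigma_def by (intro real_sqrt_le_mono) simp

text \<open>The bound on \<open>t\<close> keeps \<open>\<phi>^2\<close> uniformly below
  \<open>c\<close>; consequently negative powers of \<open>sg\<close>, and with them
  \<open>\<mu>\<close>, are bounded.\<close>

lemma sg_lower: obtains l where "l > 0" "\<And>x. l \<le> sg x"
proof
  define T where "T = (1 - b\<^sup>2) / (2 * b)"
  have pT: "1 + T\<^sup>2 > 0" by (intro add_pos_nonneg) auto
  show "sqrt (c / (1 + T\<^sup>2)) > 0" using c_pos pT by simp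
  fix x
  have "(t x)\<^sup>2 \<le> T\<^sup>2" using t_upper[of x] t_gt_b[of x] b_pos unfolding T_def by (intro power_mono) auto
  then have "c / (sg x)\<^sup>2 \<le> 1 + T\<^sup>2" using one_t2[of x] by simp
  then have "c / (1 + T\<^sup>2) \<le> (sg x)\<^sup>2" using sg_pos[of x] pT by (simp add: field_simps)
  then show "sqrt (c / (1 + T\<^sup>2)) \<le> sg x" using sg_pos[of x] by (simp add: real_le_lsqrt)
qed

lemma sg_bounded: "bounded_fun sg"
proof (rule bounded_funI)
  fix x show "\<bar>sg x\<bar> \<le> sqrt c" using sg_upper[of x] sg_pos[of x] by simp
qed

lemma inv_sg_bounded: "bounded_fun (\<lambda>x. inverse (sg x))"
  using sg_lower bounded_fun_inverse by metis

lemma q_bounded: "bounded_fun q"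
  by (rule bounded_funI[of _ Q]) (use q_less_Q less_imp_le in auto)

lemma inv_s0_sg_bounded: "bounded_fun (\<lambda>x. inverse (s0 + sg x))"
  by (rule bounded_fun_inverse[OF s0_pos]) (use sg_pos less_imp_le in auto)

text \<open>Multiplying \<open>s0 - sg\<close> by its conjugate exposes the factor
  \<open>\<phi> - k\<close>, through which the decay of the profile passes to \<open>N\<close>,
  \<open>t - b\<close> and the variational derivative.\<close>

lemma N_factor: "N x = (\<phi> x - k) * (s0 + k * (\<phi> x + k) * inverse (s0 + sg x))"
proof -
  have p: "s0 + sg x > 0" using s0_pos sg_pos[of x] by simp
  have "(s0 - sg x) * (s0 + sg x) = (\<phi> x - k) * (\<phi> x + k)"
    using s0_sq sg_sq[of x] by algebra
  then have "s0 - sg x = (\<phi> x - k) * (\<phi> x + k) * inverse (s0 + sg x)"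
    using p by (simp add: field_simps)
  then have "k * (s0 - sg x) = k * ((\<phi> x - k) * (\<phi> x + k) * inverse (s0 + sg x))" by simp
  then show ?thesis unfolding wave_N_def by (simp add: algebra_simps)
qed

lemma N_decay: "exp_decay N"
  unfolding N_factor[abs_def]
  by (intro exp_decay_mult_right decay_intros phi_decay phi_bounded inv_s0_sg_bounded)

lemma t_decay: "exp_decay (\<lambda>x. t x - b)"
proof -
  have "exp_decay (\<lambda>x. N x * (inverse (sg x) * inverse s0))"
    by (intro exp_decay_mult_right decay_intros N_decay inv_sg_bounded)
  then show ?thesis unfolding t_minus_b by (simp add: divide_inverse)
qed

section \<open>Powers of the momentum and the integrand of the functional\<close>

lemma mu_pos: "\<mu> x > 0" unfolding mu_eq using a_pos sg_pos[of x] by simp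

lemma mu_bounds: obtains l u where "l > 0" "\<And>x. l \<le> \<mu> x" "\<And>x. \<mu> x \<le> u"
proof -
  obtain l where l: "l > 0" "\<And>x. l \<le> sg x" using sg_lower by blast
  show ?thesis
  proof (rule that)
    show "a / (sqrt c) ^ 3 > 0" using a_pos c_pos by simp
    show "a / (sqrt c) ^ 3 \<le> \<mu> x" for x
      unfolding mu_eq using a_pos c_pos sg_pos[of x] sg_upper[of x]
      by (intro divide_left_mono power_mono) (auto intro!: mult_pos_pos)
    show "\<mu> x \<le> a / l ^ 3" for x
      unfolding mu_eq using a_pos l(1) l(2)[of x] sg_pos[of x]
      by (intro divide_left_mono power_mono) (auto intro!: mult_pos_pos)
  qed
qed

text \<open>\<open>\<mu> / k\<close> is the cube of \<open>s0 / sg\<close>, so powers of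
  \<open>\<mu>\<close> with exponents in thirds become integer powers of \<open>sg\<close> up to
  constants.\<close>

lemma mu_powr: "\<mu> x powr e = k powr e * (s0 / sg x) powr (3 * e)"
proof -
  have "\<mu> x = k * (s0 / sg x) ^ 3" unfolding mu_eq a_eq by (simp add: power_divide)
  also have "\<dots> = k * (s0 / sg x) powr 3"
    using s0_pos sg_pos[of x] by (simp add: powr_numeral)
  finally show ?thesis
    using k_pos s0_pos sg_pos[of x] by (simp add: powr_mult powr_powr del: powr_numeral)
qed

lemma mu_powr_23: "k powr (4/3) * \<mu> x powr (2/3) = k\<^sup>2 * (s0 / sg x)\<^sup>2"
proof -
  have "k powr (4/3) * k powr (2/3) = k\<^sup>2"
    using k_pos by (subst powr_add[symmetric]) (simp add: powr_numeral)
  moreover have "(s0 / sg x) powr (3 * (2/3)) = (s0 / sg x)\<^sup>2"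
    using s0_pos sg_pos[of x] by (simp add: powr_numeral)
  ultimately show ?thesis unfolding mu_powr by (simp add: mult.assoc[symmetric])
qed

lemma mu_powr_m13: "k powr (4/3) * \<mu> x powr (-1/3) = k * sg x / s0"
proof -
  have "k powr (4/3) * k powr (-1/3) = k"
    using k_pos by (subst powr_add[symmetric]) simp
  moreover have "(s0 / sg x) powr (3 * (-1/3)) = sg x / s0"
    using s0_pos sg_pos[of x] by (simp add: powr_minus_divide)
  ultimately show ?thesis unfolding mu_powr by (simp add: mult.assoc[symmetric])
qed

lemma helmholtz_mu: "helmholtz_inv \<mu> x = \<phi> x"
proof -
  have "\<mu> = (\<lambda>y. \<phi> y - d 2 y)" by (simp add: momentum_def d_2 fun_eq_iff)
  then show ?thesis
    using helmholtz_inv_eq[OF phi_deriv d1_deriv d_cont phi_bounded d_bounded d_bounded] by simp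
qed

text \<open>The two terms of the variational derivative combine to a multiple of \<open>N\<close>,
  so it decays although \<open>\<phi>\<close> does not.\<close>

lemma dF_eq: "nov_dF k \<mu> x = 2 * N x / s0"
  unfolding nov_dF_def helmholtz_mu mult.assoc mu_powr_m13 wave_N_def
  using s0_pos by (simp add: field_simps)

lemma dF_decay: "exp_decay (nov_dF k \<mu>)" and dF_cont: "continuous_on UNIV (nov_dF k \<mu>)"
  unfolding dF_eq[abs_def] using s0_pos
  by (intro exp_decay_divide_const exp_decay_cmult N_decay continuous_intros N_cont; simp)+

lemma density_eq: "wave_density k \<phi> x = \<mu> x * \<phi> x - k\<^sup>2 - 3 * k\<^sup>2 * ((s0 / sg x)\<^sup>2 - 1)"
proof -
  have "k powr (4/3) * k powr (2/3) = k\<^sup>2"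
    using k_pos by (subst powr_add[symmetric]) (simp add: powr_numeral)
  then show ?thesis
    unfolding wave_density_def using mu_powr_23[of x] by (simp add: algebra_simps)
qed

lemma density_factor: "wave_density k \<phi> x = c * b / (1 + b\<^sup>2)\<^sup>2 * ((t x - b) * ((t x - b)\<^sup>2 + Q\<^sup>2))"
proof -
  define T B where "T = t x" and "B = b"
  have p: "1 + B\<^sup>2 > 0" by (intro add_pos_nonneg) auto
  \<comment> \<open>The relations \<open>1 + T^2 = c / sg^2\<close> and
    \<open>1 + B^2 = c / s0^2\<close> make the density rational in \<open>T\<close> and
    \<open>B\<close>.\<close>
  have 1: "(s0 / sg x)\<^sup>2 = (1 + T\<^sup>2) / (1 + B\<^sup>2)"
    unfolding T_def B_def one_t2 one_b2 using c_pos sg_pos[of x] s0_pos by (simp add: power_divide)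
  have 2: "k\<^sup>2 = c * B\<^sup>2 / (1 + B\<^sup>2)"
    unfolding B_def one_b2 using c_pos s0_pos by (simp add: wave_b_def power_divide)
  have "\<mu> x * \<phi> x = (k / s0) * ((s0 / sg x)\<^sup>2 * s0\<^sup>2) * T"
    unfolding mu_eq a_eq T_def using s0_pos sg_pos[of x] by (simp add: field_simps power2_eq_square power3_eq_cube)
  also have "\<dots> = B * ((1 + T\<^sup>2) / (1 + B\<^sup>2) * (c / (1 + B\<^sup>2))) * T"
    unfolding 1 unfolding B_def one_b2 using c_pos s0_pos by (simp add: wave_b_def)
  finally have 3: "\<mu> x * \<phi> x = c * B * T * (1 + T\<^sup>2) / (1 + B\<^sup>2)\<^sup>2" by (simp add: power2_eq_square)
  have "wave_density k \<phi> x = (c * B * T * (1 + T\<^sup>2) - c * B\<^sup>2 * (1 + B\<^sup>2) - 3 * c * B\<^sup>2 * (T\<^sup>2 - B\<^sup>2)) / (1 + B\<^sup>2)\<^sup>2"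
    unfolding density_eq 1 3 unfolding 2 using p
    by (simp add: divide_simps) (simp add: algebra_simps power2_eq_square)
  also have "c * B * T * (1 + T\<^sup>2) - c * B\<^sup>2 * (1 + B\<^sup>2) - 3 * c * B\<^sup>2 * (T\<^sup>2 - B\<^sup>2) = c * B * ((T - B) * ((T - B)\<^sup>2 + (1 - 3 * B\<^sup>2)))"
    by algebra
  finally show ?thesis unfolding Q_sq T_def B_def by simp
qed

lemma density_pos: "wave_density k \<phi> x > 0"
proof -
  have "(t x - b)\<^sup>2 + Q\<^sup>2 > 0" using Q_pos by (intro add_nonneg_pos) auto
  moreover have "1 + b\<^sup>2 > 0" by (intro add_pos_nonneg) auto
  ultimately show ?thesis
    unfolding density_factor using c_pos b_pos t_gt_b[of x]
    by (intro mult_pos_pos divide_pos_pos zero_less_power) auto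
qed

lemma density_decay: "exp_decay (wave_density k \<phi>)"
  unfolding density_factor[abs_def]
  by (intro exp_decay_cmult exp_decay_mult_right decay_intros t_decay t_bounded)

lemma density_cont: "continuous_on A (wave_density k \<phi>)"
  unfolding density_factor[abs_def]
  by (intro continuous_intros phi_cont sg_cont) (auto simp: sg_nz)

lemma density_primitive: "((\<lambda>x. (c - k\<^sup>2) * wave_Z b (q x)) has_real_derivative wave_density k \<phi> x) (at x)"
proof -
  define T B where "T = t x" and "B = b"
  define q' where "q' = B * (1 + T\<^sup>2) * (T - B) / (1 + B\<^sup>2)"
  have qd: "(q has_real_derivative q') (at x)" using q_deriv[of x] by (simp add: q'_def T_def B_def)
  have p: "1 + B\<^sup>2 > 0" "1 + T\<^sup>2 > 0" by (auto intro!: add_pos_nonneg)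
  have Bp: "B > 0" using b_pos by (simp add: B_def)
  have M: "((\<lambda>x. wave_M b (q x)) has_real_derivative - q' * ((T + B) / (B * (1 + T\<^sup>2)))) (at x)"
    using wave_M_deriv[OF _ DERIV_const refl qd refl, of b] b_pos unfolding q_sum by (simp add: T_def B_def)
  have "((\<lambda>x. (c - k\<^sup>2) * wave_Z b (q x)) has_real_derivative
      (c - k\<^sup>2) * (q' + 2 * b\<^sup>2 * (- q' * ((T + B) / (B * (1 + T\<^sup>2)))))) (at x)"
    unfolding wave_Z_def by (intro DERIV_cmult DERIV_add qd M)
  moreover have "(c - k\<^sup>2) * (q' + 2 * b\<^sup>2 * (- q' * ((T + B) / (B * (1 + T\<^sup>2))))) = wave_density k \<phi> x"
  proof -
    have 0: "c - k\<^sup>2 = c / (1 + B\<^sup>2)"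
      unfolding B_def one_b2 using c_pos s0_pos s0_sq by simp
    have "q' * ((T + B) / (B * (1 + T\<^sup>2))) = (T - B) * (T + B) / (1 + B\<^sup>2)"
      unfolding q'_def using p Bp by simp
    then have "q' + 2 * b\<^sup>2 * (- q' * ((T + B) / (B * (1 + T\<^sup>2)))) = q' - 2 * B\<^sup>2 * ((T - B) * (T + B) / (1 + B\<^sup>2))"
      by (simp add: B_def)
    also have "\<dots> = (B * (1 + T\<^sup>2) * (T - B) - 2 * B\<^sup>2 * ((T - B) * (T + B))) / (1 + B\<^sup>2)"
      unfolding q'_def by (simp add: diff_divide_distrib)
    \<comment> \<open>The same cubic as in \<open>density_factor\<close>; the coefficient
      \<open>2 b^2\<close> in \<open>wave_Z\<close> is the one for which the two agree.\<close>
    also have "B * (1 + T\<^sup>2) * (T - B) - 2 * B\<^sup>2 * ((T - B) * (T + B)) = B * ((T - B) * ((T - B)\<^sup>2 + (1 - 3 * B\<^sup>2)))"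
      by algebra
    finally show ?thesis
      unfolding density_factor Q_sq 0 by (simp add: T_def B_def power2_eq_square)
  qed
  ultimately show ?thesis by simp
qed

section \<open>Values at infinity and evaluation of the functional\<close>

lemma q_pos: "x > 0 \<Longrightarrow> q x > 0"
proof -
  assume "x > 0"
  have "q 0 < q x"
  proof (rule DERIV_pos_imp_increasing[OF \<open>x > 0\<close>])
    fix y
    have "b * (1 + (t y)\<^sup>2) * (t y - b) / (1 + b\<^sup>2) > 0"
      using b_pos t_gt_b[of y] by (intro divide_pos_pos mult_pos_pos add_pos_nonneg) auto
    then show "\<exists>z. (q has_real_derivative z) (at y) \<and> 0 < z" using q_deriv[of y] by blast
  qed
  then show ?thesis by (simp add: q_0)
qed

text \<open>\<open>Q2_minus_q2\<close> gives the limit of \<open>q^2\<close>; positivity of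
  \<open>q\<close> for \<open>x > 0\<close> selects the root.\<close>

lemma q_tendsto_top: "(q \<longlongrightarrow> Q) at_top"
proof -
  have "((\<lambda>x. sqrt (Q\<^sup>2 - 2 * b * (t x - b))) \<longlongrightarrow> sqrt (Q\<^sup>2 - 2 * b * 0)) at_top"
    by (intro tendsto_intros exp_decay_tendsto_top t_decay)
  moreover have "\<forall>\<^sub>F x in at_top. sqrt (Q\<^sup>2 - 2 * b * (t x - b)) = q x"
    using eventually_gt_at_top[of 0]
  proof eventually_elim
    case (elim x)
    have "Q\<^sup>2 - 2 * b * (t x - b) = (q x)\<^sup>2" using Q2_minus_q2[of x] by simp
    then show ?case using q_pos[OF elim] by simp
  qed
  ultimately have "(q \<longlongrightarrow> sqrt (Q\<^sup>2 - 2 * b * 0)) at_top" by (rule Lim_transform_eventually)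
  then show ?thesis using Q_pos by simp
qed

lemma q_tendsto_bot: "(q \<longlongrightarrow> - Q) at_bot"
  using tendsto_minus[OF q_tendsto_top] by (simp add: filterlim_at_bot_mirror q_odd)

lemma wave_Z_minus: "wave_Z B (- r) = - wave_Z B r"
  by (simp add: wave_Z_def wave_M_def field_simps)

lemma wave_Z_cont: "isCont (wave_Z b) r"
proof -
  have "(1 - r)\<^sup>2 + b\<^sup>2 > 0" "(1 + r)\<^sup>2 + b\<^sup>2 > 0" using b_pos by (auto intro!: add_nonneg_pos)
  then show ?thesis unfolding wave_Z_def[abs_def] wave_M_def by (intro continuous_intros) auto
qed

lemma density_integral: "(LINT x|lborel. wave_density k \<phi> x) = 2 * (c - k\<^sup>2) * wave_Z b Q"
proof -
  have "(LINT x|lborel. wave_density k \<phi> x) = (c - k\<^sup>2) * wave_Z b Q - (c - k\<^sup>2) * wave_Z b (- Q)"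
    by (rule LINT_FTC_real[OF density_primitive density_cont])
       (intro exp_decay_integrable density_decay density_cont tendsto_mult tendsto_const
          isCont_tendsto_compose[OF wave_Z_cont] q_tendsto_top q_tendsto_bot)+
  then show ?thesis by (simp add: wave_Z_minus)
qed

lemma d_diff_deriv: "((\<lambda>x. d n x - d (n + 2) x) has_real_derivative d (Suc n) x - d (Suc n + 2) x) (at x)"
  using DERIV_diff[OF d_deriv[of n x] d_deriv[of "n + 2" x]] by simp

lemma mu_d: "\<mu> = (\<lambda>x. d 0 x - d 2 x)"
  by (simp add: momentum_def d_2 d_0 fun_eq_iff)

lemma mu_cont: "continuous_on A \<mu>"
  unfolding mu_d by (intro continuous_intros d_cont)

lemma mu_bounded: "bounded_fun \<mu>"
  unfolding mu_d by (intro decay_intros d_bounded)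

text \<open>Splitting the integral requires integrability of both integrands, since a Bochner
  integral that does not exist is 0 by convention. The first integrand decays; the second is, up to
  a constant factor, a difference of integrable functions.\<close>

lemma nov_F_eq_density: "nov_F k \<mu> = (LINT x|lborel. wave_density k \<phi> x)"
proof -
  have "exp_decay (\<lambda>x. (\<phi> x - k) * \<phi> x + k * (\<phi> x - k) - d 2 x * \<phi> x)"
    by (intro exp_decay_diff exp_decay_add exp_decay_mult_right exp_decay_cmult phi_decay phi_bounded d_decay) simp
  then have "exp_decay (\<lambda>x. \<mu> x * \<phi> x - k\<^sup>2)"
    unfolding mu_d d_0 by (simp add: algebra_simps power2_eq_square)
  then have 1: "integrable lborel (\<lambda>x. \<mu> x * \<phi> x - k\<^sup>2)"
    by (intro exp_decay_integrable continuous_intros mu_cont phi_cont)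
  have "3 * k powr (4/3) \<noteq> 0" using k_pos by simp
  moreover have "integrable lborel (\<lambda>x. 3 * k powr (4/3) * (\<mu> x powr (2/3) - k powr (2/3)))"
  proof -
    have "integrable lborel (\<lambda>x. (\<mu> x * \<phi> x - k\<^sup>2) - wave_density k \<phi> x)"
      using 1 exp_decay_integrable[OF density_decay density_cont] by simp
    then show ?thesis by (simp add: wave_density_def)
  qed
  ultimately have 2: "integrable lborel (\<lambda>x. \<mu> x powr (2/3) - k powr (2/3))"
    using integrable_mult_right[of "1 / (3 * k powr (4/3))" lborel
        "\<lambda>x. 3 * k powr (4/3) * (\<mu> x powr (2/3) - k powr (2/3))"] by simp
  show ?thesis
    unfolding nov_F_def wave_density_def helmholtz_mu using 1 2 by simp
qed

lemma nov_F_eq: "nov_F k \<mu> = 2 * (c - k\<^sup>2) * wave_Z b Q"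
  using nov_F_eq_density density_integral by simp

lemma nov_F_pos: "nov_F k \<mu> > 0"
proof -
  have i: "integrable lborel (wave_density k \<phi>)"
    by (rule exp_decay_integrable[OF density_decay density_cont])
  have "(LINT x|lborel. wave_density k \<phi> x) \<noteq> 0"
  proof
    assume "(LINT x|lborel. wave_density k \<phi> x) = 0"
    then have "AE x in lborel. wave_density k \<phi> x = 0"
      using integral_nonneg_eq_0_iff_AE[OF i] density_pos by (simp add: less_imp_le)
    then have "AE x in (lborel :: real measure). False"
      by eventually_elim (use density_pos in \<open>metis less_irrefl\<close>)
    then show False by (simp add: eventually_False ae_filter_eq_bot_iff)
  qed
  moreover have "(LINT x|lborel. wave_density k \<phi> x) \<ge> 0"
    by (intro Bochner_Integration.integral_nonneg) (simp add: density_pos less_imp_le)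
  ultimately show ?thesis unfolding nov_F_eq_density by linarith
qed

section \<open>The Euler-Lagrange equation\<close>

lemma inv_sg_deriv: "((\<lambda>x. inverse (sg x)) has_real_derivative \<phi> x * d 1 x * inverse (sg x) ^ 3) (at x)"
  using DERIV_inverse_fun[OF sg_deriv] sg_pos[of x]
  by (simp add: field_simps power3_eq_cube power2_eq_square)

lemma inv_sg_power_deriv:
  "((\<lambda>x. inverse (sg x) ^ Suc m) has_real_derivative real (Suc m) * (\<phi> x * d 1 x * inverse (sg x) ^ (m + 3))) (at x)"
  using DERIV_power[OF inv_sg_deriv[of x], where n="Suc m"] by (simp add: power_add mult_ac)

lemma mu_d1: "d 1 x - d 3 x = 3 * a * \<phi> x * d 1 x * inverse (sg x) ^ 5"
proof -
  have e: "\<mu> = (\<lambda>x. a * inverse (sg x) ^ 3)" unfolding mu_eq[abs_def] by (simp add: divide_inverse power_inverse)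
  have "(\<mu> has_real_derivative 3 * a * \<phi> x * d 1 x * inverse (sg x) ^ 5) (at x)"
    unfolding e using DERIV_cmult[OF inv_sg_power_deriv[of 2 x], of a] by (simp add: mult_ac)
  moreover have "(\<mu> has_real_derivative d 1 x - d 3 x) (at x)"
    unfolding mu_d using d_diff_deriv[of 0 x] by (simp add: numeral_eq_Suc One_nat_def)
  ultimately show ?thesis using DERIV_unique by blast
qed

lemma mu_d2: "d 2 x - d 4 x = 3 * a * ((d 1 x)\<^sup>2 + \<phi> x * d 2 x) * inverse (sg x) ^ 5
    + 15 * a * (\<phi> x)\<^sup>2 * (d 1 x)\<^sup>2 * inverse (sg x) ^ 7"
proof -
  have e: "(\<lambda>x. d 1 x - d 3 x) = (\<lambda>x. 3 * a * (\<phi> x * d 1 x) * inverse (sg x) ^ 5)"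
    using mu_d1 by (simp add: fun_eq_iff)
  have "((\<lambda>x. d 1 x - d 3 x) has_real_derivative 3 * a * ((d 1 x)\<^sup>2 + \<phi> x * d 2 x) * inverse (sg x) ^ 5
    + 15 * a * (\<phi> x)\<^sup>2 * (d 1 x)\<^sup>2 * inverse (sg x) ^ 7) (at x)"
    unfolding e
    by (rule DERIV_cong[OF DERIV_mult[OF DERIV_cmult[OF DERIV_mult[OF phi_deriv d1_deriv], of "3 * a"]
            inv_sg_power_deriv[of 4 x, simplified]]])
       (simp add: algebra_simps power2_eq_square)
  moreover have "((\<lambda>x. d 1 x - d 3 x) has_real_derivative d 2 x - d 4 x) (at x)"
    using d_diff_deriv[of 1 x] by (simp add: numeral_eq_Suc One_nat_def)
  ultimately show ?thesis using DERIV_unique by blast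
qed

text \<open>Since \<open>\<mu> powr (-1/3) = \<alpha> * sg\<close> with
  \<open>\<alpha> = a powr (-1/3)\<close>, only natural powers occur, and
  \<open>\<alpha>^3 * a = 1\<close> brings every term to \<open>\<alpha>^5\<close> times a
  polynomial. The polynomial vanishes by the profile equation and the first integral.\<close>

lemma EL_equation:
  "8/3 * \<mu> x powr (-11/3) * (d 1 x - d 3 x)\<^sup>2 - 2 * \<mu> x powr (-8/3) * (d 2 x - d 4 x) - 6 * \<mu> x powr (-5/3)
        + 2/3 * nov_omega1 c k * \<mu> x powr (-1/3) + 2 * nov_omega0 c k * \<phi> x = 0"
proof -
  define \<alpha> s i where "\<alpha> = a powr (-1/3)" and "s = sg x" and "i = inverse (sg x)"
  have s: "s > 0" "s * i = 1" using sg_pos[of x] by (auto simp: s_def i_def)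
  have \<alpha>3: "\<alpha> ^ 3 * a = 1"
  proof -
    have "a powr (- real 3 / 3) = 1 / a" using a_pos by (simp add: powr_minus_divide)
    then show ?thesis unfolding \<alpha>_def powr_thirds[OF a_pos, of 3] using a_pos by simp
  qed
  have "\<mu> x powr (-1/3) = \<alpha> * s"
  proof -
    have "\<mu> x = a * i ^ 3" by (simp add: mu_eq i_def divide_inverse power_inverse)
    also have "\<dots> = a * s powr (- 3)" using s(1)
      by (simp add: i_def s_def powr_minus powr_numeral power_inverse)
    finally show ?thesis using a_pos s(1) by (simp add: powr_mult powr_powr \<alpha>_def)
  qed
  then have p: "\<mu> x powr (- real n / 3) = (\<alpha> * s) ^ n" for n
    using powr_thirds[OF mu_pos] by simp
  have ps: "\<mu> x powr (-11/3) = (\<alpha> * s) ^ 11" "\<mu> x powr (-8/3) = (\<alpha> * s) ^ 8" "\<mu> x powr (-5/3) = (\<alpha> * s) ^ 5"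
     "\<mu> x powr (-1/3) = \<alpha> * s"
    using p[of 11] p[of 8] p[of 5] p[of 1] by simp_all
  have w0: "nov_omega0 c k = - 9 * \<alpha>\<^sup>2"
    using powr_thirds[OF a_pos, of 2] by (simp add: nov_omega0_def \<alpha>_def)
  have w1: "nov_omega1 c k = 9 * c * \<alpha> ^ 4 * (2 * nov_E c k + c)"
    using powr_thirds[OF a_pos, of 4] by (simp add: nov_omega1_def \<alpha>_def)
  define f g h where "f = \<phi> x" and "g = d 1 x" and "h = d 2 x"
  have E: "2 * c * nov_E c k = k\<^sup>2 * (c - 2 * k\<^sup>2)" using c_pos by (simp add: nov_E_def)
  have 1: "c * s * g\<^sup>2 = s * (2 * c * nov_E c k + c * f\<^sup>2) - 2 * a * f"
    using first_integral[of x] unfolding E by (simp add: s_def g_def f_def)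
  have 2: "s ^ 3 * h = f * s ^ 3 - a"
    unfolding h_def d2_eq using s(1) by (simp add: f_def s_def field_simps)
  have 3: "s\<^sup>2 = c - f\<^sup>2" using sg_sq by (simp add: s_def f_def)
  have t1: "8/3 * (\<alpha> * s) ^ 11 * (3 * a * f * g * i ^ 5)\<^sup>2 = 24 * \<alpha> ^ 5 * s * f\<^sup>2 * g\<^sup>2"
  proof -
    have "8/3 * (\<alpha> * s) ^ 11 * (3 * a * f * g * i ^ 5)\<^sup>2 = 24 * \<alpha> ^ 5 * (\<alpha> ^ 3 * a)\<^sup>2 * (s * i) ^ 10 * s * f\<^sup>2 * g\<^sup>2"
      by algebra
    then show ?thesis using \<alpha>3 s(2) by simp
  qed
  have t2: "2 * (\<alpha> * s) ^ 8 * (3 * a * (g\<^sup>2 + f * h) * i ^ 5 + 15 * a * f\<^sup>2 * g\<^sup>2 * i ^ 7)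
     = \<alpha> ^ 5 * (6 * (g\<^sup>2 + f * h) * s ^ 3 + 30 * f\<^sup>2 * g\<^sup>2 * s)"
  proof -
    have "2 * (\<alpha> * s) ^ 8 * (3 * a * (g\<^sup>2 + f * h) * i ^ 5 + 15 * a * f\<^sup>2 * g\<^sup>2 * i ^ 7)
      = \<alpha> ^ 5 * (\<alpha> ^ 3 * a) * (6 * (g\<^sup>2 + f * h) * s ^ 3 * (s * i) ^ 5 + 30 * f\<^sup>2 * g\<^sup>2 * s * (s * i) ^ 7)"
      by algebra
    then show ?thesis using \<alpha>3 s(2) by simp
  qed
  have t3: "18 * \<alpha>\<^sup>2 * f = \<alpha> ^ 5 * (18 * a * f)"
  proof -
    have e: "\<alpha> ^ 5 * (18 * a * f) = 18 * \<alpha>\<^sup>2 * f * (\<alpha> ^ 3 * a)" by algebra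
    show ?thesis unfolding e \<alpha>3 by simp
  qed
  \<comment> \<open>Via \<open>f^2 + s^2 = c\<close> the terms with \<open>g^2\<close> combine into
    the block \<open>c * s * g^2\<close>, which the first integral evaluates.\<close>
  have key: "4 * s * f\<^sup>2 * g\<^sup>2 - ((g\<^sup>2 + f * h) * s ^ 3 + 5 * f\<^sup>2 * g\<^sup>2 * s) - s ^ 5 + (2 * c * nov_E c k + c\<^sup>2) * s - 3 * a * f = 0"
  proof -
    have "4 * s * f\<^sup>2 * g\<^sup>2 - ((g\<^sup>2 + f * h) * s ^ 3 + 5 * f\<^sup>2 * g\<^sup>2 * s)
       = - (f\<^sup>2 + s\<^sup>2) * s * g\<^sup>2 - f * (s ^ 3 * h)" by algebra
    also have "\<dots> = - (c * s * g\<^sup>2) - f * (f * s ^ 3 - a)" unfolding 2 3 by simp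
    also have "\<dots> = - (s * (2 * c * nov_E c k + c * f\<^sup>2) - 2 * a * f) - f * (f * s ^ 3 - a)" unfolding 1 ..
    finally have "4 * s * f\<^sup>2 * g\<^sup>2 - ((g\<^sup>2 + f * h) * s ^ 3 + 5 * f\<^sup>2 * g\<^sup>2 * s) - s ^ 5 + (2 * c * nov_E c k + c\<^sup>2) * s - 3 * a * f
       = c * s * (c - f\<^sup>2) - s ^ 3 * (f\<^sup>2 + s\<^sup>2)" by algebra
    also have "\<dots> = c * s * s\<^sup>2 - s ^ 3 * c" unfolding 3 by simp
    also have "\<dots> = 0" by algebra
    finally show ?thesis .
  qed
  have "8/3 * (\<alpha> * s) ^ 11 * (3 * a * f * g * i ^ 5)\<^sup>2
     - 2 * (\<alpha> * s) ^ 8 * (3 * a * (g\<^sup>2 + f * h) * i ^ 5 + 15 * a * f\<^sup>2 * g\<^sup>2 * i ^ 7) - 6 * (\<alpha> * s) ^ 5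
     + 2/3 * (9 * c * \<alpha> ^ 4 * (2 * nov_E c k + c)) * (\<alpha> * s) + 2 * (- 9 * \<alpha>\<^sup>2) * f
     = 6 * \<alpha> ^ 5 * (4 * s * f\<^sup>2 * g\<^sup>2 - ((g\<^sup>2 + f * h) * s ^ 3 + 5 * f\<^sup>2 * g\<^sup>2 * s) - s ^ 5 + (2 * c * nov_E c k + c\<^sup>2) * s - 3 * a * f)"
    unfolding t1 t2 using t3 by algebra
  also have "\<dots> = 0" unfolding key by simp
  finally show ?thesis
    unfolding ps w0 w1 mu_d1 mu_d2 f_def g_def h_def i_def .
qed

text \<open>Translation invariance: differentiating the Euler-Lagrange equation in \<open>x\<close>.\<close>

lemma nov_L_mu': "nov_L c k \<mu> (\<lambda>x. complex_of_real (d 1 x - d 3 x)) (\<lambda>x. 0)"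
proof -
  obtain l u where lu: "l > 0" "\<And>x. l \<le> \<mu> x" "\<And>x. \<mu> x \<le> u" using mu_bounds by blast
  have D: "(\<mu> has_real_derivative d 1 x - d 3 x) (at x)"
    "((\<lambda>x. d 1 x - d 3 x) has_real_derivative d 2 x - d 4 x) (at x)"
    "((\<lambda>x. d 2 x - d 4 x) has_real_derivative d 3 x - d 5 x) (at x)" for x
    unfolding mu_d using d_diff_deriv[of 0 x] d_diff_deriv[of 1 x] d_diff_deriv[of 2 x]
    by (simp_all add: numeral_eq_Suc One_nat_def)
  have H: "helmholtz_inv (\<lambda>x. d 1 x - d 3 x) x = d 1 x" for x
    using d_deriv[of 1] d_deriv[of 2]
    by (intro helmholtz_inv_eq[where ?u1.0="d 2"] d_cont d_bounded) (simp_all add: numeral_eq_Suc One_nat_def)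
  have "nov_L c k \<mu> (\<lambda>x. complex_of_real (d 1 x - d 3 x)) (\<lambda>x. complex_of_real 0)"
  proof (rule nov_L_classical[OF D(2) D(3) _ _ _ _ D(1) D(2) _ lu])
    show "exp_decay (\<lambda>x. d 1 x - d 3 x)" "exp_decay (\<lambda>x. d 2 x - d 4 x)" "exp_decay (\<lambda>x. d 3 x - d 5 x)"
      by (intro exp_decay_diff d_decay; simp)+
    show "bounded_fun (\<lambda>x. d 1 x - d 3 x)" by (intro decay_intros d_bounded)
    show "continuous_on UNIV (\<lambda>x. d 3 x - d 5 x)" by (intro continuous_intros d_cont)
    show "exp_decay (\<lambda>x. 0)" by (rule exp_decay_zero)
    fix x
    show "0 = 2/3 * (- 3 * (\<mu> x powr (-8/3) * (d 3 x - d 5 x) - 8/3 * \<mu> x powr (-11/3) * (d 1 x - d 3 x) * (d 2 x - d 4 x))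
          + (8 * (d 2 x - d 4 x) * \<mu> x powr (-11/3) - 44/3 * (d 1 x - d 3 x)\<^sup>2 * \<mu> x powr (-14/3) + 15 * \<mu> x powr (-8/3)) * (d 1 x - d 3 x))
        - 2 * nov_omega1 c k / 9 * \<mu> x powr (-4/3) * (d 1 x - d 3 x) + 2 * nov_omega0 c k * helmholtz_inv (\<lambda>x. d 1 x - d 3 x) x"
      unfolding H
      using EL_linearization[OF D(1) D(2) D(3) phi_deriv DERIV_const DERIV_const mu_pos always_eventually[OF allI[OF EL_equation]]]
      by simp
  qed simp_all
  then show ?thesis by simp
qed

text \<open>For \<open>x > 0\<close> positivity of \<open>q\<close> gives
  \<open>\<phi>' \<noteq> 0\<close>. Nontriviality lets \<open>\<mu>'\<close> replace the unnamed
  eigenfunction supplied by the spectral assumption.\<close>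

lemma mu'_not_AE_zero: "\<not> (AE x in lborel. complex_of_real (d 1 x - d 3 x) = 0)"
proof
  assume "AE x in lborel. complex_of_real (d 1 x - d 3 x) = 0"
  then have "AE x in lborel. x \<notin> {0<..<1::real}"
  proof eventually_elim
    case (elim x)
    have "d 1 x - d 3 x \<noteq> 0" if "x > 0"
    proof -
      have "d 1 x \<noteq> 0" using q_pos[OF that] by (auto simp: wave_q_def d_1)
      then show ?thesis unfolding mu_d1 using a_pos phi_pos[of x] sg_pos[of x] by simp
    qed
    then show ?case using elim by auto
  qed
  then have "{0<..<1::real} \<in> null_sets lborel"
    by (subst AE_iff_null_sets) auto
  then show False by (simp add: null_sets_def)
qed

lemma integral_mu'_dF: "(LINT x|lborel. (d 1 x - d 3 x) * nov_dF k \<mu> x) = 0"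
proof -
  define g where "g x = (d 1 x - d 3 x) * nov_dF k \<mu> x" for x
  have odd: "g (- x) = - g x" for x
    unfolding g_def mu_d1 dF_eq wave_N_def by (simp add: d1_odd phi_even sg_even)
  have "(LINT x|lborel. g x) = (LINT x|lborel. g (0 + (-1) * x))"
    by (subst lborel_integral_real_affine[where c="-1" and t=0]) auto
  also have "\<dots> = - (LINT x|lborel. g x)" by (simp add: odd)
  finally show ?thesis by (simp add: g_def)
qed

end

section \<open>Dependence on the background \<open>k\<close>\<close>

locale novikov_family =
  fixes c :: real and \<phi> :: "real \<Rightarrow> real \<Rightarrow> real" and D :: "nat \<Rightarrow> nat \<Rightarrow> real \<times> real \<Rightarrow> real"
  assumes family_c: "c > 0"
    and family_profile: "\<And>\<kappa>. \<kappa> \<in> {0<..<sqrt c / 2} \<Longrightarrow> solitary_profile c \<kappa> (\<phi> \<kappa>)"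
    and D_00: "\<And>\<kappa> x. \<kappa> \<in> {0<..<sqrt c / 2} \<Longrightarrow> D 0 0 (\<kappa>, x) = \<phi> \<kappa> x"
    and D_has_derivative: "\<And>i j \<kappa> x. \<kappa> \<in> {0<..<sqrt c / 2} \<Longrightarrow>
      (D i j has_derivative (\<lambda>h. D (Suc i) j (\<kappa>, x) * fst h + D i (Suc j) (\<kappa>, x) * snd h)) (at (\<kappa>, x))"
begin

abbreviation I :: "real set" where "I \<equiv> {0<..<sqrt c / 2}"

lemma wave: "\<kappa> \<in> I \<Longrightarrow> novikov_wave c \<kappa> (\<phi> \<kappa>)"
  using family_c family_profile by unfold_locales auto

lemma D_x: "\<kappa> \<in> I \<Longrightarrow> ((\<lambda>x. D i j (\<kappa>, x)) has_real_derivative D i (Suc j) (\<kappa>, x)) (at x)"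
proof -
  assume k: "\<kappa> \<in> I"
  have "((\<lambda>x. (\<kappa>, x)) has_derivative (\<lambda>h. (0, h))) (at x)" by (auto intro!: derivative_eq_intros)
  from has_derivative_compose[OF this D_has_derivative[OF k]] show ?thesis
    by (simp add: has_field_derivative_def)
qed

lemma D_k: "\<kappa> \<in> I \<Longrightarrow> ((\<lambda>\<kappa>. D i j (\<kappa>, x)) has_real_derivative D (Suc i) j (\<kappa>, x)) (at \<kappa>)"
proof -
  assume k: "\<kappa> \<in> I"
  have "((\<lambda>\<kappa>. (\<kappa>, x)) has_derivative (\<lambda>h. (h, 0))) (at \<kappa>)" by (auto intro!: derivative_eq_intros)
  from has_derivative_compose[OF this D_has_derivative[OF k]] show ?thesis
    by (simp add: has_field_derivative_def)
qed

lemma D_cont: "continuous_on (I \<times> A) (D i j)"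
proof (rule continuous_at_imp_continuous_on, rule ballI)
  fix p assume "p \<in> I \<times> A"
  then show "isCont (D i j) p" using has_derivative_continuous[OF D_has_derivative] by (cases p) auto
qed

lemma D_0j: "\<kappa> \<in> I \<Longrightarrow> D 0 j (\<kappa>, x) = deriv_n j (\<phi> \<kappa>) x"
proof (induction j arbitrary: x)
  case 0
  then show ?case using D_00 by (simp add: deriv_n_def)
next
  case (Suc j)
  have "(\<lambda>x. D 0 j (\<kappa>, x)) = deriv_n j (\<phi> \<kappa>)" using Suc by auto
  then show ?case using DERIV_imp_deriv[OF D_x[OF Suc.prems, of 0 j x]] by (simp add: deriv_n_def)
qed

lemma momentum_D: "\<kappa> \<in> I \<Longrightarrow> momentum (\<phi> \<kappa>) x = D 0 0 (\<kappa>, x) - D 0 2 (\<kappa>, x)"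
  using novikov_wave.mu_d[OF wave] by (simp add: D_0j)

text \<open>The identities of a single wave hold for parameters in the open interval
  \<open>I\<close>, which is enough to differentiate them in \<open>k\<close> at its points.\<close>

lemma transform_k:
  assumes "\<kappa> \<in> I" "(f has_real_derivative f') (at \<kappa>)" "\<And>r. r \<in> I \<Longrightarrow> f r = g r"
  shows "(g has_real_derivative f') (at \<kappa>)"
  using has_field_derivative_transform_within_open[OF assms(2) open_greaterThanLessThan assms(1)] assms(3) by blast

lemma deriv_n_k: "\<kappa> \<in> I \<Longrightarrow> ((\<lambda>\<kappa>. deriv_n j (\<phi> \<kappa>) x) has_real_derivative D (Suc 0) j (\<kappa>, x)) (at \<kappa>)"
  by (rule transform_k[OF _ D_k]) (auto simp: D_0j)

lemma phi_k: "\<kappa> \<in> I \<Longrightarrow> ((\<lambda>\<kappa>. \<phi> \<kappa> x) has_real_derivative D (Suc 0) 0 (\<kappa>, x)) (at \<kappa>)"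
  by (rule transform_k[OF _ D_k]) (auto simp: D_00)

lemma momentum_k:
  "\<kappa> \<in> I \<Longrightarrow> ((\<lambda>\<kappa>. momentum (\<phi> \<kappa>) x) has_real_derivative D (Suc 0) 0 (\<kappa>, x) - D (Suc 0) 2 (\<kappa>, x)) (at \<kappa>)"
  by (rule transform_k[OF _ DERIV_diff[OF D_k D_k]]) (auto simp: momentum_D)

text \<open>Written in the mixed partials \<open>D\<close>, so that joint continuity in
  \<open>(k, x)\<close>, which the Leibniz rule needs, can be read off.\<close>

definition density_k :: "real \<Rightarrow> real \<Rightarrow> real" where
  "density_k \<kappa> x = (D (Suc 0) 0 (\<kappa>, x) - D (Suc 0) 2 (\<kappa>, x)) * D 0 0 (\<kappa>, x)
     + (D 0 0 (\<kappa>, x) - D 0 2 (\<kappa>, x)) * D (Suc 0) 0 (\<kappa>, x) - 2 * \<kappa>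
     - 4 * \<kappa> powr (1/3) * ((D 0 0 (\<kappa>, x) - D 0 2 (\<kappa>, x)) powr (2/3) - \<kappa> powr (2/3))
     - 3 * \<kappa> powr (4/3) * (2/3 * (D 0 0 (\<kappa>, x) - D 0 2 (\<kappa>, x)) powr (-1/3) * (D (Suc 0) 0 (\<kappa>, x) - D (Suc 0) 2 (\<kappa>, x))
         - 2/3 * \<kappa> powr (-1/3))"

lemma density_k_deriv:
  assumes "\<kappa> \<in> I"
  shows "((\<lambda>\<kappa>. wave_density \<kappa> (\<phi> \<kappa>) x) has_real_derivative density_k \<kappa> x) (at \<kappa>)"
proof -
  have pos: "\<kappa> > 0" "momentum (\<phi> \<kappa>) x > 0" using assms novikov_wave.mu_pos[OF wave] by auto
  have pk: "((\<lambda>\<kappa>. \<kappa> powr e) has_real_derivative e * \<kappa> powr (e - 1)) (at \<kappa>)" for e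
    using has_real_derivative_powr[OF pos(1)] .
  have pm: "((\<lambda>\<kappa>. momentum (\<phi> \<kappa>) x powr e) has_real_derivative
      e * momentum (\<phi> \<kappa>) x powr (e - 1) * (D (Suc 0) 0 (\<kappa>, x) - D (Suc 0) 2 (\<kappa>, x))) (at \<kappa>)" for e
    using DERIV_chain2[OF has_real_derivative_powr[OF pos(2)] momentum_k[OF assms]] .
  have e: "4/3 - 1 = (1/3::real)" "2/3 - 1 = (-1/3::real)" by simp_all
  show ?thesis
    unfolding wave_density_def
    by (rule DERIV_cong, (rule derivative_eq_intros pk pm momentum_k[OF assms] phi_k[OF assms] refl)+)
       (simp add: density_k_def momentum_D[OF assms] D_00[OF assms] algebra_simps)
qed

lemma density_k_cont: "continuous_on (I \<times> A) (\<lambda>(\<kappa>, x). density_k \<kappa> x)"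
proof -
  have nz: "D 0 0 p - D 0 2 p \<noteq> 0" "fst p \<noteq> 0" if "p \<in> I \<times> A" for p
    using that novikov_wave.mu_pos[OF wave, of "fst p" "snd p"] momentum_D[of "fst p" "snd p"] by auto
  have "continuous_on (I \<times> A) (\<lambda>p. (D (Suc 0) 0 p - D (Suc 0) 2 p) * D 0 0 p
     + (D 0 0 p - D 0 2 p) * D (Suc 0) 0 p - 2 * fst p
     - 4 * fst p powr (1/3) * ((D 0 0 p - D 0 2 p) powr (2/3) - fst p powr (2/3))
     - 3 * fst p powr (4/3) * (2/3 * (D 0 0 p - D 0 2 p) powr (-1/3) * (D (Suc 0) 0 p - D (Suc 0) 2 p)
         - 2/3 * fst p powr (-1/3)))"
    using nz by (intro continuous_intros D_cont) auto
  then show ?thesis by (simp add: density_k_def case_prod_beta)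
qed

end

text \<open>The derivative of \<open>wave_Z\<close> at \<open>(b, r)\<close> in the direction
  \<open>(b', r')\<close>; used with \<open>(q, q_k)\<close> at finite \<open>x\<close> and with
  \<open>(Q, Q')\<close> at infinity.\<close>

definition wave_dZ :: "real \<Rightarrow> real \<Rightarrow> real \<Rightarrow> real \<Rightarrow> real" where
  "wave_dZ b b' r r' = r' + 4 * b * b' * wave_M b r
     + 2 * b\<^sup>2 * (b' * (b / ((1 - r)\<^sup>2 + b\<^sup>2) - b / ((1 + r)\<^sup>2 + b\<^sup>2))
       - r' * ((1 - r) / ((1 - r)\<^sup>2 + b\<^sup>2) + (1 + r) / ((1 + r)\<^sup>2 + b\<^sup>2)))"

lemma wave_Z_deriv:
  assumes "b \<noteq> 0" and b: "(B has_real_derivative b') (at s)" "B s = b"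
    and q: "(q has_real_derivative q') (at s)" "q s = r"
  shows "((\<lambda>s. wave_Z (B s) (q s)) has_real_derivative wave_dZ b b' r q') (at s)"
proof -
  have 1: "((\<lambda>s. 2 * (B s)\<^sup>2) has_real_derivative 4 * b * b') (at s)"
    by (rule derivative_eq_intros b refl)+ (simp add: b)
  show ?thesis
    unfolding wave_Z_def
    by (rule DERIV_cong[OF DERIV_add[OF q(1) DERIV_mult[OF 1 wave_M_deriv[OF assms]]]])
       (simp add: wave_dZ_def b q algebra_simps)
qed

lemma wave_dZ_minus: "wave_dZ b b' (- r) (- r') = - wave_dZ b b' r r'"
proof -
  \<comment> \<open>\<open>x\<close>, \<open>y\<close> stand for the two logarithms and
    \<open>P\<close>, \<open>S\<close> for the two quadratics; changing the sign of \<open>r\<close>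
    interchanges them.\<close>
  have "- r' + 4 * b * b' * ((y - x) / 2) + 2 * b\<^sup>2 * (b' * (b / S - b / P) - - r' * ((1 + r) / S + (1 - r) / P))
    = - (r' + 4 * b * b' * ((x - y) / 2) + 2 * b\<^sup>2 * (b' * (b / P - b / S) - r' * ((1 - r) / P + (1 + r) / S)))"
    for x y P S :: real
    by (simp add: algebra_simps add_divide_distrib diff_divide_distrib)
  then show ?thesis by (simp add: wave_dZ_def wave_M_def)
qed

section \<open>Differentiating the closed form in \<open>k\<close>\<close>

locale novikov_family_at = novikov_family +
  fixes k :: real
  assumes k_in: "k \<in> {0<..<sqrt c / 2}"

sublocale novikov_family_at \<subseteq> novikov_wave c k "\<phi> k"
  using wave k_in by blast

context novikov_family_at
begin

abbreviation e :: "nat \<Rightarrow> real \<Rightarrow> real" where "e j x \<equiv> D (Suc 0) j (k, x)"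

definition b' :: real where "b' = c / s0 ^ 3"
definition Q' :: real where "Q' = - 3 * b * b' / Q"
definition q_k :: "real \<Rightarrow> real" where "q_k x = deriv (\<lambda>\<kappa>. wave_q c \<kappa> (\<phi> \<kappa>) x) k"

lemma s0_k: "(wave_s0 c has_real_derivative - k / s0) (at k)"
  unfolding wave_s0_def[abs_def] using ck2
  by (auto intro!: derivative_eq_intros simp: field_simps)

lemma b_k: "(wave_b c has_real_derivative b') (at k)"
proof -
  have nz: "s0 \<noteq> 0" using s0_pos by simp
  have "(1 * s0 - k * (- k / s0)) / (s0 * s0) = (s0\<^sup>2 + k\<^sup>2) / s0 ^ 3"
    using nz by (simp add: field_simps power2_eq_square power3_eq_cube)
  then have "(1 * s0 - k * (- k / s0)) / (s0 * s0) = b'" using s0_sq by (simp add: b'_def)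
  then show ?thesis
    unfolding wave_b_def[abs_def] using DERIV_divide[OF DERIV_ident s0_k nz] by simp
qed

lemma Q_k: "(wave_Q c has_real_derivative Q') (at k)"
proof -
  have 1: "1 - 3 * b\<^sup>2 > 0" using three_b2 by simp
  have "((\<lambda>\<kappa>. 1 - 3 * (wave_b c \<kappa>)\<^sup>2) has_real_derivative - 6 * b * b') (at k)"
    by (rule derivative_eq_intros b_k refl)+ simp
  from DERIV_chain2[OF DERIV_real_sqrt[OF 1] this] show ?thesis
    unfolding wave_Q_def[abs_def] Q'_def
    by (simp add: wave_Q_def inverse_eq_divide field_simps)
qed

lemma QQ': "Q * Q' = - 3 * b * b'" unfolding Q'_def using Q_pos by simp

lemma sg_k: "((\<lambda>\<kappa>. wave_sigma c (\<phi> \<kappa>) x) has_real_derivative - \<phi> k x * e 0 x / sg x) (at k)"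
proof -
  have 1: "c - (\<phi> k x)\<^sup>2 > 0" using phi_sq[of x] by simp
  have "((\<lambda>\<kappa>. c - (\<phi> \<kappa> x)\<^sup>2) has_real_derivative - 2 * \<phi> k x * e 0 x) (at k)"
    by (rule derivative_eq_intros phi_k[OF k_in] refl)+ simp
  from DERIV_chain2[OF DERIV_real_sqrt[OF 1] this] show ?thesis
    unfolding wave_sigma_def by (simp add: inverse_eq_divide field_simps)
qed

lemma t_k: "((\<lambda>\<kappa>. \<phi> \<kappa> x / wave_sigma c (\<phi> \<kappa>) x) has_real_derivative c * e 0 x / sg x ^ 3) (at k)"
proof -
  have nz: "sg x \<noteq> 0" by (rule sg_nz)
  have "(e 0 x * sg x - \<phi> k x * (- \<phi> k x * e 0 x / sg x)) / (sg x * sg x) = ((sg x)\<^sup>2 + (\<phi> k x)\<^sup>2) * e 0 x / (sg x) ^ 3"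
    using nz by (simp add: field_simps power2_eq_square power3_eq_cube)
  then show ?thesis
    using DERIV_divide[OF phi_k[OF k_in, of x] sg_k nz] sg_sq[of x] by simp
qed

lemma q_k_deriv: "((\<lambda>\<kappa>. wave_q c \<kappa> (\<phi> \<kappa>) x) has_real_derivative q_k x) (at k)"
proof -
  have "\<exists>z. ((\<lambda>\<kappa>. wave_N c \<kappa> (\<phi> \<kappa>) x) has_real_derivative z) (at k)"
    unfolding wave_N_def
    using DERIV_diff[OF DERIV_mult[OF s0_k phi_k[OF k_in, of x]] DERIV_mult[OF DERIV_ident sg_k[of x]]] by blast
  then obtain z where z: "((\<lambda>\<kappa>. wave_N c \<kappa> (\<phi> \<kappa>) x) has_real_derivative z) (at k)" by blast
  have d1: "((\<lambda>\<kappa>. deriv (\<phi> \<kappa>) x) has_real_derivative e 1 x) (at k)"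
    using deriv_n_k[OF k_in, of 1 x] by (simp add: deriv_n_def One_nat_def)
  have "\<exists>z. ((\<lambda>\<kappa>. wave_q c \<kappa> (\<phi> \<kappa>) x) has_real_derivative z) (at k)"
    unfolding wave_q_def
    using DERIV_divide[OF DERIV_cmult[OF d1] DERIV_mult[OF s0_k z], of "- c"] N_nz[of x] s0_pos by auto
  then show ?thesis unfolding q_k_def using DERIV_imp_deriv by metis
qed

text \<open>The right side of \<open>position_eq\<close> is free of \<open>k\<close>, so
  differentiating in \<open>k\<close> at fixed \<open>x\<close> gives a linear equation for
  \<open>q_k\<close>. The term with \<open>L\<close> stems from the \<open>k\<close>-dependence of
  \<open>Q\<close>; its factor \<open>L\<close> grows linearly in \<open>x\<close>.\<close>

lemma q_k_eq:
  defines "L \<equiv> \<lambda>x. ln (Q + q x) - ln (Q - q x)"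
  shows "q_k x = (1 + (t x)\<^sup>2) / (1 + b\<^sup>2) * (q x * Q' / Q)
    + b * (1 + (t x)\<^sup>2) * (t x - b) / (1 + b\<^sup>2)
       * (L x * Q' / Q\<^sup>2 - b' * (b / ((1 - q x)\<^sup>2 + b\<^sup>2) - b / ((1 + q x)\<^sup>2 + b\<^sup>2)))"
proof -
  define Mb where "Mb = b / ((1 - q x)\<^sup>2 + b\<^sup>2) - b / ((1 + q x)\<^sup>2 + b\<^sup>2)"
  define S where "S = (t x + b) / (b * (1 + (t x)\<^sup>2))"
  define r where "r = b * (1 + (t x)\<^sup>2) * (t x - b) / (1 + b\<^sup>2)"
  define W where "W = Q\<^sup>2 - (q x)\<^sup>2"
  have p: "Q + q x > 0" "Q - q x > 0" using q_less_Q[of x] by auto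
  have W: "W > 0" unfolding W_def Q2_minus_q2 using b_pos t_gt_b[of x] by simp
  have M: "((\<lambda>\<kappa>. wave_M (wave_b c \<kappa>) (wave_q c \<kappa> (\<phi> \<kappa>) x)) has_real_derivative b' * Mb - q_k x * S) (at k)"
    using wave_M_deriv[OF _ b_k refl q_k_deriv refl] b_pos unfolding q_sum Mb_def S_def by simp
  have l1: "((\<lambda>\<kappa>. ln (wave_Q c \<kappa> + wave_q c \<kappa> (\<phi> \<kappa>) x)) has_real_derivative 1 / (Q + q x) * (Q' + q_k x)) (at k)"
    by (rule DERIV_chain2[OF DERIV_ln_divide DERIV_add[OF Q_k q_k_deriv]]) (rule p)
  have l2: "((\<lambda>\<kappa>. ln (wave_Q c \<kappa> - wave_q c \<kappa> (\<phi> \<kappa>) x)) has_real_derivative 1 / (Q - q x) * (Q' - q_k x)) (at k)"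
    by (rule DERIV_chain2[OF DERIV_ln_divide DERIV_diff[OF Q_k q_k_deriv]]) (rule p)
  have nQ: "Q \<noteq> 0" using Q_pos by simp
  have "((\<lambda>\<kappa>. (ln (wave_Q c \<kappa> + wave_q c \<kappa> (\<phi> \<kappa>) x) - ln (wave_Q c \<kappa> - wave_q c \<kappa> (\<phi> \<kappa>) x)) / wave_Q c \<kappa>
      + wave_M (wave_b c \<kappa>) (wave_q c \<kappa> (\<phi> \<kappa>) x)) has_real_derivative
      ((1 / (Q + q x) * (Q' + q_k x) - 1 / (Q - q x) * (Q' - q_k x)) * Q - (ln (Q + q x) - ln (Q - q x)) * Q') / (Q * Q)
        + (b' * Mb - q_k x * S)) (at k)"
    by (intro DERIV_add DERIV_divide DERIV_diff l1 l2 Q_k nQ M)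
  moreover have "((\<lambda>\<kappa>. (ln (wave_Q c \<kappa> + wave_q c \<kappa> (\<phi> \<kappa>) x) - ln (wave_Q c \<kappa> - wave_q c \<kappa> (\<phi> \<kappa>) x)) / wave_Q c \<kappa>
      + wave_M (wave_b c \<kappa>) (wave_q c \<kappa> (\<phi> \<kappa>) x)) has_real_derivative 0) (at k)"
    by (rule transform_k[OF k_in DERIV_const[of x]]) (use novikov_wave.position_eq[OF wave] in auto)
  ultimately have 0: "((1 / (Q + q x) * (Q' + q_k x) - 1 / (Q - q x) * (Q' - q_k x)) * Q - L x * Q') / (Q * Q)
        + (b' * Mb - q_k x * S) = 0"
    unfolding L_def by (rule DERIV_unique)
  have 1: "1 / (Q + q x) * (Q' + q_k x) - 1 / (Q - q x) * (Q' - q_k x) = (2 * q_k x * Q - 2 * Q' * q x) / W"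
  proof -
    have w: "W = (Q + q x) * (Q - q x)" unfolding W_def by algebra
    show ?thesis unfolding w using p by (simp add: field_simps)
  qed
  have 2: "q_k x * (2 / W - S) = 2 * q x * Q' / (Q * W) + L x * Q' / Q\<^sup>2 - b' * Mb"
  proof -
    have "((2 * q_k x * Q - 2 * Q' * q x) / W * Q - L x * Q') / (Q * Q)
        = q_k x * (2 / W) - 2 * q x * Q' / (Q * W) - L x * Q' / Q\<^sup>2"
      using W nQ by (simp add: field_simps power2_eq_square)
    then show ?thesis using 0 unfolding 1 by (simp only: right_diff_distrib)
  qed
  have tb: "t x - b > 0" "1 + (t x)\<^sup>2 > 0" "1 + b\<^sup>2 > 0" using t_gt_b[of x] by (auto intro!: add_pos_nonneg)
  have rW: "r * (2 / W) = (1 + (t x)\<^sup>2) / (1 + b\<^sup>2)"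
    unfolding r_def W_def Q2_minus_q2 using b_pos tb by simp
  have rS: "r * S = (t x - b) * (t x + b) / (1 + b\<^sup>2)"
    unfolding r_def S_def using b_pos tb by simp
  \<comment> \<open>The coefficient of \<open>q_k\<close> is \<open>dx/dq\<close>, the reciprocal of
    \<open>r = q'\<close>, by the same partial fractions as in \<open>position_eq\<close>.\<close>
  have "r * (2 / W - S) = 1"
  proof -
    have "r * (2 / W - S) = ((1 + (t x)\<^sup>2) - (t x - b) * (t x + b)) / (1 + b\<^sup>2)"
      unfolding right_diff_distrib rW rS by (rule diff_divide_distrib[symmetric])
    also have "(1 + (t x)\<^sup>2) - (t x - b) * (t x + b) = 1 + b\<^sup>2" by algebra
    finally show ?thesis using tb by simp
  qed
  then have "q_k x = r * (q_k x * (2 / W - S))" by (simp add: mult.left_commute)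
  also have "\<dots> = r * (2 / W) * (q x * Q' / Q) + r * (L x * Q' / Q\<^sup>2 - b' * Mb)"
    unfolding 2 by (simp add: algebra_simps)
  finally show ?thesis unfolding rW unfolding r_def Mb_def .
qed

text \<open>By \<open>position_eq\<close> the difference of logarithms is
  \<open>Q * (x - wave_M b (q x))\<close>, and \<open>wave_M b\<close> is bounded on
  \<open>[-Q, Q]\<close>.\<close>

lemma log_linear_growth: obtains B where "\<And>x. \<bar>ln (Q + q x) - ln (Q - q x)\<bar> \<le> B * (1 + \<bar>x\<bar>)"
proof -
  have "continuous_on {- Q..Q} (wave_M b)"
    unfolding wave_M_def[abs_def] using b_pos by (intro continuous_intros) auto
  then have "bounded (wave_M b ` {- Q..Q})" by (intro compact_imp_bounded compact_continuous_image) auto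
  then obtain C where C: "\<And>r. r \<in> {- Q..Q} \<Longrightarrow> \<bar>wave_M b r\<bar> \<le> C"
    unfolding bounded_iff by (metis imageI real_norm_def)
  show ?thesis
  proof
    fix x
    have "ln (Q + q x) - ln (Q - q x) = Q * (x - wave_M b (q x))"
      using position_eq[of x] Q_pos by (simp add: field_simps)
    moreover have "\<bar>x - wave_M b (q x)\<bar> \<le> (1 + \<bar>C\<bar>) * (1 + \<bar>x\<bar>)"
    proof -
      have "\<bar>wave_M b (q x)\<bar> \<le> C" using q_less_Q[of x] by (intro C) auto
      then have "\<bar>x - wave_M b (q x)\<bar> \<le> \<bar>x\<bar> + \<bar>C\<bar>" by linarith
      also have "\<dots> \<le> (1 + \<bar>C\<bar>) * (1 + \<bar>x\<bar>)" by (simp add: algebra_simps)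
      finally show ?thesis .
    qed
    ultimately show "\<bar>ln (Q + q x) - ln (Q - q x)\<bar> \<le> (Q * (1 + \<bar>C\<bar>)) * (1 + \<bar>x\<bar>)"
      using Q_pos by (simp add: abs_mult mult.assoc)
  qed
qed

lemma bounded_rational: "bounded_fun (\<lambda>x. inverse ((1 - q x)\<^sup>2 + b\<^sup>2))" "bounded_fun (\<lambda>x. inverse ((1 + q x)\<^sup>2 + b\<^sup>2))"
  by (rule bounded_fun_inverse[of "b\<^sup>2"]; use b_pos in simp)+

text \<open>\<open>q_k\<close> is odd with opposite limits at the two ends; multiplied by the odd
  \<open>q\<close> it tends to \<open>Q * Q'\<close> at both, with a remainder divisible by
  \<open>t - b\<close>. The part carrying the logarithm is kept apart because its cofactor is
  unbounded.\<close>

lemma q_q_k_decay: "exp_decay (\<lambda>x. q x * q_k x - Q * Q')"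
proof -
  define L where "L x = ln (Q + q x) - ln (Q - q x)" for x
  define G1 where "G1 x = Q' / (Q * (1 + b\<^sup>2)) * ((q x)\<^sup>2 * (t x + b) - 2 * b * (1 + b\<^sup>2))
     - b * (1 + (t x)\<^sup>2) / (1 + b\<^sup>2) * q x * (b' * (b * inverse ((1 - q x)\<^sup>2 + b\<^sup>2) - b * inverse ((1 + q x)\<^sup>2 + b\<^sup>2)))" for x
  define G2 where "G2 x = b * (1 + (t x)\<^sup>2) / (1 + b\<^sup>2) * q x * (Q' / Q\<^sup>2)" for x
  have p: "1 + b\<^sup>2 > 0" by (intro add_pos_nonneg) auto
  have "q x * q_k x - Q * Q' = (t x - b) * G1 x + (t x - b) * L x * G2 x" for x
  proof -
    define Mb T where "Mb = b * inverse ((1 - q x)\<^sup>2 + b\<^sup>2) - b * inverse ((1 + q x)\<^sup>2 + b\<^sup>2)" and "T = t x"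
    have qk: "q_k x = (1 + T\<^sup>2) / (1 + b\<^sup>2) * (q x * Q' / Q)
        + b * (1 + T\<^sup>2) * (T - b) / (1 + b\<^sup>2) * (L x * Q' / Q\<^sup>2 - b' * Mb)"
      using q_k_eq[of x] by (simp add: L_def Mb_def T_def divide_inverse)
    have "q x * ((1 + T\<^sup>2) / (1 + b\<^sup>2) * (q x * Q' / Q)) - Q * Q' = Q' / (Q * (1 + b\<^sup>2)) * ((q x)\<^sup>2 * (1 + T\<^sup>2) - Q\<^sup>2 * (1 + b\<^sup>2))"
    proof -
      have "Q * Q' = Q' / (Q * (1 + b\<^sup>2)) * (Q\<^sup>2 * (1 + b\<^sup>2))"
        using Q_pos p by (simp add: power2_eq_square)
      moreover have "q x * ((1 + T\<^sup>2) / (1 + b\<^sup>2) * (q x * Q' / Q)) = Q' / (Q * (1 + b\<^sup>2)) * ((q x)\<^sup>2 * (1 + T\<^sup>2))"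
        by (simp add: power2_eq_square mult_ac)
      ultimately show ?thesis by (simp only: right_diff_distrib)
    qed
    \<comment> \<open>Replacing \<open>Q^2\<close> by \<open>q^2 + 2 b (T - b)\<close> makes the
      factor \<open>T - b\<close> explicit.\<close>
    also have "(q x)\<^sup>2 * (1 + T\<^sup>2) - Q\<^sup>2 * (1 + b\<^sup>2) = (T - b) * ((q x)\<^sup>2 * (T + b) - 2 * b * (1 + b\<^sup>2))"
    proof -
      have "Q\<^sup>2 = (q x)\<^sup>2 + 2 * b * (T - b)" using Q2_minus_q2[of x] by (simp add: T_def)
      then show ?thesis by algebra
    qed
    finally have F: "q x * q_k x - Q * Q' = Q' / (Q * (1 + b\<^sup>2)) * ((T - b) * ((q x)\<^sup>2 * (T + b) - 2 * b * (1 + b\<^sup>2)))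
       + q x * (b * (1 + T\<^sup>2) * (T - b) / (1 + b\<^sup>2) * (L x * Q' / Q\<^sup>2 - b' * Mb))"
      unfolding qk by (simp add: distrib_left)
    define A1 A2 A3 where "A1 = Q' / (Q * (1 + b\<^sup>2))" and "A2 = b * (1 + T\<^sup>2) / (1 + b\<^sup>2)" and "A3 = Q' / Q\<^sup>2"
    have A: "b * (1 + T\<^sup>2) * (T - b) / (1 + b\<^sup>2) = A2 * (T - b)" "L x * Q' / Q\<^sup>2 = L x * A3"
      by (simp_all add: A2_def A3_def)
    have "q x * q_k x - Q * Q' = A1 * ((T - b) * ((q x)\<^sup>2 * (T + b) - 2 * b * (1 + b\<^sup>2)))
       + q x * (A2 * (T - b) * (L x * A3 - b' * Mb))" unfolding F A A1_def[symmetric] ..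
    then show ?thesis
      unfolding G1_def G2_def Mb_def[symmetric] T_def[symmetric] A1_def[symmetric] A2_def[symmetric] A3_def[symmetric]
      by algebra
  qed
  moreover have "bounded_fun G1" "bounded_fun G2"
    unfolding G1_def G2_def by (intro decay_intros t_bounded q_bounded bounded_rational)+
  moreover have "exp_decay (\<lambda>x. (t x - b) * L x)"
  proof -
    obtain B where "\<And>x. \<bar>L x\<bar> \<le> B * (1 + \<bar>x\<bar>)" unfolding L_def using log_linear_growth by blast
    then show ?thesis by (rule exp_decay_mult_linear[OF t_decay])
  qed
  ultimately show ?thesis
    using exp_decay_add[OF exp_decay_mult_right[OF t_decay, of G1] exp_decay_mult_right[of "\<lambda>x. (t x - b) * L x" G2]]
    by simp
qed

text \<open>Obtained from the \<open>k\<close>-derivative of \<open>q_sq\<close>. The bracket is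
  arranged so that only \<open>b * b'\<close> survives at infinity;
  \<open>Q * Q' = - 3 * b * b'\<close> supplies the shift.\<close>

lemma phi_k_eq: "e 0 x = sg x ^ 3 / (b * c) * (- (q x * q_k x - Q * Q') + b * b' - b' * (t x - b))"
proof -
  have 1: "((\<lambda>\<kappa>. (wave_q c \<kappa> (\<phi> \<kappa>) x)\<^sup>2) has_real_derivative 2 * q x * q_k x) (at k)"
    by (rule derivative_eq_intros q_k_deriv refl)+ simp
  have "((\<lambda>\<kappa>. 1 - (wave_b c \<kappa>)\<^sup>2 - 2 * wave_b c \<kappa> * (\<phi> \<kappa> x / wave_sigma c (\<phi> \<kappa>) x)) has_real_derivative
     - 2 * b * b' - (2 * b' * t x + 2 * b * (c * e 0 x / sg x ^ 3))) (at k)"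
    by (rule DERIV_cong[OF DERIV_diff[OF DERIV_diff[OF DERIV_const DERIV_power[OF b_k, where n=2]]
            DERIV_mult[OF DERIV_cmult[OF b_k, of 2] t_k]]]) simp
  then have "((\<lambda>\<kappa>. (wave_q c \<kappa> (\<phi> \<kappa>) x)\<^sup>2) has_real_derivative
     - 2 * b * b' - (2 * b' * t x + 2 * b * (c * e 0 x / sg x ^ 3))) (at k)"
    by (rule transform_k[OF k_in]) (use novikov_wave.q_sq[OF wave] in auto)
  then have "2 * q x * q_k x = - 2 * b * b' - (2 * b' * t x + 2 * b * (c * e 0 x / sg x ^ 3))"
    by (rule DERIV_unique[OF 1])
  then have "b * (c * e 0 x / sg x ^ 3) = - (q x * q_k x) - b * b' - b' * t x" by linarith
  also have "\<dots> = - (q x * q_k x - Q * Q') + b * b' - b' * (t x - b)"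
    unfolding QQ' by (simp add: algebra_simps)
  finally have "- (q x * q_k x - Q * Q') + b * b' - b' * (t x - b) = b * (c * e 0 x / sg x ^ 3)" ..
  then show ?thesis using b_pos c_pos sg_nz[of x] by simp
qed

section \<open>Decay of \<open>\<phi>\<^sub>k - \<phi> / k\<close> and its derivatives in
  \<open>x\<close>\<close>

definition v :: "nat \<Rightarrow> real \<Rightarrow> real" where "v j x = e j x - d j x / k"

lemma v_deriv: "(v j has_real_derivative v (Suc j) x) (at x)"
  unfolding v_def[abs_def] by (intro DERIV_diff DERIV_cdivide D_x[OF k_in] d_deriv)

lemma v_cont: "continuous_on A (v j)"
  by (rule continuous_on_subset[OF DERIV_continuous_on_UNIV[OF v_deriv]]) simp

text \<open>Both \<open>\<phi>\<^sub>k\<close> and \<open>\<phi> / k\<close> tend to 1. The leading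
  part of \<open>\<phi>\<^sub>k\<close> is \<open>sg^3 / s0^3\<close>, because
  \<open>b' = c / s0^3\<close>; its distance to 1 is factored through \<open>sg - s0\<close> and
  then through \<open>\<phi> - k\<close>.\<close>

lemma v0_decay: "exp_decay (v 0)"
proof -
  have "v 0 x = 1 / (b * c) * (- (sg x ^ 3 * (q x * q_k x - Q * Q')) - b' * (sg x ^ 3 * (t x - b)))
     - (\<phi> k x - k) * ((\<phi> k x + k) * inverse (s0 + sg x) * ((sg x)\<^sup>2 + sg x * s0 + s0\<^sup>2) / s0 ^ 3)
     - (\<phi> k x - k) / k" for x
  proof -
    have p: "s0 + sg x > 0" using s0_pos sg_pos[of x] by simp
    have "sg x ^ 3 / (b * c) * (b * b') - 1 = (sg x ^ 3 - s0 ^ 3) / s0 ^ 3"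
      unfolding b'_def using b_pos c_pos s0_pos by (simp add: field_simps)
    also have "sg x ^ 3 - s0 ^ 3 = (sg x - s0) * ((sg x)\<^sup>2 + sg x * s0 + s0\<^sup>2)" by algebra
    also have "sg x - s0 = - ((\<phi> k x - k) * (\<phi> k x + k) * inverse (s0 + sg x))"
    proof -
      have "(s0 - sg x) * (s0 + sg x) = (\<phi> k x - k) * (\<phi> k x + k)"
        using s0_sq sg_sq[of x] by algebra
      then have "s0 - sg x = (\<phi> k x - k) * (\<phi> k x + k) * inverse (s0 + sg x)"
        using p by (simp add: field_simps)
      then show ?thesis by linarith
    qed
    finally have 1: "sg x ^ 3 / (b * c) * (b * b') = 1 - (\<phi> k x - k) * ((\<phi> k x + k) * inverse (s0 + sg x) * ((sg x)\<^sup>2 + sg x * s0 + s0\<^sup>2) / s0 ^ 3)"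
      by simp
    have "e 0 x = 1 / (b * c) * (- (sg x ^ 3 * (q x * q_k x - Q * Q')) - b' * (sg x ^ 3 * (t x - b))) + sg x ^ 3 / (b * c) * (b * b')"
      unfolding phi_k_eq by (simp add: algebra_simps)
    moreover have "\<phi> k x / k = 1 + (\<phi> k x - k) / k" using k_pos by (simp add: field_simps)
    ultimately show ?thesis unfolding v_def d_0 1 by linarith
  qed
  then have V: "v 0 = (\<lambda>x. 1 / (b * c) * (- (sg x ^ 3 * (q x * q_k x - Q * Q')) - b' * (sg x ^ 3 * (t x - b)))
     - (\<phi> k x - k) * ((\<phi> k x + k) * inverse (s0 + sg x) * ((sg x)\<^sup>2 + sg x * s0 + s0\<^sup>2) / s0 ^ 3)
     - (\<phi> k x - k) / k)" by (rule ext)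
  have A: "exp_decay (\<lambda>x. sg x ^ 3 * (q x * q_k x - Q * Q'))" "exp_decay (\<lambda>x. sg x ^ 3 * (t x - b))"
    by (rule exp_decay_mult_left[OF bounded_fun_power[OF sg_bounded]], rule q_q_k_decay t_decay)+
  have "bounded_fun (\<lambda>x. (\<phi> k x + k) * inverse (s0 + sg x) * ((sg x)\<^sup>2 + sg x * s0 + s0\<^sup>2) / s0 ^ 3)"
    by (intro bounded_fun_mult bounded_fun_add bounded_fun_divide_const bounded_fun_power bounded_fun_const
        phi_bounded inv_s0_sg_bounded sg_bounded)
  from exp_decay_mult_right[OF phi_decay this] show ?thesis
    unfolding V
    by (intro exp_decay_diff[OF exp_decay_diff] exp_decay_cmult[OF exp_decay_diff[OF exp_decay_minus[OF A(1)] exp_decay_cmult[OF A(2)]]]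
        exp_decay_divide_const[OF phi_decay])
qed

lemma a_k: "(nov_a c has_real_derivative s0 ^ 3 - 3 * k\<^sup>2 * s0) (at k)"
proof -
  have "((\<lambda>\<kappa>. \<kappa> * wave_s0 c \<kappa> ^ 3) has_real_derivative 1 * s0 ^ 3 + (real 3 * (- k / s0 * s0 ^ (3 - Suc 0))) * k) (at k)"
    by (intro DERIV_mult DERIV_ident DERIV_power s0_k)
  moreover have "1 * s0 ^ 3 + (real 3 * (- k / s0 * s0 ^ (3 - Suc 0))) * k = s0 ^ 3 - 3 * k\<^sup>2 * s0"
    using s0_pos by (simp add: power2_eq_square)
  ultimately have "((\<lambda>\<kappa>. \<kappa> * wave_s0 c \<kappa> ^ 3) has_real_derivative s0 ^ 3 - 3 * k\<^sup>2 * s0) (at k)" by simp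
  then show ?thesis by (rule transform_k[OF k_in]) (use novikov_wave.a_eq[OF wave] in auto)
qed

lemma inv_sg_k: "((\<lambda>\<kappa>. inverse (wave_sigma c (\<phi> \<kappa>) x)) has_real_derivative \<phi> k x * e 0 x * inverse (sg x) ^ 3) (at k)"
  using DERIV_inverse_fun[OF sg_k] sg_nz[of x]
  by (simp add: field_simps power3_eq_cube power2_eq_square)

lemma momentum_k_eq: "e 0 x - e 2 x = (s0 ^ 3 - 3 * k\<^sup>2 * s0) * inverse (sg x) ^ 3 + 3 * a * \<phi> k x * e 0 x * inverse (sg x) ^ 5"
proof -
  have "((\<lambda>\<kappa>. nov_a c \<kappa> * inverse (wave_sigma c (\<phi> \<kappa>) x) ^ 3) has_real_derivative
     (s0 ^ 3 - 3 * k\<^sup>2 * s0) * inverse (sg x) ^ 3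
     + (real 3 * (\<phi> k x * e 0 x * inverse (sg x) ^ 3 * inverse (sg x) ^ (3 - Suc 0))) * a) (at k)"
    by (intro DERIV_mult a_k DERIV_power inv_sg_k)
  then have "((\<lambda>\<kappa>. momentum (\<phi> \<kappa>) x) has_real_derivative
     (s0 ^ 3 - 3 * k\<^sup>2 * s0) * inverse (sg x) ^ 3
     + (real 3 * (\<phi> k x * e 0 x * inverse (sg x) ^ 3 * inverse (sg x) ^ (3 - Suc 0))) * a) (at k)"
  proof (rule transform_k[OF k_in])
    fix r assume "r \<in> I"
    show "nov_a c r * inverse (wave_sigma c (\<phi> r) x) ^ 3 = momentum (\<phi> r) x"
      unfolding novikov_wave.mu_eq[OF wave[OF \<open>r \<in> I\<close>]] by (simp only: divide_inverse power_inverse)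
  qed
  from DERIV_unique[OF momentum_k[OF k_in] this] show ?thesis
    by (simp add: power_add[symmetric] mult_ac)
qed

text \<open>\<open>v 0 - v 2 = K * J\<close> splits into a bounded and a decaying factor; the
  suffixes 1 and 2 mark \<open>x\<close>-derivatives. This gives decay of the higher
  \<open>x\<close>-derivatives of \<open>\<phi>\<^sub>k\<close>, about which joint smoothness says
  nothing.\<close>

definition J :: "real \<Rightarrow> real" where
  "J x = a * (\<phi> k x * v 0 x) + c * s0 * ((\<phi> k x - k) * (\<phi> k x + k))"
definition J1 :: "real \<Rightarrow> real" where
  "J1 x = a * (d 1 x * v 0 x + \<phi> k x * v 1 x) + c * s0 * (2 * \<phi> k x * d 1 x)"
definition J2 :: "real \<Rightarrow> real" where
  "J2 x = a * (d 2 x * v 0 x + 2 * d 1 x * v 1 x + \<phi> k x * v 2 x) + c * s0 * (2 * d 1 x * d 1 x + 2 * \<phi> k x * d 2 x)"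
definition K :: "real \<Rightarrow> real" where "K x = 3 * inverse (sg x) ^ 5"
definition K1 :: "real \<Rightarrow> real" where "K1 x = 15 * \<phi> k x * d 1 x * inverse (sg x) ^ 7"
definition K2 :: "real \<Rightarrow> real" where
  "K2 x = 15 * (d 1 x * d 1 x + \<phi> k x * d 2 x) * inverse (sg x) ^ 7 + 105 * (\<phi> k x * d 1 x) * (\<phi> k x * d 1 x) * inverse (sg x) ^ 9"

text \<open>In \<open>\<mu>\<^sub>k - \<mu> / k\<close> the terms without \<open>v 0\<close> meet as
  \<open>s0^2 * P^2 - k^2 * s^2\<close>, which is \<open>c * (P^2 - k^2)\<close> and therefore
  decays.\<close>

lemma v_02_eq: "v 0 x - v 2 x = K x * J x"
proof -
  define i E P V s where "i = inverse (sg x)" and "E = e 0 x" and "P = \<phi> k x" and "V = v 0 x" and "s = sg x"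
  have si: "s * i = 1" using sg_nz[of x] by (simp add: i_def s_def)
  have 1: "e 0 x - e 2 x = (s0 ^ 3 - 3 * k\<^sup>2 * s0) * i ^ 3 + 3 * a * P * E * i ^ 5"
    using momentum_k_eq[of x] by (simp add: i_def P_def E_def)
  have 2: "d 0 x - d 2 x = a * i ^ 3" using mu_eq[of x] unfolding mu_d by (simp add: i_def divide_inverse power_inverse)
  have 3: "k * E = k * V + P" using k_pos by (simp add: V_def v_def E_def d_0 P_def field_simps)
  have 4: "k * (v 0 x - v 2 x) = k * (e 0 x - e 2 x) - (d 0 x - d 2 x)"
    using k_pos by (simp add: v_def field_simps)
  have 5: "s\<^sup>2 = c - P\<^sup>2" "s0\<^sup>2 = c - k\<^sup>2" using sg_sq s0_sq by (auto simp: s_def P_def)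
  have i3: "i ^ 3 = s\<^sup>2 * i ^ 5"
  proof -
    have "s\<^sup>2 * i ^ 5 = (s * i)\<^sup>2 * i ^ 3" by algebra
    then show ?thesis using si by simp
  qed
  have "k * (v 0 x - v 2 x) = k * ((s0 ^ 3 - 3 * k\<^sup>2 * s0) * i ^ 3) + 3 * a * P * (k * E) * i ^ 5 - k * s0 ^ 3 * i ^ 3"
    unfolding 4 1 2 a_eq by (simp add: algebra_simps)
  also have "\<dots> = k * (3 * i ^ 5 * (a * (P * V) + s0 * (s0\<^sup>2 * P\<^sup>2 - k\<^sup>2 * s\<^sup>2)))"
    unfolding 3 i3 a_eq by algebra
  also have "s0\<^sup>2 * P\<^sup>2 - k\<^sup>2 * s\<^sup>2 = c * ((P - k) * (P + k))" using 5 by algebra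
  finally have "v 0 x - v 2 x = 3 * i ^ 5 * (a * (P * V) + s0 * (c * ((P - k) * (P + k))))" using k_pos by simp
  then show ?thesis by (simp add: K_def J_def i_def P_def V_def algebra_simps)
qed

lemma v_rules: "(v 0 has_real_derivative v 1 x) (at x)" "(v 1 has_real_derivative v 2 x) (at x)"
   "(v 2 has_real_derivative v 3 x) (at x)" "(v 3 has_real_derivative v 4 x) (at x)"
  using v_deriv[of 0 x] v_deriv[of 1 x] v_deriv[of 2 x] v_deriv[of 3 x] by (simp_all add: numeral_eq_Suc One_nat_def)

lemma J_deriv: "(J has_real_derivative J1 x) (at x)"
  unfolding J_def[abs_def]
  by (rule DERIV_cong, (rule derivative_eq_intros phi_deriv v_rules refl)+) (simp add: J1_def algebra_simps)

lemma J1_deriv: "(J1 has_real_derivative J2 x) (at x)"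
  unfolding J1_def[abs_def]
  by (rule DERIV_cong, (rule derivative_eq_intros phi_deriv d1_deriv v_rules refl)+) (simp add: J2_def algebra_simps)

lemma K_deriv: "(K has_real_derivative K1 x) (at x)"
  unfolding K_def[abs_def] using DERIV_cmult[OF inv_sg_power_deriv[of 4 x], of 3] by (simp add: K1_def mult_ac)

lemma K1_deriv: "(K1 has_real_derivative K2 x) (at x)"
proof -
  have "K1 = (\<lambda>x. 15 * (\<phi> k x * d 1 x) * inverse (sg x) ^ Suc 6)" by (simp add: K1_def fun_eq_iff)
  moreover have "((\<lambda>x. 15 * (\<phi> k x * d 1 x) * inverse (sg x) ^ Suc 6) has_real_derivative K2 x) (at x)"
    by (rule DERIV_cong[OF DERIV_mult[OF DERIV_cmult[OF DERIV_mult[OF phi_deriv d1_deriv], of 15] inv_sg_power_deriv[of 6 x]]])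
       (simp add: K2_def algebra_simps)
  ultimately show ?thesis by simp
qed

lemma v_13_eq: "v 1 x - v 3 x = K1 x * J x + K x * J1 x"
proof -
  have "((\<lambda>x. v 0 x - v 2 x) has_real_derivative v 1 x - v 3 x) (at x)" by (intro DERIV_diff v_rules)
  moreover have "((\<lambda>x. v 0 x - v 2 x) has_real_derivative K1 x * J x + J1 x * K x) (at x)"
    unfolding v_02_eq by (intro DERIV_mult K_deriv J_deriv)
  ultimately show ?thesis using DERIV_unique by fastforce
qed

lemma v_24_eq: "v 2 x - v 4 x = (K2 x * J x + K1 x * J1 x) + (K1 x * J1 x + K x * J2 x)"
proof -
  have "((\<lambda>x. v 1 x - v 3 x) has_real_derivative v 2 x - v 4 x) (at x)" by (intro DERIV_diff v_rules)
  moreover have "((\<lambda>x. v 1 x - v 3 x) has_real_derivative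
      (K2 x * J x + J1 x * K1 x) + (K1 x * J1 x + J2 x * K x)) (at x)"
    unfolding v_13_eq by (intro DERIV_add DERIV_mult K_deriv K1_deriv J_deriv J1_deriv)
  ultimately have "v 2 x - v 4 x = (K2 x * J x + J1 x * K1 x) + (K1 x * J1 x + J2 x * K x)"
    by (rule DERIV_unique)
  then show ?thesis by (simp add: mult.commute)
qed

lemma K_bounded: "bounded_fun K" "bounded_fun K1" "bounded_fun K2"
  unfolding K_def[abs_def] K1_def[abs_def] K2_def[abs_def]
  by (intro decay_intros phi_bounded d_bounded inv_sg_bounded)+

lemma J_decay: "exp_decay J"
proof -
  have "exp_decay (\<lambda>x. \<phi> k x * v 0 x)" "exp_decay (\<lambda>x. (\<phi> k x - k) * (\<phi> k x + k))"
    using exp_decay_mult_left[OF phi_bounded v0_decay] exp_decay_mult_right[OF phi_decay bounded_fun_add[OF phi_bounded bounded_fun_const]]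
    by simp_all
  then show ?thesis unfolding J_def[abs_def] by (intro exp_decay_add exp_decay_cmult)
qed

lemma v_02_decay: "exp_decay (\<lambda>x. v 0 x - v 2 x)"
  unfolding v_02_eq by (rule exp_decay_mult_left[OF K_bounded(1) J_decay])

lemma v2_decay: "exp_decay (v 2)"
  using exp_decay_diff[OF v0_decay v_02_decay] by simp

text \<open>\<open>v 0\<close> decays by the closed form and \<open>v 2\<close> by the
  differentiated equation; the derivative in between follows by interpolation.\<close>

lemma v1_decay: "exp_decay (v 1)"
  by (rule exp_decay_interpolate[OF v_rules(1,2) v0_decay v2_decay])

lemma J1_decay: "exp_decay J1"
proof -
  have "exp_decay (\<lambda>x. d 1 x * v 0 x)" "exp_decay (\<lambda>x. \<phi> k x * v 1 x)" "exp_decay (\<lambda>x. 2 * \<phi> k x * d 1 x)"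
    using exp_decay_mult_left[OF d_bounded v0_decay, of 1] exp_decay_mult_left[OF phi_bounded v1_decay]
      exp_decay_mult_left[OF bounded_fun_mult[OF bounded_fun_const phi_bounded] d_decay, of 1 2] by simp_all
  then show ?thesis unfolding J1_def[abs_def] by (intro exp_decay_add exp_decay_cmult)
qed

lemma J2_decay: "exp_decay J2"
proof -
  have "exp_decay (\<lambda>x. d 2 x * v 0 x)" by (rule exp_decay_mult_left[OF d_bounded v0_decay])
  moreover have "exp_decay (\<lambda>x. 2 * d 1 x * v 1 x)"
    by (rule exp_decay_mult_left[OF bounded_fun_mult[OF bounded_fun_const d_bounded] v1_decay])
  moreover have "exp_decay (\<lambda>x. \<phi> k x * v 2 x)" by (rule exp_decay_mult_left[OF phi_bounded v2_decay])
  moreover have "exp_decay (\<lambda>x. 2 * d 1 x * d 1 x)"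
    by (rule exp_decay_mult_left[OF bounded_fun_mult[OF bounded_fun_const d_bounded] d_decay]) simp
  moreover have "exp_decay (\<lambda>x. 2 * \<phi> k x * d 2 x)"
    by (rule exp_decay_mult_left[OF bounded_fun_mult[OF bounded_fun_const phi_bounded] d_decay]) simp
  ultimately show ?thesis unfolding J2_def[abs_def] by (intro exp_decay_add exp_decay_cmult)
qed

lemma v_13_decay: "exp_decay (\<lambda>x. v 1 x - v 3 x)"
  unfolding v_13_eq by (intro exp_decay_add exp_decay_mult_left[OF K_bounded(1)] exp_decay_mult_left[OF K_bounded(2)] J_decay J1_decay)

lemma v_24_decay: "exp_decay (\<lambda>x. v 2 x - v 4 x)"
  unfolding v_24_eq
  by (intro exp_decay_add exp_decay_mult_left[OF K_bounded(1)] exp_decay_mult_left[OF K_bounded(2)]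
       exp_decay_mult_left[OF K_bounded(3)] J_decay J1_decay J2_decay)

section \<open>The preimage of the variational derivative\<close>

lemma a_powr_k: "((\<lambda>\<kappa>. nov_a c \<kappa> powr p) has_real_derivative p * a powr p * (1 / k - 3 * k / s0\<^sup>2)) (at k)"
proof -
  have "((\<lambda>\<kappa>. nov_a c \<kappa> powr p) has_real_derivative p * a powr (p - 1) * (s0 ^ 3 - 3 * k\<^sup>2 * s0)) (at k)"
    using DERIV_chain2[OF has_real_derivative_powr[OF a_pos] a_k] .
  moreover have "p * a powr (p - 1) * (s0 ^ 3 - 3 * k\<^sup>2 * s0) = p * a powr p * (1 / k - 3 * k / s0\<^sup>2)"
  proof -
    have r1: "a powr (p - 1) = a powr p / a" using a_pos by (simp add: powr_diff)
    have r2: "(s0 ^ 3 - 3 * k\<^sup>2 * s0) / a = 1 / k - 3 * k / s0\<^sup>2"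
      unfolding a_eq using k_pos s0_pos by (simp add: field_simps power2_eq_square power3_eq_cube)
    have "p * a powr (p - 1) * (s0 ^ 3 - 3 * k\<^sup>2 * s0) = p * a powr p * ((s0 ^ 3 - 3 * k\<^sup>2 * s0) / a)"
      unfolding r1 by simp
    then show ?thesis unfolding r2 .
  qed
  ultimately show ?thesis by simp
qed

definition \<omega>0' :: real where "\<omega>0' = - 2/3 * nov_omega0 c k * (1 / k - 3 * k / s0\<^sup>2)"
definition \<omega>1' :: real where
  "\<omega>1' = 9 * c * (- 4/3 * a powr (-4/3) * (1 / k - 3 * k / s0\<^sup>2)) * (2 * nov_E c k + c)
     + 9 * a powr (-4/3) * (2 * k * c - 8 * k ^ 3)"
text \<open>The factor by which the operator sends \<open>v 0 - v 2\<close> to the variational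
  derivative. It is positive because \<open>nov_omega0\<close> is negative, so dividing by it keeps
  the sign of the pairing.\<close>

definition ampl :: real where "ampl = - 2 * nov_omega0 c k * c / (k * s0\<^sup>2)"

lemma omega0_k: "(nov_omega0 c has_real_derivative \<omega>0') (at k)"
  unfolding nov_omega0_def[abs_def] \<omega>0'_def
  by (rule DERIV_cong[OF DERIV_cmult[OF a_powr_k]]) simp

lemma omega1_k: "(nov_omega1 c has_real_derivative \<omega>1') (at k)"
proof -
  have E: "(nov_E c has_real_derivative (2 * k * c - 8 * k ^ 3) / (2 * c)) (at k)"
    unfolding nov_E_def[abs_def]
    by (rule DERIV_cdivide)
       (auto intro!: derivative_eq_intros simp: algebra_simps power2_eq_square power3_eq_cube)
  show ?thesis
    unfolding nov_omega1_def[abs_def] \<omega>1'_def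
    by (rule DERIV_cong[OF DERIV_mult[OF DERIV_cmult[OF a_powr_k] DERIV_add[OF DERIV_cmult[OF E] DERIV_const]]])
       (use c_pos in \<open>simp add: field_simps\<close>)
qed

lemma ampl_pos: "ampl > 0"
  unfolding ampl_def nov_omega0_def using a_pos c_pos k_pos s0_pos by simp

text \<open>The coefficient of \<open>\<phi>\<close> in the image of \<open>v 0 - v 2\<close>:
  \<open>\<omega>0'\<close> arises from the \<open>k\<close>-derivative, \<open>16/3\<close> from
  homogeneity.\<close>

lemma coeff_omega0: "- 2 * \<omega>0' - 16/3 * nov_omega0 c k / k = 2 * ampl"
proof -
  have "c = s0\<^sup>2 + k\<^sup>2" using s0_sq by simp
  then have "c / (k * s0\<^sup>2) = 1 / k + k / s0\<^sup>2" using k_pos s0_pos by (simp add: field_simps power2_eq_square)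
  then have am: "ampl = - 2 * nov_omega0 c k * (1 / k + k / s0\<^sup>2)"
    unfolding ampl_def by (simp only: times_divide_eq_right[symmetric])
  show ?thesis unfolding \<omega>0'_def am by (simp add: algebra_simps)
qed

lemma a_powr_23: "a powr (-2/3) * (k\<^sup>2 * s0\<^sup>2) = k powr (4/3)"
proof -
  have "a = k * s0 powr 3" unfolding a_eq using s0_pos by (simp add: powr_numeral)
  then have "a powr (-2/3) = k powr (-2/3) * s0 powr (-2)"
    using k_pos s0_pos by (simp add: powr_mult powr_powr del: powr_numeral)
  moreover have "s0 powr (-2) * s0\<^sup>2 = 1" using s0_pos by (simp add: powr_minus powr_numeral)
  moreover have "k powr (-2/3) * k\<^sup>2 = k powr (4/3)"
  proof -
    have "k powr (-2/3) * k powr 2 = k powr (4/3)" by (subst powr_add[symmetric]) simp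
    then show ?thesis using k_pos by (simp add: powr_numeral)
  qed
  moreover have "k powr (-2/3) * s0 powr (-2) * (k\<^sup>2 * s0\<^sup>2) = (k powr (-2/3) * k\<^sup>2) * (s0 powr (-2) * s0\<^sup>2)"
    by (simp only: mult_ac)
  ultimately show ?thesis by simp
qed

text \<open>The coefficient of \<open>\<mu> powr (-1/3)\<close>, up to sign. That the same
  \<open>ampl\<close> appears as in \<open>coeff_omega0\<close>, now with
  \<open>k powr (4/3)\<close>, is what makes the image a multiple of \<open>nov_dF\<close>.\<close>

lemma coeff_omega1: "2/3 * \<omega>1' + 8/9 * nov_omega1 c k / k = 2 * ampl * k powr (4/3)"
proof -
  define A where "A = a powr (-2/3)"
  have A4: "a powr (-4/3) = A * A" unfolding A_def by (subst powr_add[symmetric]) simp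
  have E: "c * (2 * nov_E c k + c) = (c + 2 * k\<^sup>2) * s0\<^sup>2"
    unfolding nov_E_def s0_sq using c_pos by (simp add: field_simps power2_eq_square)
  have "2/3 * \<omega>1' + 8/9 * nov_omega1 c k / k
     = 6 * (A * A) * (- 4/3 * (1 / k - 3 * k / s0\<^sup>2)) * (c * (2 * nov_E c k + c)) + 6 * (A * A) * (2 * k * c - 8 * k ^ 3)
       + 8 * (A * A) * (c * (2 * nov_E c k + c)) / k"
    unfolding \<omega>1'_def nov_omega1_def A4 by (simp add: algebra_simps add_divide_distrib)
  also have "\<dots> = A * A * (36 * c * k)"
    unfolding E using k_pos s0_pos by (simp add: field_simps power2_eq_square power3_eq_cube)
  also have "\<dots> = 2 * ampl * (A * (k\<^sup>2 * s0\<^sup>2))"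
    unfolding ampl_def nov_omega0_def A_def[symmetric] using k_pos s0_pos by (simp add: field_simps power2_eq_square)
  finally show ?thesis unfolding A_def a_powr_23 .
qed

text \<open>The parameter derivative \<open>\<mu>\<^sub>k\<close> alone does not decay; subtracting \<open>\<mu> / k\<close>, on which the operator is computed
  by homogeneity, restores decay.\<close>

lemma nov_L_preimage:
  "nov_L c k \<mu> (\<lambda>x. complex_of_real ((v 0 x - v 2 x) / ampl)) (\<lambda>x. complex_of_real (nov_dF k \<mu> x))"
proof -
  obtain l u where lu: "l > 0" "\<And>x. l \<le> \<mu> x" "\<And>x. \<mu> x \<le> u" using mu_bounds by blast
  have Dm: "(\<mu> has_real_derivative d 1 x - d 3 x) (at x)"
    "((\<lambda>x. d 1 x - d 3 x) has_real_derivative d 2 x - d 4 x) (at x)" for x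
    unfolding mu_d using d_diff_deriv[of 0 x] d_diff_deriv[of 1 x]
    by (simp_all add: numeral_eq_Suc One_nat_def)
  have H: "helmholtz_inv (\<lambda>x. (v 0 x - v 2 x) / ampl) x = v 0 x / ampl" for x
  proof -
    have "helmholtz_inv (\<lambda>x. v 0 x - v 2 x) x = v 0 x"
      by (intro helmholtz_inv_eq[where ?u1.0="v 1"] v_rules v_cont exp_decay_imp_bounded v0_decay v1_decay v2_decay)
    then show ?thesis unfolding helmholtz_inv_def by simp
  qed
  show ?thesis
  proof (rule nov_L_classical[where ?f1.0="\<lambda>x. (v 1 x - v 3 x) / ampl" and ?f2.0="\<lambda>x. (v 2 x - v 4 x) / ampl",
          OF _ _ _ _ _ _ Dm _ lu])
    show "((\<lambda>x. (v 0 x - v 2 x) / ampl) has_real_derivative (v 1 x - v 3 x) / ampl) (at x)"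
      "((\<lambda>x. (v 1 x - v 3 x) / ampl) has_real_derivative (v 2 x - v 4 x) / ampl) (at x)" for x
      by (intro DERIV_cdivide DERIV_diff v_rules)+
    show "continuous_on UNIV (\<lambda>x. (v 2 x - v 4 x) / ampl)" using ampl_pos by (intro continuous_intros v_cont) auto
    show "exp_decay (\<lambda>x. (v 0 x - v 2 x) / ampl)" "exp_decay (\<lambda>x. (v 1 x - v 3 x) / ampl)" "exp_decay (\<lambda>x. (v 2 x - v 4 x) / ampl)"
      by (intro exp_decay_divide_const v_02_decay v_13_decay v_24_decay)+
    show "bounded_fun (\<lambda>x. d 1 x - d 3 x)" by (intro decay_intros d_bounded)
    show "exp_decay (nov_dF k \<mu>)" "continuous_on UNIV (nov_dF k \<mu>)"
      by (rule dF_decay dF_cont)+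
    fix x
    define y where "y n = \<mu> x powr (- real n / 3)" for n
    define m m1 m2 where "m = \<mu> x" and "m1 = d 1 x - d 3 x" and "m2 = d 2 x - d 4 x"
    define w0 w1 P where "w0 = nov_omega0 c k" and "w1 = nov_omega1 c k" and "P = \<phi> k x"
    have y: "\<mu> x powr (-14/3) = y 14" "\<mu> x powr (-11/3) = y 11" "\<mu> x powr (-8/3) = y 8" "\<mu> x powr (-5/3) = y 5"
       "\<mu> x powr (-4/3) = y 4" "\<mu> x powr (-1/3) = y 1"
      by (simp_all add: y_def)
    \<comment> \<open>The pointwise operator with the function, its two derivatives and its
      Helmholtz inverse as independent slots, so that linearity is pure algebra.\<close>
    define Lf where "Lf f0 f1 f2 g = 2/3 * (- 3 * (y 8 * f2 - 8/3 * y 11 * m1 * f1)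
          + (8 * m2 * y 11 - 44/3 * m1\<^sup>2 * y 14 + 15 * y 8) * f0) - 2 * w1 / 9 * y 4 * f0 + 2 * w0 * g" for f0 f1 f2 g
    have shift: "y (n + 3) * m = y n" for n
    proof -
      have "y (n + 3) * m = \<mu> x powr (- real (n + 3) / 3 + 1)"
        unfolding y_def m_def powr_add using mu_pos[of x] by simp
      also have "- real (n + 3) / 3 + 1 = - real n / 3" by (simp add: field_simps)
      finally show ?thesis by (simp add: y_def)
    qed
    have sh: "y 14 * m = y 11" "y 11 * m = y 8" "y 8 * m = y 5" "y 4 * m = y 1"
      using shift[of 11] shift[of 8] shift[of 5] shift[of 1] by simp_all
    have EL: "8/3 * y 11 * m1\<^sup>2 - 2 * y 8 * m2 - 6 * y 5 + 2/3 * w1 * y 1 + 2 * w0 * P = 0"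
      using EL_equation[of x] unfolding y by (simp add: m1_def m2_def w1_def w0_def P_def)
    \<comment> \<open>The first three Euler-Lagrange terms have degree \<open>-5/3\<close> in
      \<open>\<mu>\<close>, the others \<open>-1/3\<close> and \<open>1\<close>. Eliminating the
      first three leaves \<open>(5/3 - 1/3) * 2/3 = 8/9\<close> and
      \<open>(5/3 + 1) * 2 = 16/3\<close>.\<close>
    have LD: "Lf m m1 m2 P = 8/9 * w1 * y 1 + 16/3 * w0 * P"
    proof -
      have "Lf m m1 m2 P = 10/3 * y 8 * m2 - 40/9 * y 11 * m1\<^sup>2 + 10 * y 5 - 2/9 * w1 * y 1 + 2 * w0 * P"
        unfolding Lf_def sh[symmetric] by algebra
      then show ?thesis using EL by linarith
    qed
    have LE: "Lf (e 0 x - e 2 x) (e 1 x - e 3 x) (e 2 x - e 4 x) (e 0 x) = - (2/3 * \<omega>1' * y 1 + 2 * \<omega>0' * P)"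
    proof -
      have "\<forall>\<^sub>F r in nhds k. r \<in> I" by (rule eventually_nhds_in_open) (use k_in in auto)
      then have ev: "\<forall>\<^sub>F r in nhds k. 8/3 * momentum (\<phi> r) x powr (-11/3) * (deriv_n 1 (\<phi> r) x - deriv_n 3 (\<phi> r) x)\<^sup>2
         - 2 * momentum (\<phi> r) x powr (-8/3) * (deriv_n 2 (\<phi> r) x - deriv_n 4 (\<phi> r) x) - 6 * momentum (\<phi> r) x powr (-5/3)
        + 2/3 * nov_omega1 c r * momentum (\<phi> r) x powr (-1/3) + 2 * nov_omega0 c r * \<phi> r x = 0"
        by eventually_elim (rule novikov_wave.EL_equation[OF wave])
      show ?thesis
        using EL_linearization[OF momentum_k[OF k_in] DERIV_diff[OF deriv_n_k[OF k_in] deriv_n_k[OF k_in]]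
            DERIV_diff[OF deriv_n_k[OF k_in] deriv_n_k[OF k_in]] phi_k[OF k_in] omega1_k omega0_k mu_pos ev]
        unfolding y Lf_def by (simp add: m1_def m2_def w1_def w0_def P_def)
    qed
    have lin: "Lf (f0 - g0 / k) (f1 - g1 / k) (f2 - g2 / k) (f3 - g3 / k) = Lf f0 f1 f2 f3 - Lf g0 g1 g2 g3 / k" for f0 f1 f2 f3 g0 g1 g2 g3
    proof -
      define B1 B2 B3 B4 where "B1 = y 8" and "B2 = 8/3 * y 11 * m1" and "B3 = 8 * m2 * y 11 - 44/3 * m1\<^sup>2 * y 14 + 15 * y 8" and "B4 = 2 * w1 / 9 * y 4"
      show ?thesis
        unfolding Lf_def B1_def[symmetric] B2_def[symmetric] B3_def[symmetric] B4_def[symmetric]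
        by (simp add: algebra_simps diff_divide_distrib add_divide_distrib)
    qed
    have "Lf (v 0 x - v 2 x) (v 1 x - v 3 x) (v 2 x - v 4 x) (v 0 x)
      = Lf ((e 0 x - e 2 x) - m / k) ((e 1 x - e 3 x) - m1 / k) ((e 2 x - e 4 x) - m2 / k) (e 0 x - P / k)"
      unfolding m_def m1_def m2_def P_def mu_d by (simp add: v_def d_0 diff_divide_distrib algebra_simps)
    also have "\<dots> = - (2/3 * \<omega>1' * y 1 + 2 * \<omega>0' * P) - (8/9 * w1 * y 1 + 16/3 * w0 * P) / k"
      unfolding lin LD LE ..
    also have "\<dots> = (- 2 * \<omega>0' - 16/3 * w0 / k) * P - (2/3 * \<omega>1' + 8/9 * w1 / k) * y 1"
      by (simp add: algebra_simps add_divide_distrib)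
    also have "\<dots> = 2 * ampl * P - 2 * ampl * k powr (4/3) * y 1"
      unfolding w0_def w1_def coeff_omega0 coeff_omega1 ..
    also have "\<dots> = ampl * nov_dF k \<mu> x"
      unfolding nov_dF_def helmholtz_mu y P_def by (simp add: algebra_simps)
    finally have main: "Lf (v 0 x - v 2 x) (v 1 x - v 3 x) (v 2 x - v 4 x) (v 0 x) = ampl * nov_dF k \<mu> x" .
    have scale: "Lf (f0 / A) (f1 / A) (f2 / A) (f3 / A) = Lf f0 f1 f2 f3 / A" for f0 f1 f2 f3 A
    proof -
      define B1 B2 B3 B4 where "B1 = y 8" and "B2 = 8/3 * y 11 * m1" and "B3 = 8 * m2 * y 11 - 44/3 * m1\<^sup>2 * y 14 + 15 * y 8" and "B4 = 2 * w1 / 9 * y 4"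
      show ?thesis
        unfolding Lf_def B1_def[symmetric] B2_def[symmetric] B3_def[symmetric] B4_def[symmetric]
        by (simp add: algebra_simps diff_divide_distrib add_divide_distrib)
    qed
    have "nov_dF k \<mu> x = Lf ((v 0 x - v 2 x) / ampl) ((v 1 x - v 3 x) / ampl) ((v 2 x - v 4 x) / ampl) (v 0 x / ampl)"
      unfolding scale main using ampl_pos by simp
    then show "nov_dF k \<mu> x = 2/3 * (- 3 * (\<mu> x powr (-8/3) * ((v 2 x - v 4 x) / ampl) - 8/3 * \<mu> x powr (-11/3) * (d 1 x - d 3 x) * ((v 1 x - v 3 x) / ampl))
          + (8 * (d 2 x - d 4 x) * \<mu> x powr (-11/3) - 44/3 * (d 1 x - d 3 x)\<^sup>2 * \<mu> x powr (-14/3) + 15 * \<mu> x powr (-8/3)) * ((v 0 x - v 2 x) / ampl))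
        - 2 * nov_omega1 c k / 9 * \<mu> x powr (-4/3) * ((v 0 x - v 2 x) / ampl) + 2 * nov_omega0 c k * helmholtz_inv (\<lambda>x. (v 0 x - v 2 x) / ampl) x"
      unfolding y H Lf_def m1_def m2_def w1_def w0_def .
  qed
qed

section \<open>The derivative of the functional along the family\<close>

definition flux_k :: "real \<Rightarrow> real" where
  "flux_k x = - 2 * k * wave_Z b (q x) + (c - k\<^sup>2) * wave_dZ b b' (q x) (q_k x)"

lemma flux_k: "((\<lambda>\<kappa>. (c - \<kappa>\<^sup>2) * wave_Z (wave_b c \<kappa>) (wave_q c \<kappa> (\<phi> \<kappa>) x)) has_real_derivative flux_k x) (at k)"
proof -
  have 1: "((\<lambda>\<kappa>. c - \<kappa>\<^sup>2) has_real_derivative - 2 * k) (at k)" by (auto intro!: derivative_eq_intros)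
  have 2: "((\<lambda>\<kappa>. wave_Z (wave_b c \<kappa>) (wave_q c \<kappa> (\<phi> \<kappa>) x)) has_real_derivative wave_dZ b b' (q x) (q_k x)) (at k)"
    by (rule wave_Z_deriv[OF _ b_k refl q_k_deriv refl]) (use b_pos in simp)
  show ?thesis
    by (rule DERIV_cong[OF DERIV_mult[OF 1 2]]) (simp add: flux_k_def)
qed

lemma density_k_cont_x: "continuous_on A (density_k k)"
proof -
  have "continuous_on A (\<lambda>x. (\<lambda>(\<kappa>, x). density_k \<kappa> x) (k, x))"
    by (rule continuous_on_compose2[OF density_k_cont[of A]]) (use k_in in \<open>auto intro!: continuous_intros\<close>)
  then show ?thesis by simp
qed

text \<open>On a compact interval joint continuity suffices for the Leibniz rule; the explicit
  primitive identifies the result with a difference of boundary values.\<close>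

lemma integral_density_k:
  assumes "\<alpha> \<le> \<beta>"
  shows "integral {\<alpha>..\<beta>} (density_k k) = flux_k \<beta> - flux_k \<alpha>"
proof -
  have prim: "(wave_density \<kappa> (\<phi> \<kappa>) has_integral
      ((c - \<kappa>\<^sup>2) * wave_Z (wave_b c \<kappa>) (wave_q c \<kappa> (\<phi> \<kappa>) \<beta>) - (c - \<kappa>\<^sup>2) * wave_Z (wave_b c \<kappa>) (wave_q c \<kappa> (\<phi> \<kappa>) \<alpha>))) {\<alpha>..\<beta>}"
    if "\<kappa> \<in> I" for \<kappa>
    using novikov_wave.density_primitive[OF wave[OF that]]
    by (intro fundamental_theorem_of_calculus[OF assms])
       (auto simp: has_real_derivative_iff_has_vector_derivative[symmetric] intro: has_field_derivative_at_within)
  have "((\<lambda>\<kappa>. integral (cbox \<alpha> \<beta>) (wave_density \<kappa> (\<phi> \<kappa>))) has_real_derivative integral (cbox \<alpha> \<beta>) (density_k k)) (at k within I)"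
  proof (rule leibniz_rule_field_derivative)
    show "((\<lambda>\<kappa>. wave_density \<kappa> (\<phi> \<kappa>) x) has_real_derivative density_k \<kappa> x) (at \<kappa> within I)" if "\<kappa> \<in> I" for \<kappa> x
      using density_k_deriv[OF that] by (rule has_field_derivative_at_within)
    show "wave_density \<kappa> (\<phi> \<kappa>) integrable_on cbox \<alpha> \<beta>" if "\<kappa> \<in> I" for \<kappa>
      using prim[OF that] by auto
    show "continuous_on (I \<times> cbox \<alpha> \<beta>) (\<lambda>(\<kappa>, x). density_k \<kappa> x)" by (rule density_k_cont)
  qed (use k_in in auto)
  then have "((\<lambda>\<kappa>. integral {\<alpha>..\<beta>} (wave_density \<kappa> (\<phi> \<kappa>))) has_real_derivative integral {\<alpha>..\<beta>} (density_k k)) (at k)"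
    using k_in by (simp add: at_within_open[of k I])
  then have "((\<lambda>\<kappa>. (c - \<kappa>\<^sup>2) * wave_Z (wave_b c \<kappa>) (wave_q c \<kappa> (\<phi> \<kappa>) \<beta>) - (c - \<kappa>\<^sup>2) * wave_Z (wave_b c \<kappa>) (wave_q c \<kappa> (\<phi> \<kappa>) \<alpha>))
      has_real_derivative integral {\<alpha>..\<beta>} (density_k k)) (at k)"
    by (rule transform_k[OF k_in]) (rule integral_unique[OF prim])
  then show ?thesis by (rule DERIV_unique) (intro DERIV_diff flux_k)
qed

text \<open>Exchanges the \<open>x\<close>- and \<open>k\<close>-derivatives of the primitive, by
  way of the compact-interval formula instead of differentiating \<open>q_k\<close> in
  \<open>x\<close>.\<close>

lemma flux_k_deriv: "(flux_k has_real_derivative density_k k x) (at x)"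
proof -
  have "((\<lambda>y. integral {x - 1..y} (density_k k)) has_real_derivative density_k k x) (at x within {x - 1..x + 1})"
    by (rule integral_has_real_derivative[OF density_k_cont_x]) auto
  then have "((\<lambda>y. integral {x - 1..y} (density_k k)) has_real_derivative density_k k x) (at x)"
    by (simp add: at_within_Icc_at)
  then have "((\<lambda>y. integral {x - 1..y} (density_k k) + flux_k (x - 1)) has_real_derivative density_k k x + 0) (at x)"
    by (intro DERIV_add DERIV_const)
  then have 1: "((\<lambda>y. integral {x - 1..y} (density_k k) + flux_k (x - 1)) has_real_derivative density_k k x) (at x)" by simp
  show ?thesis
    by (rule has_field_derivative_transform_within_open[OF 1, of "{x - 1<..}"]) (auto simp: integral_density_k)
qed

lemma q_k_tendsto_top: "(q_k \<longlongrightarrow> Q') at_top"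
proof -
  have "((\<lambda>x. (q x * q_k x - Q * Q') + Q * Q') \<longlongrightarrow> 0 + Q * Q') at_top"
    by (intro tendsto_add tendsto_const exp_decay_tendsto_top q_q_k_decay)
  then have "((\<lambda>x. q x * q_k x) \<longlongrightarrow> Q * Q') at_top" by simp
  then have "((\<lambda>x. q x * q_k x / q x) \<longlongrightarrow> Q * Q' / Q) at_top"
    by (intro tendsto_divide q_tendsto_top) (use Q_pos in auto)
  moreover have "\<forall>\<^sub>F x in at_top. q x * q_k x / q x = q_k x"
    using eventually_gt_at_top[of 0] by eventually_elim (use q_pos in fastforce)
  ultimately have "(q_k \<longlongrightarrow> Q * Q' / Q) at_top" by (rule Lim_transform_eventually)
  then show ?thesis using Q_pos by simp
qed

lemma q_k_odd: "q_k (- x) = - q_k x"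
proof -
  have "((\<lambda>\<kappa>. wave_q c \<kappa> (\<phi> \<kappa>) (- x)) has_real_derivative - q_k x) (at k)"
    by (rule transform_k[OF k_in DERIV_minus[OF q_k_deriv]]) (simp add: novikov_wave.q_odd[OF wave])
  from DERIV_unique[OF q_k_deriv this] show ?thesis .
qed

text \<open>The limit is half of the derivative in \<open>nov_F_deriv\<close>. This agreement
  replaces an interchange of \<open>k\<close>-derivative and integral over the whole line.\<close>

lemma flux_k_tendsto_top: "(flux_k \<longlongrightarrow> - 2 * k * wave_Z b Q + (c - k\<^sup>2) * wave_dZ b b' Q Q') at_top"
proof -
  have nz: "(1 - Q)\<^sup>2 + b\<^sup>2 \<noteq> 0" "(1 + Q)\<^sup>2 + b\<^sup>2 \<noteq> 0" using b_pos by auto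
  have "((\<lambda>x. wave_dZ b b' (q x) (q_k x)) \<longlongrightarrow> wave_dZ b b' Q Q') at_top"
    unfolding wave_dZ_def wave_M_def using nz
    by (intro tendsto_intros q_tendsto_top q_k_tendsto_top) auto
  then show ?thesis
    unfolding flux_k_def[abs_def]
    by (intro tendsto_add tendsto_mult tendsto_const isCont_tendsto_compose[OF wave_Z_cont] q_tendsto_top)
qed

lemma flux_k_odd: "flux_k (- x) = - flux_k x"
  unfolding flux_k_def q_odd q_k_odd wave_Z_minus wave_dZ_minus by simp

lemma flux_k_tendsto_bot: "(flux_k \<longlongrightarrow> - (- 2 * k * wave_Z b Q + (c - k\<^sup>2) * wave_dZ b b' Q Q')) at_bot"
  using tendsto_minus[OF flux_k_tendsto_top] by (simp add: filterlim_at_bot_mirror flux_k_odd)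

lemma nov_F_deriv:
  "((\<lambda>\<kappa>. nov_F \<kappa> (momentum (\<phi> \<kappa>))) has_real_derivative 2 * (- 2 * k * wave_Z b Q + (c - k\<^sup>2) * wave_dZ b b' Q Q')) (at k)"
proof -
  have 1: "((\<lambda>\<kappa>. c - \<kappa>\<^sup>2) has_real_derivative - 2 * k) (at k)" by (auto intro!: derivative_eq_intros)
  have 2: "((\<lambda>\<kappa>. wave_Z (wave_b c \<kappa>) (wave_Q c \<kappa>)) has_real_derivative wave_dZ b b' Q Q') (at k)"
    by (rule wave_Z_deriv[OF _ b_k refl Q_k refl]) (use b_pos in simp)
  have "((\<lambda>\<kappa>. 2 * ((c - \<kappa>\<^sup>2) * wave_Z (wave_b c \<kappa>) (wave_Q c \<kappa>))) has_real_derivative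
      2 * (- 2 * k * wave_Z b Q + wave_dZ b b' Q Q' * (c - k\<^sup>2))) (at k)"
    by (intro DERIV_cmult DERIV_mult 1 2)
  then have "((\<lambda>\<kappa>. 2 * ((c - \<kappa>\<^sup>2) * wave_Z (wave_b c \<kappa>) (wave_Q c \<kappa>))) has_real_derivative
      2 * (- 2 * k * wave_Z b Q + (c - k\<^sup>2) * wave_dZ b b' Q Q')) (at k)" by (simp only: mult.commute)
  then show ?thesis
    by (rule transform_k[OF k_in]) (simp add: novikov_wave.nov_F_eq[OF wave] mult.assoc)
qed

text \<open>The chain rule at each \<open>x\<close>, with \<open>f = v 0 - v 2\<close>. Homogeneity
  of degree 2 gives the last term; the middle bracket is the pointwise defect in the symmetry of the
  Helmholtz inverse and integrates to 0.\<close>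

lemma density_k_eq:
  "density_k k x = (v 0 x - v 2 x) * nov_dF k \<mu> x - (\<phi> k x * (v 0 x - v 2 x) - \<mu> x * v 0 x) + 2 / k * wave_density k (\<phi> k) x"
proof -
  define m P f V where "m = \<mu> x" and "P = \<phi> k x" and "f = v 0 x - v 2 x" and "V = v 0 x"
  define \<alpha> \<beta> \<gamma> where "\<alpha> = k powr (1/3)" and "\<beta> = m powr (2/3)" and "\<gamma> = k powr (4/3) * m powr (-1/3)"
  have mD: "D 0 0 (k, x) - D 0 2 (k, x) = m" using momentum_D[OF k_in, of x] by (simp add: m_def)
  have e0: "D (Suc 0) 0 (k, x) = V + P / k" by (simp add: V_def v_def P_def d_0)
  have e02: "D (Suc 0) 0 (k, x) - D (Suc 0) 2 (k, x) = f + m / k"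
    using mu_d by (simp add: f_def v_def m_def diff_divide_distrib)
  have k1: "k powr (1/3) * k powr (2/3) = k" using k_pos by (subst powr_add[symmetric]) simp
  have k2: "k powr (4/3) * k powr (-1/3) = k" using k_pos by (subst powr_add[symmetric]) simp
  have k4: "k powr (4/3) = k * \<alpha>"
  proof -
    have "k powr (4/3) = k powr (1 + 1/3)" by simp
    then show ?thesis unfolding powr_add using k_pos by (simp add: \<alpha>_def)
  qed
  have g: "\<gamma> * m = k * \<alpha> * \<beta>"
  proof -
    have "m powr (-1/3) * m powr 1 = m powr (2/3)" by (subst powr_add[symmetric]) simp
    then have "m powr (-1/3) * m = \<beta>" using mu_pos[of x] by (simp add: m_def \<beta>_def)
    then show ?thesis by (simp add: \<gamma>_def k4)
  qed
  have k3: "k powr (4/3) * k powr (2/3) = k\<^sup>2"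
    using k_pos by (subst powr_add[symmetric]) (simp add: powr_numeral)
  have "density_k k x = (f + m / k) * P + m * (V + P / k) - 2 * k - 4 * (\<alpha> * \<beta> - k) - 2 * \<gamma> * (f + m / k) + 2 * k"
    unfolding density_k_def mD e02 unfolding e0 D_00[OF k_in] P_def[symmetric] \<alpha>_def \<beta>_def \<gamma>_def
    using k1 k2 by (simp add: algebra_simps)
  also have "2 * \<gamma> * (f + m / k) = 2 * \<gamma> * f + 2 * \<alpha> * \<beta>"
    using g k_pos by (simp add: field_simps)
  finally have 1: "density_k k x = (f + m / k) * P + m * (V + P / k) - 6 * \<alpha> * \<beta> + 4 * k - 2 * \<gamma> * f" by simp
  have "wave_density k (\<phi> k) x = m * P - k\<^sup>2 - 3 * (k * \<alpha> * \<beta> - k\<^sup>2)"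
    unfolding wave_density_def m_def[symmetric] P_def[symmetric] \<beta>_def[symmetric] using k3 by (simp add: k4 algebra_simps)
  then have 2: "2 / k * wave_density k (\<phi> k) x = 2 * (m * P) / k + 4 * k - 6 * \<alpha> * \<beta>"
    using k_pos by (simp add: field_simps power2_eq_square)
  have 3: "nov_dF k \<mu> x = 2 * P - 2 * \<gamma>"
    unfolding nov_dF_def helmholtz_mu by (simp add: P_def \<gamma>_def m_def)
  show ?thesis
    unfolding 1 2 3 f_def[symmetric] unfolding P_def[symmetric] m_def[symmetric] V_def[symmetric]
    by (simp add: algebra_simps)
qed

lemma inner_preimage:
  "integrable lborel (\<lambda>x. (v 0 x - v 2 x) * nov_dF k \<mu> x)"
  "(LINT x|lborel. (v 0 x - v 2 x) * nov_dF k \<mu> x)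
     = deriv (\<lambda>\<kappa>. nov_F \<kappa> (momentum (\<phi> \<kappa>))) k - 2 / k * nov_F k \<mu>"
proof -
  define S where "S = - 2 * k * wave_Z b Q + (c - k\<^sup>2) * wave_dZ b b' Q Q'"
  note dF = dF_decay dF_cont
  have f: "continuous_on UNIV (\<lambda>x. v 0 x - v 2 x)" by (intro continuous_intros v_cont)
  show i1: "integrable lborel (\<lambda>x. (v 0 x - v 2 x) * nov_dF k \<mu> x)"
    by (intro exp_decay_integrable exp_decay_mult_right[OF v_02_decay] exp_decay_imp_bounded dF continuous_on_mult f)
  have e2: "exp_decay (\<lambda>x. \<phi> k x * (v 0 x - v 2 x) - \<mu> x * v 0 x)"
    by (intro exp_decay_diff exp_decay_mult_left[OF phi_bounded v_02_decay] exp_decay_mult_left[OF mu_bounded v0_decay])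
  have c2: "continuous_on UNIV (\<lambda>x. \<phi> k x * (v 0 x - v 2 x) - \<mu> x * v 0 x)"
    by (intro continuous_intros phi_cont v_cont mu_cont)
  have i2: "integrable lborel (\<lambda>x. \<phi> k x * (v 0 x - v 2 x) - \<mu> x * v 0 x)"
    by (rule exp_decay_integrable[OF e2 c2])
  have i3: "integrable lborel (wave_density k (\<phi> k))"
    by (rule exp_decay_integrable[OF density_decay density_cont])
  have ik: "integrable lborel (density_k k)"
    unfolding density_k_eq[abs_def] using i1 i2 i3 by simp
  have "exp_decay (\<lambda>x. d 1 x * v 0 x - \<phi> k x * v 1 x)"
    by (intro exp_decay_diff exp_decay_mult_left[OF d_bounded v0_decay] exp_decay_mult_left[OF phi_bounded v1_decay])
  \<comment> \<open>The integrand is the derivative of \<open>\<phi>' * v 0 - \<phi> * v 1\<close>,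
    which vanishes at both ends by the decay of \<open>v 0\<close> and \<open>v 1\<close>.\<close>
  then have 2: "(LINT x|lborel. \<phi> k x * (v 0 x - v 2 x) - \<mu> x * v 0 x) = 0 - 0"
  proof (intro LINT_FTC_real[where B="\<lambda>x. d 1 x * v 0 x - \<phi> k x * v 1 x"] c2 i2 exp_decay_tendsto_top exp_decay_tendsto_bot)
    fix x
    have "((\<lambda>x. d 1 x * v 0 x - \<phi> k x * v 1 x) has_real_derivative
        (d 2 x * v 0 x + v 1 x * d 1 x) - (d 1 x * v 1 x + v 2 x * \<phi> k x)) (at x)"
      by (intro DERIV_diff DERIV_mult d1_deriv phi_deriv v_rules)
    moreover have "(d 2 x * v 0 x + v 1 x * d 1 x) - (d 1 x * v 1 x + v 2 x * \<phi> k x) = \<phi> k x * (v 0 x - v 2 x) - \<mu> x * v 0 x"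
      unfolding mu_d d_0 by (simp add: algebra_simps)
    ultimately show "((\<lambda>x. d 1 x * v 0 x - \<phi> k x * v 1 x) has_real_derivative \<phi> k x * (v 0 x - v 2 x) - \<mu> x * v 0 x) (at x)"
      by simp
  qed
  \<comment> \<open>The flux has opposite limits at the two ends, so the total is
    \<open>2 * S\<close>, the derivative found in \<open>nov_F_deriv\<close>.\<close>
  have k: "(LINT x|lborel. density_k k x) = S - - S"
    unfolding S_def
    by (rule LINT_FTC_real[OF flux_k_deriv density_k_cont_x ik flux_k_tendsto_top flux_k_tendsto_bot])
  have "(LINT x|lborel. density_k k x) = (LINT x|lborel. (v 0 x - v 2 x) * nov_dF k \<mu> x)
     - (LINT x|lborel. \<phi> k x * (v 0 x - v 2 x) - \<mu> x * v 0 x) + 2 / k * (LINT x|lborel. wave_density k (\<phi> k) x)"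
    unfolding density_k_eq
    by (subst Bochner_Integration.integral_add, use i1 i2 i3 in simp, use i3 in simp,
        subst Bochner_Integration.integral_diff, rule i1, rule i2) simp
  then show "(LINT x|lborel. (v 0 x - v 2 x) * nov_dF k \<mu> x)
     = deriv (\<lambda>\<kappa>. nov_F \<kappa> (momentum (\<phi> \<kappa>))) k - 2 / k * nov_F k \<mu>"
    unfolding k 2 nov_F_eq_density[symmetric] DERIV_imp_deriv[OF nov_F_deriv] S_def[symmetric] by simp
qed

lemma preimages_negative:
  assumes spec: "spectral_assumption (nov_L c k \<mu>)"
    and neg: "deriv (\<lambda>\<kappa>. nov_F \<kappa> (momentum (\<phi> \<kappa>))) k < 0"
    and w: "nov_L c k \<mu> w (\<lambda>x. complex_of_real (nov_dF k \<mu> x))"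
  shows "L2_inner w (\<lambda>x. complex_of_real (nov_dF k \<mu> x)) \<in> \<real> \<and>
    Re (L2_inner w (\<lambda>x. complex_of_real (nov_dF k \<mu> x))) < 0"
proof -
  define F where "F x = complex_of_real (nov_dF k \<mu> x)" for x
  define w0 where "w0 x = complex_of_real ((v 0 x - v 2 x) / ampl)" for x
  define p where "p x = complex_of_real (d 1 x - d 3 x)" for x
  \<comment> \<open>The assumption supplies some eigenfunction \<open>f0\<close> for 0. Both
    \<open>\<mu>'\<close> and the difference of two preimages are multiples of it, and
    \<open>\<beta> \<noteq> 0\<close> allows \<open>f0\<close> to be eliminated.\<close>
  obtain f0 where f0: "\<And>g. nov_L c k \<mu> g (\<lambda>x. 0 * g x) \<Longrightarrow> \<exists>b. AE x in lborel. g x = b * f0 x"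
    using spec unfolding spectral_assumption_def simple_eigenvalue_def by blast
  have "nov_L c k \<mu> p (\<lambda>x. 0 * p x)" using nov_L_mu' by (simp add: p_def[abs_def])
  then obtain \<beta> where \<beta>: "AE x in lborel. p x = \<beta> * f0 x" using f0 by blast
  have "\<beta> \<noteq> 0" using \<beta> mu'_not_AE_zero by (auto simp: p_def)
  have "nov_L c k \<mu> (\<lambda>x. w x - w0 x) (\<lambda>x. 0 * (w x - w0 x))"
    using nov_L_diff[OF w nov_L_preimage] by (simp add: w0_def[abs_def])
  then obtain \<gamma> where \<gamma>: "AE x in lborel. w x - w0 x = \<gamma> * f0 x" using f0 by blast
  have ae: "AE x in lborel. w x * F x = w0 x * F x + \<gamma> / \<beta> * (p x * F x)"
    using \<beta> \<gamma>
  proof eventually_elim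
    case (elim x)
    have "w x = w0 x + \<gamma> / \<beta> * p x" using elim \<open>\<beta> \<noteq> 0\<close> by (simp add: algebra_simps)
    then show ?case by (simp add: algebra_simps)
  qed
  note dF = dF_decay dF_cont
  have meas: "w \<in> borel_measurable borel" "F \<in> borel_measurable borel" "w0 \<in> borel_measurable borel" "p \<in> borel_measurable borel"
  proof -
    show "w \<in> borel_measurable borel" using w by (auto simp: nov_L_def weak_deriv_def L2_def)
    show "F \<in> borel_measurable borel" using exp_decay_L2[OF dF] by (simp add: F_def[abs_def] L2_def)
    show "w0 \<in> borel_measurable borel" using nov_L_preimage by (auto simp: nov_L_def weak_deriv_def L2_def w0_def[abs_def])
    show "p \<in> borel_measurable borel" using nov_L_mu' by (auto simp: nov_L_def weak_deriv_def L2_def p_def[abs_def])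
  qed
  have i1: "integrable lborel (\<lambda>x. (v 0 x - v 2 x) / ampl * nov_dF k \<mu> x)"
    using inner_preimage(1) by simp
  have i2: "integrable lborel (\<lambda>x. (d 1 x - d 3 x) * nov_dF k \<mu> x)"
    by (intro exp_decay_integrable exp_decay_mult_right exp_decay_diff d_decay exp_decay_imp_bounded dF continuous_intros d_cont) simp_all
  have w0F: "(\<lambda>x. w0 x * F x) = (\<lambda>x. complex_of_real ((v 0 x - v 2 x) / ampl * nov_dF k \<mu> x))"
    and pF: "(\<lambda>x. p x * F x) = (\<lambda>x. complex_of_real ((d 1 x - d 3 x) * nov_dF k \<mu> x))"
    by (simp_all add: w0_def p_def F_def)
  have "L2_inner w F = (LINT x|lborel. w0 x * F x + \<gamma> / \<beta> * (p x * F x))"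
  proof -
    have cF: "cnj (F x) = F x" for x by (simp add: F_def)
    note [measurable] = meas
    show ?thesis unfolding L2_inner_def cF by (intro integral_cong_AE ae) measurable
  qed
  also have "\<dots> = (LINT x|lborel. w0 x * F x) + (LINT x|lborel. \<gamma> / \<beta> * (p x * F x))"
    by (rule Bochner_Integration.integral_add)
       (use i1 i2 in \<open>simp_all only: w0F pF integrable_mult_right integrable_of_real\<close>)
  also have "(LINT x|lborel. \<gamma> / \<beta> * (p x * F x)) = \<gamma> / \<beta> * complex_of_real (LINT x|lborel. (d 1 x - d 3 x) * nov_dF k \<mu> x)"
    by (subst integral_mult_right_zero, subst pF, subst integral_complex_of_real) (rule refl)
  also have "(LINT x|lborel. w0 x * F x) = complex_of_real (LINT x|lborel. (v 0 x - v 2 x) / ampl * nov_dF k \<mu> x)"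
    by (subst w0F) (rule integral_complex_of_real)
  finally have inner: "L2_inner w F = complex_of_real (LINT x|lborel. (v 0 x - v 2 x) / ampl * nov_dF k \<mu> x)"
    unfolding integral_mu'_dF by simp
  have "(LINT x|lborel. (v 0 x - v 2 x) / ampl * nov_dF k \<mu> x) = (LINT x|lborel. (v 0 x - v 2 x) * nov_dF k \<mu> x) / ampl"
    by simp
  also have "\<dots> < 0"
  proof (rule divide_neg_pos[OF _ ampl_pos])
    \<comment> \<open>The first claim enters here: the pairing is \<open>F' - 2 F / k\<close>, which
      lies below \<open>F'\<close> because \<open>F > 0\<close>.\<close>
    have "2 / k * nov_F k \<mu> > 0" using nov_F_pos k_pos by simp
    then show "(LINT x|lborel. (v 0 x - v 2 x) * nov_dF k \<mu> x) < 0" unfolding inner_preimage(2) using neg by linarith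
  qed
  finally show ?thesis using inner unfolding F_def[abs_def] by simp
qed

end

theorem lemma4p9:
  fixes c :: real and \<phi> :: "real \<Rightarrow> real \<Rightarrow> real"
  assumes "c > 0"
    and "\<And>k. k \<in> {0<..<sqrt c / 2} \<Longrightarrow> solitary_profile c k (\<phi> k)"
    and "jointly_smooth_on ({0<..<sqrt c / 2} \<times> UNIV) \<phi>"
  shows "(\<forall>k\<in>{0<..<sqrt c / 2}. nov_F k (momentum (\<phi> k)) > 0) \<and>
    (\<forall>k\<in>{0<..<sqrt c / 2}.
       let \<mu> = momentum (\<phi> k);
           L = nov_L c k \<mu>;
           dF = (\<lambda>x. complex_of_real (nov_dF k \<mu> x))
       in spectral_assumption L \<longrightarrow>
          deriv (\<lambda>\<kappa>. nov_F \<kappa> (momentum (\<phi> \<kappa>))) k < 0 \<longrightarrow>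
          (\<exists>w. L w dF) \<and>
          (\<forall>w. L w dF \<longrightarrow> L2_inner w dF \<in> \<real> \<and> Re (L2_inner w dF) < 0))"
proof -
  obtain D :: "nat \<Rightarrow> nat \<Rightarrow> real \<times> real \<Rightarrow> real" where D:
    "\<forall>p\<in>{0<..<sqrt c / 2} \<times> UNIV. D 0 0 p = \<phi> (fst p) (snd p)"
    "\<forall>i j. \<forall>p\<in>{0<..<sqrt c / 2} \<times> UNIV. (D i j has_derivative
            (\<lambda>h. D (Suc i) j p * fst h + D i (Suc j) p * snd h)) (at p)"
    using assms(3) unfolding jointly_smooth_on_def by blast
  interpret novikov_family c \<phi> D
    using assms(1,2) D by unfold_locales auto
  have at: "novikov_family_at c \<phi> D k" if "k \<in> {0<..<sqrt c / 2}" for k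
    using that by unfold_locales
  show ?thesis
    unfolding Let_def
    using novikov_wave.nov_F_pos[OF wave] novikov_family_at.nov_L_preimage[OF at]
      novikov_family_at.preimages_negative[OF at]
    by blast
qed

end
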